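(* Let $X$ be a Markov shift with $X^\#\neq\emptyset$, let $(T,Y)$ be a dynamical system, and let $\pi:X^\#\to Y$ be an excellent semiconjugacy. Then there exist another Markov shift $\hat X$ and a semiconjugacy $\hat\pi:\hat X^\#\to Y$ such that: <br/>(1) $\hat\pi:\hat X^\#\to Y$ is an excellent semiconjugacy. Moreover, if $\pi$ admits a multiplicity bound, so does $\hat\pi$; <br/>(2) if $X$ is locally compact, so is $\hat X$; <br/>(3) $\hat\pi=\pi\circ q|_{\hat X^\#}$ where $q:\hat X\to X$ is a $1$-Lipschitz map with $q(\hat X^\#)\subset X^\#$; <br/>(4) $q:\hat X^\#\to X^\#$ is proper, i.e., $q^{-1}(K)\cap\hat X^\#$ is compact for any compact $K\subset X^\#$; <br/>(5') $\hat\pi(\hat X^\#)\subset\pi(X^\#)$ and the difference is a null set; <br/>(6') there is a word $\hat W\in\mathcal L(\hat X^{\mathrm{rec}})$ such that for any $x\in\hat X$ that sees i.o. $\hat W$, $\hat\pi^{-1}(\hat\pi(x))=\{x\}$; <br/>(7') if $X$ is irreducible, then so is $\hat X$.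
   Context: A dynamical system $(T,Y)$ is a Borel automorphism of a standard Borel space; all measures are ergodic, invariant, Borel probability measures. A subset of $Y$ is null if its complement has measure $1$ for all ergodic $T$-invariant Borel probability measures. A symbolic system $(S,X)$ over a countable (possibly finite) alphabet $\mathcal A$ is a shift-invariant subset $X\subset\mathcal A^{\mathbb Z}$ with the shift $S:(x_n)\mapsto(x_{n+1})$ and distance $d(x,y)=\exp(-\inf\{|n|:x_n\neq y_n\})$. A Markov shift is the symbolic system of bi-infinite paths on a simple directed graph with vertex set $\mathcal A$ (at most one arrow from $a$ to $b$); it is irreducible if for any two symbols $a,b$ there is a path from $a$ to $b$ on the graph. Its regular part $X^\#$ is the set of $x\in X$ for which there are $u,v\in\mathcal A$ such that $\{n\ge0:x_{-n}=u\}$ and $\{n\ge0:x_n=v\}$ are both infinite. Words: a word $w$ of length $|w|$ occurs in $x$ at $n$ if $x_nx_{n+1}\cdots x_{n+|w|-1}=w$; $\mathcal L(Z)$ is the set of words occurring in elements of $Z$. A point $x$ sees $w$ i.o. if $w$ occurs in $x$ infinitely often in both $x_{(-\infty,0]}$ and $x_{[0,\infty)}$. $X^{\mathrm{rec}}\subset X$ is the set of $x$ such that every word occurring in $x$ is seen i.o. by $x$. A semiconjugacy $\pi:(S,Z)\to(T,Y)$ is a map $\pi:Z\to Y$ (not necessarily onto) with $\pi\circ S=T\circ\pi$. A semiconjugacy $\pi$ on a symbolic system $Z\subset\mathcal A^{\mathbb Z}$ is excellent if it is Borel, finite-to-one (every $\pi^{-1}(y)$, $y\in Y$, is finite), and there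 is a reflexive, symmetric and locally finite relation $\sim$ on $\mathcal A$ (locally finite: $\{b:b\sim a\}$ is finite for each $a\in\mathcal A$) such that for all $x,y\in Z$: $\pi(x)=\pi(y)\iff\forall n\in\mathbb Z\ x_n\sim y_n$. A function $C:\mathcal A\times\mathcal A\to\{0,1,2,\dots\}$ is a multiplicity bound for $\pi:X^\#\to Y$ if for all $x\in X^\#$, $|\pi^{-1}(\pi(x))|\le C(a,b)$ for every $(a,b)\in\mathcal A\times\mathcal A$ such that $x_{-n}=a$ for infinitely many positive integers $n$ and $x_n=b$ for infinitely many positive integers $n$. A map $q$ between metric spaces is $1$-Lipschitz if $d(q(x),q(y))\le d(x,y)$ (it need not commute with the shifts). *)

theory Defs
  imports "HOL-Probability.Probability"
begin

definition borel_of_top :: "'a topology \<Rightarrow> 'a measure" where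
  "borel_of_top T = sigma (topspace T) {U. openin T U}"

definition standard_borel :: "'y measure \<Rightarrow> bool" where
  "standard_borel M \<longleftrightarrow>
     (\<exists>T. completely_metrizable_space T \<and> second_countable T \<and> sets M = sets (borel_of_top T))"

definition borel_automorphism :: "'y measure \<Rightarrow> ('y \<Rightarrow> 'y) \<Rightarrow> bool" where
  "borel_automorphism M T \<longleftrightarrow>
     bij_betw T (space M) (space M) \<and> T \<in> M \<rightarrow>\<^sub>M M \<and> the_inv_into (space M) T \<in> M \<rightarrow>\<^sub>M M"

definition dynamical_system :: "('y \<Rightarrow> 'y) \<Rightarrow> 'y measure \<Rightarrow> bool" where
  "dynamical_system T M \<longleftrightarrow> standard_borel M \<and> borel_automorphism M T"

definition invariant_prob :: "('y \<Rightarrow> 'y) \<Rightarrow> 'y measure \<Rightarrow> 'y measure \<Rightarrow> bool" where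
  "invariant_prob T M \<mu> \<longleftrightarrow> sets \<mu> = sets M \<and> prob_space \<mu> \<and> distr \<mu> M T = \<mu>"

definition ergodic_prob :: "('y \<Rightarrow> 'y) \<Rightarrow> 'y measure \<Rightarrow> 'y measure \<Rightarrow> bool" where
  "ergodic_prob T M \<mu> \<longleftrightarrow> invariant_prob T M \<mu> \<and>
     (\<forall>B\<in>sets M. T -` B \<inter> space M = B \<longrightarrow> emeasure \<mu> B = 0 \<or> emeasure \<mu> B = 1)"

text \<open>Null sets are arbitrary subsets of the phase space, hence the completion; on Borel sets
  the completed measure agrees with the original one.\<close>

definition null_subset :: "('y \<Rightarrow> 'y) \<Rightarrow> 'y measure \<Rightarrow> 'y set \<Rightarrow> bool" where
  "null_subset T M N \<longleftrightarrow> N \<subseteq> space M \<and>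
     (\<forall>\<mu>. ergodic_prob T M \<mu> \<longrightarrow> emeasure (completion \<mu>) (space M - N) = 1)"

definition left_shift :: "(int \<Rightarrow> 'a) \<Rightarrow> (int \<Rightarrow> 'a)" where
  "left_shift x = (\<lambda>n. x (n + 1))"

text \<open>The first case is the convention that the infimum of the empty set is \<open>\<infinity>\<close>.\<close>

definition symb_dist :: "(int \<Rightarrow> 'a) \<Rightarrow> (int \<Rightarrow> 'a) \<Rightarrow> real" where
  "symb_dist x y =
     (if x = y then 0 else exp (- real (Inf {nat \<bar>n\<bar> | n. x n \<noteq> y n})))"

lemma symb_dist_ultra: "symb_dist x z \<le> max (symb_dist x y) (symb_dist y z)"
proof (cases "x = y \<or> y = z \<or> x = z")
  case True
  then show ?thesis by (auto simp: symb_dist_def le_max_iff_disj)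
next
  case False
  define D where "D u v = {nat \<bar>n\<bar> | n. u n \<noteq> v n}" for u v :: "int \<Rightarrow> 'a"
  have "D x z \<noteq> {}" using False by (auto simp: D_def fun_eq_iff)
  then have "Inf (D x z) \<in> D x z" by (rule Inf_nat_def1)
  then have "Inf (D x z) \<in> D x y \<or> Inf (D x z) \<in> D y z"
    by (auto simp: D_def)
  then have "Inf (D x y) \<le> Inf (D x z) \<or> Inf (D y z) \<le> Inf (D x z)"
    by (auto intro: wellorder_Inf_le1)
  with False show ?thesis by (auto simp: symb_dist_def D_def le_max_iff_disj)
qed

lemma Metric_space_symb_dist: "Metric_space Z symb_dist"
proof
  fix x y z :: "int \<Rightarrow> 'a"
  show "0 \<le> symb_dist x y" by (simp add: symb_dist_def)
  show "symb_dist x y = symb_dist y x" by (simp add: symb_dist_def eq_commute)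
  show "symb_dist x y = 0 \<longleftrightarrow> x = y" by (simp add: symb_dist_def)
  have "0 \<le> symb_dist x y" "0 \<le> symb_dist y z" by (simp_all add: symb_dist_def)
  then show "symb_dist x z \<le> symb_dist x y + symb_dist y z"
    using symb_dist_ultra[of x z y] by linarith
qed

definition symb_top :: "(int \<Rightarrow> 'a) set \<Rightarrow> (int \<Rightarrow> 'a) topology" where
  "symb_top Z = Metric_space.mtopology Z symb_dist"

definition occurs_at :: "'a list \<Rightarrow> (int \<Rightarrow> 'a) \<Rightarrow> int \<Rightarrow> bool" where
  "occurs_at w x n \<longleftrightarrow> (\<forall>i<length w. x (n + int i) = w ! i)"

definition language :: "(int \<Rightarrow> 'a) set \<Rightarrow> 'a list set" where
  "language Z = {w. w \<noteq> [] \<and> (\<exists>x\<in>Z. \<exists>n. occurs_at w x n)}"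

definition sees_io :: "(int \<Rightarrow> 'a) \<Rightarrow> 'a list \<Rightarrow> bool" where
  "sees_io x w \<longleftrightarrow>
     infinite {n. occurs_at w x n \<and> n + int (length w) - 1 \<le> 0} \<and>
     infinite {n. occurs_at w x n \<and> 0 \<le> n}"

definition rec_part :: "(int \<Rightarrow> 'a) set \<Rightarrow> (int \<Rightarrow> 'a) set" where
  "rec_part X = {x \<in> X. \<forall>w n. occurs_at w x n \<longrightarrow> sees_io x w}"

definition regular_part :: "(int \<Rightarrow> 'a) set \<Rightarrow> (int \<Rightarrow> 'a) set" where
  "regular_part X = {x \<in> X. \<exists>u v. infinite {n::nat. x (- int n) = u} \<and>
                                   infinite {n::nat. x (int n) = v}}"

text \<open>A simple directed graph is a countable vertex set with a set of ordered pairs of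
  vertices; loops are allowed.\<close>

definition shift_graph :: "'a set \<Rightarrow> ('a \<times> 'a) set \<Rightarrow> bool" where
  "shift_graph A E \<longleftrightarrow> countable A \<and> E \<subseteq> A \<times> A"

definition markov_shift :: "('a \<times> 'a) set \<Rightarrow> (int \<Rightarrow> 'a) set" where
  "markov_shift E = {x. \<forall>n. (x n, x (n + 1)) \<in> E}"

definition irreducible_graph :: "'a set \<Rightarrow> ('a \<times> 'a) set \<Rightarrow> bool" where
  "irreducible_graph A E \<longleftrightarrow> (\<forall>a\<in>A. \<forall>b\<in>A. (a, b) \<in> E\<^sup>+)"

definition semiconjugacy ::
  "(int \<Rightarrow> 'a) set \<Rightarrow> ('y \<Rightarrow> 'y) \<Rightarrow> 'y measure \<Rightarrow> ((int \<Rightarrow> 'a) \<Rightarrow> 'y) \<Rightarrow> bool" where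
  "semiconjugacy Z T M p \<longleftrightarrow>
     p \<in> Z \<rightarrow> space M \<and> (\<forall>x\<in>Z. p (left_shift x) = T (p x))"

definition locally_finite_on :: "'a set \<Rightarrow> ('a \<times> 'a) set \<Rightarrow> bool" where
  "locally_finite_on A R \<longleftrightarrow> (\<forall>a\<in>A. finite {b \<in> A. (b, a) \<in> R})"

definition excellent ::
  "'a set \<Rightarrow> (int \<Rightarrow> 'a) set \<Rightarrow> ('y \<Rightarrow> 'y) \<Rightarrow> 'y measure \<Rightarrow> ((int \<Rightarrow> 'a) \<Rightarrow> 'y) \<Rightarrow> bool" where
  "excellent A Z T M p \<longleftrightarrow>
     semiconjugacy Z T M p \<and>
     p \<in> borel_of_top (symb_top Z) \<rightarrow>\<^sub>M M \<and>
     (\<forall>y\<in>space M. finite {x \<in> Z. p x = y}) \<and>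
     (\<exists>R. R \<subseteq> A \<times> A \<and> refl_on A R \<and> sym R \<and> locally_finite_on A R \<and>
          (\<forall>x\<in>Z. \<forall>y\<in>Z. p x = p y \<longleftrightarrow> (\<forall>n. (x n, y n) \<in> R)))"

text \<open>Finiteness of the fibre is stated because \<open>card\<close> is 0 on infinite sets.\<close>

definition multiplicity_bound ::
  "'a set \<Rightarrow> (int \<Rightarrow> 'a) set \<Rightarrow> ((int \<Rightarrow> 'a) \<Rightarrow> 'y) \<Rightarrow> ('a \<Rightarrow> 'a \<Rightarrow> nat) \<Rightarrow> bool" where
  "multiplicity_bound A Z p C \<longleftrightarrow>
     (\<forall>x\<in>Z. \<forall>a\<in>A. \<forall>b\<in>A.
        infinite {n::nat. 0 < n \<and> x (- int n) = a} \<and>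
        infinite {n::nat. 0 < n \<and> x (int n) = b} \<longrightarrow>
        finite {z \<in> Z. p z = p x} \<and> card {z \<in> Z. p z = p x} \<le> C a b)"

definition one_lipschitz ::
  "(int \<Rightarrow> 'b) set \<Rightarrow> (int \<Rightarrow> 'a) set \<Rightarrow> ((int \<Rightarrow> 'b) \<Rightarrow> (int \<Rightarrow> 'a)) \<Rightarrow> bool" where
  "one_lipschitz Z X q \<longleftrightarrow>
     q \<in> Z \<rightarrow> X \<and> (\<forall>x\<in>Z. \<forall>y\<in>Z. symb_dist (q x) (q y) \<le> symb_dist x y)"

end

theory Submission
  imports Defs
begin

text \<open>
  Call a periodic point of \<open>X\<close> good if its fibre has the minimal cardinality among all periodic
  points. The points of a periodic fibre are periodic and pairwise disjoint (they never share a
  symbol at the same time), since otherwise switching between them would produce an infinite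
  fibre. By compactness the fibre of a good point \<open>g\<close> is determined near time \<open>0\<close> by a finite
  window of \<open>g\<close>, so every periodic point containing that window is again good. The vertices of
  the new graph are the sections \<open>{z 0 | z in the fibre of g}\<close> of good fibres, together with the
  singletons \<open>{a}\<close> of the symbols that occur in no section. The arrows of \<open>X\<close> induce a bijection
  between the endpoints of each new arrow, so that a path of sets is a finite bundle of disjoint
  paths of \<open>X\<close>, and \<open>q\<close> follows the path of the bundle that starts at a chosen element of the set
  at time \<open>0\<close>. A regular point that \<open>q\<close> misses up to \<open>\<pi>\<close> crosses an arrow that admits no return
  path. The crossing happens at most once, so its image is a wandering set. It is a Souslin set,
  hence universally measurable, hence null by Poincare recurrence.
\<close>

section \<open>Projections of Souslin sets\<close>

text \<open>The obstacle is that periodic fibres vary only upper semicontinuously: a window of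
  \<open>g\<close> forces the section of a periodic fibre that shares the window into the section of
  \<open>g\<close>, but the inclusion may be strict. Minimal cardinality turns it into an equality,
  so that sections of good points are reproduced by every periodic orbit that runs through a
  suitable window.

  A point that meets a good section and whose arrows all admit return paths is covered because each
  of its finite windows can be closed up through a window of a good point. The resulting orbits are
  good, and a limit of their bundles is a path of sets with the given point as a thread. Singletons
  serve the points that meet no good section.

  The start of the thread chosen by \<open>q\<close> is fixed at time 0, so \<open>q\<close> need
  not commute with the shift. All threads of a bundle are related at all times, hence have the same
  image, and this makes the composition of \<open>q\<close> with \<open>p\<close> equivariant.

  Measurability of images enters through inner approximation: it is enough that every measurable
  subset of the wandering image is null.\<close>

lemma finite_choice_compactness:
  fixes F :: "'i \<Rightarrow> 'b set" and C :: "nat \<Rightarrow> ('i \<Rightarrow> 'b) \<Rightarrow> bool"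
  assumes fin: "\<And>i. finite (F i)"
    and dep: "\<And>n. \<exists>J. finite J \<and> (\<forall>x y. (\<forall>i\<in>J. x i = y i) \<longrightarrow> C n x \<longrightarrow> C n y)"
    and sat: "\<And>n. \<exists>x. (\<forall>i. x i \<in> F i) \<and> (\<forall>m\<le>n. C m x)"
  shows "\<exists>x. (\<forall>i. x i \<in> F i) \<and> (\<forall>n. C n x)"
proof -
  \<comment> \<open>Compact by Tychonoff. A constraint on finitely many coordinates is clopen here,
    so the sets \<open>D n\<close> are closed, nested and nonempty.\<close>
  let ?X = "product_topology (\<lambda>i. discrete_topology (F i)) UNIV"
  define D where "D n = {x. (\<forall>i. x i \<in> F i) \<and> (\<forall>m\<le>n. C m x)}" for n
  have ts: "topspace ?X = {x. \<forall>i. x i \<in> F i}"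
    by (auto simp: PiE_def)
  have "compact_space ?X"
    using fin by (auto simp: compact_space_product_topology compact_space_discrete_topology)
  moreover have "closedin ?X (D n)" for n
  proof -
    have cl: "closedin ?X {x. (\<forall>i. x i \<in> F i) \<and> C m x}" (is "closedin _ ?S") for m
    proof -
      obtain J where J: "finite J" "\<And>x y. (\<forall>i\<in>J. x i = y i) \<Longrightarrow> C m x \<Longrightarrow> C m y"
        using dep[of m] by blast
      have "openin ?X (topspace ?X - ?S)"
        unfolding openin_product_topology_alt
      proof
        fix x assume x: "x \<in> topspace ?X - ?S"
        define U where "U i = (if i \<in> J then {x i} else F i)" for i
        have xF: "x i \<in> F i" for i using x ts by auto
        have "finite {i. U i \<noteq> F i}"
          by (rule finite_subset[OF _ J(1)]) (auto simp: U_def)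
        moreover have "\<forall>i. openin (discrete_topology (F i)) (U i)"
          using xF by (auto simp: U_def)
        moreover have "x \<in> Pi\<^sub>E UNIV U" using xF by (auto simp: U_def)
        moreover have "Pi\<^sub>E UNIV U \<subseteq> topspace ?X - ?S"
        proof
          fix y assume "y \<in> Pi\<^sub>E UNIV U"
          then have y: "y i \<in> U i" for i by auto
          have yF: "y i \<in> F i" for i using y[of i] xF[of i] by (auto simp: U_def split: if_splits)
          have "\<forall>i\<in>J. y i = x i" using y by (auto simp: U_def split: if_splits) (metis singletonD)
          then have "C m y \<Longrightarrow> C m x" using J(2)[of y x] by auto
          with x ts xF yF show "y \<in> topspace ?X - ?S" by auto
        qed
        ultimately show "\<exists>U. finite {i \<in> UNIV. U i \<noteq> topspace (discrete_topology (F i))} \<and>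
              (\<forall>i\<in>UNIV. openin (discrete_topology (F i)) (U i)) \<and>
              x \<in> Pi\<^sub>E UNIV U \<and> Pi\<^sub>E UNIV U \<subseteq> topspace ?X - ?S"
          by (intro exI[of _ U]) auto
      qed
      then show ?thesis unfolding closedin_def ts by auto
    qed
    have "D n = (\<Inter>m\<in>{..n}. {x. (\<forall>i. x i \<in> F i) \<and> C m x})" by (auto simp: D_def)
    then show ?thesis using cl by (auto intro!: closedin_Inter)
  qed
  moreover have "D n \<noteq> {}" for n using sat[of n] by (auto simp: D_def)
  moreover have "decseq D" by (auto simp: decseq_def D_def)
  ultimately have "(\<Inter>n. D n) \<noteq> {}" by (rule compact_space_imp_nest)
  then show ?thesis by (auto simp: D_def)
qed

text \<open>Capacitability: if the outer measure exceeds \<open>c > 0\<close>, bounds on the coordinates of \<open>s\<close> can be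
  imposed one at a time without dropping below \<open>c\<close>. The resulting box of sequences is compact,
  which makes the part of \<open>S\<close> it witnesses a countable intersection of measurable sets.\<close>

lemma inner_null_imp_outer_null:
  fixes Q :: "nat \<Rightarrow> (nat \<Rightarrow> nat) \<Rightarrow> 'y set"
  assumes fm: "finite_measure \<mu>" and Q: "\<And>j s. Q j s \<in> sets \<mu>"
    and dep: "\<And>j. \<exists>N. \<forall>s s'. (\<forall>k<N. s k = s' k) \<longrightarrow> Q j s = Q j s'"
    and S: "S = {y \<in> space \<mu>. \<exists>s. \<forall>j. y \<in> Q j s}"
    and null: "\<And>L. L \<in> sets \<mu> \<Longrightarrow> L \<subseteq> S \<Longrightarrow> emeasure \<mu> L = 0"
  shows "outer_measure_of \<mu> S = 0"
proof (rule ccontr)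
  assume "outer_measure_of \<mu> S \<noteq> 0"
  then obtain c where c: "0 < c" "c < outer_measure_of \<mu> S"
    using dense[of 0 "outer_measure_of \<mu> S"] by (auto simp: zero_less_iff_neq_zero)
  define T where "T n k = {y \<in> space \<mu>. \<exists>s. (\<forall>i<n. s i \<le> k i) \<and> (\<forall>j. y \<in> Q j s)}"
    for n and k :: "nat \<Rightarrow> nat"
  have step: "\<exists>k'. c < outer_measure_of \<mu> (T (Suc n) k') \<and> (\<forall>i<n. k' i = k i)"
    if k: "c < outer_measure_of \<mu> (T n k)" for n k
  proof -
    \<comment> \<open>Outer measure is continuous along increasing unions even of nonmeasurable
      sets, so some bound \<open>m\<close> on coordinate \<open>n\<close> keeps it above
      \<open>c\<close>.\<close>
    have "(\<Union>m. T (Suc n) (k(n := m))) = T n k"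
    proof (intro equalityI subsetI)
      fix y assume "y \<in> (\<Union>m. T (Suc n) (k(n := m)))"
      then obtain m s where "y \<in> space \<mu>" "\<forall>i<Suc n. s i \<le> (k(n := m)) i" "\<forall>j. y \<in> Q j s"
        unfolding T_def by blast
      moreover from this(2) have "\<forall>i<n. s i \<le> k i"
        by (metis fun_upd_other less_SucI less_irrefl)
      ultimately show "y \<in> T n k" unfolding T_def by blast
    next
      fix y assume "y \<in> T n k"
      then obtain s where s: "y \<in> space \<mu>" "\<forall>i<n. s i \<le> k i" "\<forall>j. y \<in> Q j s"
        unfolding T_def by blast
      from s(2) have "\<forall>i<Suc n. s i \<le> (k(n := s n)) i" by (auto simp: less_Suc_eq)
      with s show "y \<in> (\<Union>m. T (Suc n) (k(n := m)))" unfolding T_def by blast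
    qed
    moreover have "incseq (\<lambda>m. T (Suc n) (k(n := m)))"
      unfolding incseq_def
    proof (intro allI impI subsetI)
      fix m m' y assume "m \<le> m'" "y \<in> T (Suc n) (k(n := m))"
      then obtain s where "y \<in> space \<mu>" "\<forall>i<Suc n. s i \<le> (k(n := m)) i" "\<forall>j. y \<in> Q j s"
        unfolding T_def by blast
      moreover from this(2) \<open>m \<le> m'\<close> have "\<forall>i<Suc n. s i \<le> (k(n := m')) i"
        by (auto simp: less_Suc_eq split: if_splits)
      ultimately show "y \<in> T (Suc n) (k(n := m'))" unfolding T_def by blast
    qed
    moreover have "T (Suc n) (k(n := m)) \<subseteq> space \<mu>" for m by (auto simp: T_def)
    ultimately have "(SUP m. outer_measure_of \<mu> (T (Suc n) (k(n := m)))) = outer_measure_of \<mu> (T n k)"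
      using SUP_outer_measure_of_incseq[of "\<lambda>m. T (Suc n) (k(n := m))" \<mu>] by simp
    with k obtain m where "c < outer_measure_of \<mu> (T (Suc n) (k(n := m)))"
      by (metis less_SUP_iff)
    then show ?thesis by (intro exI[of _ "k(n := m)"]) auto
  qed
  have "c < outer_measure_of \<mu> (T 0 k)" for k using c by (simp add: T_def S)
  then obtain f where f: "\<And>n. c < outer_measure_of \<mu> (T n (f n))" "\<And>n i. i < n \<Longrightarrow> f (Suc n) i = f n i"
    using dependent_nat_choice[of "\<lambda>n k. c < outer_measure_of \<mu> (T n k)" "\<lambda>n k k'. \<forall>i<n. k' i = k i"] step
    by metis
  \<comment> \<open>Coordinate \<open>i\<close> is fixed from stage \<open>Suc i\<close> on, so the
    diagonal \<open>K\<close> is the limit of the bounds \<open>f n\<close>.\<close>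
  define K where "K i = f (Suc i) i" for i
  have fK: "f n i = K i" if "i < n" for n i
    using that
  proof (induction n)
    case (Suc n) then show ?case using f(2)[of i n] by (cases "i = n") (auto simp: K_def)
  qed simp
  have TK: "c < outer_measure_of \<mu> (T n K)" for n
  proof -
    have "T n K = T n (f n)" using fK by (auto simp: T_def)
    then show ?thesis using f(1)[of n] by simp
  qed
  obtain N where N: "\<And>j s s'. (\<forall>k<N j. s k = s' k) \<Longrightarrow> Q j s = Q j s'" using dep by metis
  \<comment> \<open>In contrast to \<open>T\<close>, all coordinates are bounded and only the first
    \<open>n\<close> sets are imposed. Only finitely many sequences matter, so \<open>R n\<close> is
    measurable, and it contains \<open>T (b n) K\<close>.\<close>
  define R where "R n = {y \<in> space \<mu>. \<exists>s. (\<forall>i. s i \<le> K i) \<and> (\<forall>j<n. y \<in> Q j s)}" for n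
  define b where "b n = (\<Sum>j<n. N j)" for n
  have b: "N j \<le> b n" if "j < n" for j n
    using member_le_sum[of j "{..<n}" N] that by (auto simp: b_def)
  \<comment> \<open>Beyond \<open>b n\<close> the first \<open>n\<close> sets read nothing, and the
    filler 0 respects every bound.\<close>
  define ext where "ext n g = (\<lambda>i. if i < b n then g i else 0 :: nat)" for n g
  have Qe: "Q j (ext n s) = Q j s" if "j < n" for j n s
    using b[OF that] by (intro N) (auto simp: ext_def)
  have Req: "R n = space \<mu> \<inter> (\<Union>g\<in>Pi\<^sub>E {..<b n} (\<lambda>i. {..K i}). \<Inter>j\<in>{..<n}. Q j (ext n g))" for n
  proof (intro equalityI subsetI)
    fix y assume "y \<in> R n"
    then obtain s where s: "y \<in> space \<mu>" "\<forall>i. s i \<le> K i" "\<forall>j<n. y \<in> Q j s" by (auto simp: R_def)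
    have "restrict s {..<b n} \<in> Pi\<^sub>E {..<b n} (\<lambda>i. {..K i})" using s by auto
    moreover have "ext n (restrict s {..<b n}) = ext n s" by (auto simp: ext_def)
    then have "y \<in> (\<Inter>j\<in>{..<n}. Q j (ext n (restrict s {..<b n})))" using s Qe by simp
    ultimately show "y \<in> space \<mu> \<inter> (\<Union>g\<in>Pi\<^sub>E {..<b n} (\<lambda>i. {..K i}). \<Inter>j\<in>{..<n}. Q j (ext n g))"
      using s(1) by blast
  next
    fix y assume "y \<in> space \<mu> \<inter> (\<Union>g\<in>Pi\<^sub>E {..<b n} (\<lambda>i. {..K i}). \<Inter>j\<in>{..<n}. Q j (ext n g))"
    then obtain g where g: "y \<in> space \<mu>" "g \<in> Pi\<^sub>E {..<b n} (\<lambda>i. {..K i})" "\<forall>j<n. y \<in> Q j (ext n g)" by auto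
    have "ext n g i \<le> K i" for i using g(2) by (auto simp: ext_def)
    with g show "y \<in> R n" by (auto simp: R_def)
  qed
  have Rm: "R n \<in> sets \<mu>" for n
  proof (cases n)
    case 0
    have "R 0 = space \<mu>" unfolding R_def by auto
    then show ?thesis using 0 by simp
  next
    case (Suc m)
    then show ?thesis unfolding Req
      using Q by (intro sets.Int sets.top sets.finite_UN sets.finite_INT finite_PiE) auto
  qed
  have Rc: "c \<le> emeasure \<mu> (R n)" for n
  proof -
    have "T (b n) K \<subseteq> R n"
    proof
      fix y assume "y \<in> T (b n) K"
      then obtain s where s: "y \<in> space \<mu>" "\<forall>i<b n. s i \<le> K i" "\<forall>j. y \<in> Q j s" by (auto simp: T_def)
      have "\<forall>i. ext n s i \<le> K i" using s(2) by (auto simp: ext_def)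
      with s Qe show "y \<in> R n" by (auto simp: R_def)
    qed
    then have "outer_measure_of \<mu> (T (b n) K) \<le> outer_measure_of \<mu> (R n)" by (rule outer_measure_of_mono)
    then show ?thesis using TK[of "b n"] Rm by simp
  qed
  have "(\<Inter>n. R n) \<subseteq> S"
  proof
    fix y assume y: "y \<in> (\<Inter>n. R n)"
    have "\<exists>s. (\<forall>i. s i \<in> {..K i}) \<and> (\<forall>j. y \<in> Q j s)"
    proof (rule finite_choice_compactness)
      show "\<exists>J. finite J \<and> (\<forall>s s'. (\<forall>i\<in>J. s i = s' i) \<longrightarrow> y \<in> Q n s \<longrightarrow> y \<in> Q n s')" for n
        using N[of n] by (intro exI[of _ "{..<N n}"]) (metis finite_lessThan lessThan_iff)
      show "\<exists>s. (\<forall>i. s i \<in> {..K i}) \<and> (\<forall>m\<le>n. y \<in> Q m s)" for n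
      proof -
        have "y \<in> R (Suc n)" using y by blast
        then show ?thesis by (auto simp: R_def less_Suc_eq_le)
      qed
    qed auto
    then show "y \<in> S" using y by (auto simp: S R_def)
  qed
  then have "emeasure \<mu> (\<Inter>n. R n) = 0" using Rm by (intro null) auto
  moreover have "(INF n. emeasure \<mu> (R n)) = emeasure \<mu> (\<Inter>n. R n)"
  proof (rule INF_emeasure_decseq)
    show "range R \<subseteq> sets \<mu>" using Rm by auto
    show "decseq R" unfolding decseq_def
    proof (intro allI impI subsetI)
      fix m n y assume "m \<le> n" "y \<in> R n"
      then obtain s where "y \<in> space \<mu>" "\<forall>i. s i \<le> K i" "\<forall>j<n. y \<in> Q j s" unfolding R_def by blast
      moreover from this(3) \<open>m \<le> n\<close> have "\<forall>j<m. y \<in> Q j s" by simp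
      ultimately show "y \<in> R m" unfolding R_def by blast
    qed
    show "\<And>i. emeasure \<mu> (R i) \<noteq> \<infinity>" using fm finite_measure.emeasure_finite by auto
  qed
  moreover have "c \<le> (INF n. emeasure \<mu> (R n))" using Rc by (intro INF_greatest) auto
  ultimately show False using c by simp
qed

text \<open>A Souslin scheme with parameter \<open>t\<close>. Instead of the usual prefix condition, the \<open>j\<close>-th set may
  depend on any finite number of coordinates, which makes countable unions and intersections easy.\<close>

definition souslin_scheme ::
  "'y measure \<Rightarrow> (nat \<Rightarrow> (nat \<Rightarrow> nat) \<Rightarrow> (nat \<Rightarrow> nat) \<Rightarrow> 'y set) \<Rightarrow> ((nat \<Rightarrow> nat) \<Rightarrow> 'y \<Rightarrow> bool) \<Rightarrow> bool"
where
  "souslin_scheme M Q P \<longleftrightarrow>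
     (\<forall>j s t. Q j s t \<in> sets M) \<and>
     (\<forall>j. \<exists>N. \<forall>s s' t t'. (\<forall>k<N. s k = s' k \<and> t k = t' k) \<longrightarrow> Q j s t = Q j s' t') \<and>
     (\<forall>t. \<forall>y\<in>space M. P t y \<longleftrightarrow> (\<exists>s. \<forall>j. y \<in> Q j s t))"

definition souslin :: "'y measure \<Rightarrow> ((nat \<Rightarrow> nat) \<Rightarrow> 'y \<Rightarrow> bool) \<Rightarrow> bool" where
  "souslin M P \<longleftrightarrow> (\<exists>Q. souslin_scheme M Q P)"

lemma souslin_cong:
  assumes "souslin M P" "\<And>t y. y \<in> space M \<Longrightarrow> P t y \<longleftrightarrow> P' t y"
  shows "souslin M P'"
proof -
  have "(\<forall>t. \<forall>y\<in>space M. P t y \<longleftrightarrow> R t y) \<longleftrightarrow> (\<forall>t. \<forall>y\<in>space M. P' t y \<longleftrightarrow> R t y)" for R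
    using assms(2) by blast
  with assms(1) show ?thesis unfolding souslin_def souslin_scheme_def by simp
qed

lemma souslin_basic:
  assumes "\<And>t. B t \<in> sets M" "\<And>t t'. (\<forall>k<N. t k = t' k) \<Longrightarrow> B t = B t'"
  shows "souslin M (\<lambda>t y. y \<in> B t)"
  unfolding souslin_def souslin_scheme_def using assms by (intro exI[of _ "\<lambda>j s t. B t"]) blast

lemma souslin_clopen:
  assumes "\<And>t t'. (\<forall>k<N. t k = t' k) \<Longrightarrow> P t \<longleftrightarrow> P t'"
  shows "souslin M (\<lambda>t y. P t)"
proof -
  have "souslin M (\<lambda>t y. y \<in> (if P t then space M else {}))"
  proof (rule souslin_basic[where N = N])
    fix t t' :: "nat \<Rightarrow> nat" assume "\<forall>k<N. t k = t' k"
    then have "P t \<longleftrightarrow> P t'" by (rule assms)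
    then show "(if P t then space M else {}) = (if P t' then space M else {})" by simp
  qed simp
  then show ?thesis by (rule souslin_cong) auto
qed

text \<open>One witness sequence per \<open>i\<close> is packed into a single sequence: row
  \<open>i\<close> of the pairing is the witness for \<open>P i\<close>, and the index
  \<open>j\<close> of the new scheme encodes both \<open>i\<close> and an index of its
  scheme.\<close>

lemma souslin_all:
  assumes "\<And>i::nat. souslin M (P i)"
  shows "souslin M (\<lambda>t y. \<forall>i. P i t y)"
proof -
  obtain Q where sch: "\<And>i. souslin_scheme M (Q i) (P i)"
    using assms unfolding souslin_def by metis
  have Q: "Q i j s t \<in> sets M" for i j s t using sch[of i] unfolding souslin_scheme_def by blast
  have P: "P i t y \<longleftrightarrow> (\<exists>s. \<forall>j. y \<in> Q i j s t)" if "y \<in> space M" for i t y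
    using sch[of i] that unfolding souslin_scheme_def by blast
  have "\<forall>i j. \<exists>N. \<forall>s s' t t'. (\<forall>k<N. s k = s' k \<and> t k = t' k) \<longrightarrow> Q i j s t = Q i j s' t'"
    using sch unfolding souslin_scheme_def by blast
  then obtain N where N: "\<And>i j s s' t t'. (\<forall>k<N i j. s k = s' k \<and> t k = t' k) \<Longrightarrow> Q i j s t = Q i j s' t'"
    by metis
  define Q' where "Q' j s t = (case prod_decode j of (i, j') \<Rightarrow> Q i j' (\<lambda>k. s (prod_encode (i, k))) t)"
    for j and s t :: "nat \<Rightarrow> nat"
  have "\<exists>n. \<forall>s s' t t'. (\<forall>k<n. s k = s' k \<and> t k = t' k) \<longrightarrow> Q' j s t = Q' j s' t'" for j
  proof -
    obtain i j' where ij: "prod_decode j = (i, j')" by fastforce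
    \<comment> \<open>The sum bounds all packed positions that are read; the summand
      \<open>N i j'\<close> is there for \<open>t\<close>, which is not repacked.\<close>
    define n where "n = N i j' + (\<Sum>k<N i j'. Suc (prod_encode (i, k)))"
    have "prod_encode (i, k) < n" if "k < N i j'" for k
      using member_le_sum[of k "{..<N i j'}" "\<lambda>k. Suc (prod_encode (i, k))"] that by (auto simp: n_def)
    moreover have "N i j' \<le> n" by (simp add: n_def)
    ultimately show ?thesis
      by (intro exI[of _ n]) (auto simp: Q'_def ij intro!: N)
  qed
  moreover have "(\<forall>i. P i t y) \<longleftrightarrow> (\<exists>s. \<forall>j. y \<in> Q' j s t)" if "y \<in> space M" for t y
  proof
    assume "\<forall>i. P i t y"
    then have "\<forall>i. \<exists>s. \<forall>j. y \<in> Q i j s t" using P that by simp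
    then obtain s where s: "\<And>i j. y \<in> Q i j (s i) t" by metis
    have "y \<in> Q' j (\<lambda>k. case prod_decode k of (i, k') \<Rightarrow> s i k') t" for j
      using s by (auto simp: Q'_def split: prod.split)
    then show "\<exists>s. \<forall>j. y \<in> Q' j s t" by blast
  next
    assume "\<exists>s. \<forall>j. y \<in> Q' j s t"
    then obtain s where s: "\<And>j. y \<in> Q' j s t" by blast
    show "\<forall>i. P i t y"
    proof
      fix i
      have "y \<in> Q i j (\<lambda>k. s (prod_encode (i, k))) t" for j
        using s[of "prod_encode (i, j)"] by (simp add: Q'_def)
      then show "P i t y" using P that by auto
    qed
  qed
  moreover have "Q' j s t \<in> sets M" for j s t using Q by (simp add: Q'_def split: prod.split)
  ultimately show ?thesis unfolding souslin_def souslin_scheme_def by (intro exI[of _ Q']) blast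
qed

text \<open>The entry \<open>s 0\<close> names the disjunct and the shifted sequence is its witness;
  the sets of the other disjuncts are replaced by the whole space.\<close>

lemma souslin_ex:
  assumes "\<And>i::nat. souslin M (P i)"
  shows "souslin M (\<lambda>t y. \<exists>i. P i t y)"
proof -
  obtain Q where sch: "\<And>i. souslin_scheme M (Q i) (P i)"
    using assms unfolding souslin_def by metis
  have Q: "Q i j s t \<in> sets M" for i j s t using sch[of i] unfolding souslin_scheme_def by blast
  have P: "P i t y \<longleftrightarrow> (\<exists>s. \<forall>j. y \<in> Q i j s t)" if "y \<in> space M" for i t y
    using sch[of i] that unfolding souslin_scheme_def by blast
  have "\<forall>i j. \<exists>N. \<forall>s s' t t'. (\<forall>k<N. s k = s' k \<and> t k = t' k) \<longrightarrow> Q i j s t = Q i j s' t'"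
    using sch unfolding souslin_scheme_def by blast
  then obtain N where N: "\<And>i j s s' t t'. (\<forall>k<N i j. s k = s' k \<and> t k = t' k) \<Longrightarrow> Q i j s t = Q i j s' t'"
    by metis
  define Q' where "Q' j s t = (case prod_decode j of (i, j') \<Rightarrow>
      if s 0 = i then Q i j' (\<lambda>k. s (Suc k)) t else space M)" for j and s t :: "nat \<Rightarrow> nat"
  have "\<exists>n. \<forall>s s' t t'. (\<forall>k<n. s k = s' k \<and> t k = t' k) \<longrightarrow> Q' j s t = Q' j s' t'" for j
  proof -
    obtain i j' where ij: "prod_decode j = (i, j')" by fastforce
    show ?thesis
      by (intro exI[of _ "Suc (N i j')"]) (auto simp: Q'_def ij intro!: N)
  qed
  moreover have "(\<exists>i. P i t y) \<longleftrightarrow> (\<exists>s. \<forall>j. y \<in> Q' j s t)" if "y \<in> space M" for t y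
  proof
    assume "\<exists>i. P i t y"
    then obtain i where "P i t y" by blast
    then have "\<exists>s. \<forall>j. y \<in> Q i j s t" using P that by simp
    then obtain s where s: "\<And>j. y \<in> Q i j s t" by blast
    have "y \<in> Q' j (case_nat i s) t" for j
      using s that by (auto simp: Q'_def split: prod.split)
    then show "\<exists>s. \<forall>j. y \<in> Q' j s t" by blast
  next
    assume "\<exists>s. \<forall>j. y \<in> Q' j s t"
    then obtain s where s: "\<And>j. y \<in> Q' j s t" by blast
    have "y \<in> Q (s 0) j (\<lambda>k. s (Suc k)) t" for j
      using s[of "prod_encode (s 0, j)"] by (simp add: Q'_def)
    then show "\<exists>i. P i t y" using P that by blast
  qed
  moreover have "Q' j s t \<in> sets M" for j s t using Q by (simp add: Q'_def split: prod.split)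
  ultimately show ?thesis unfolding souslin_def souslin_scheme_def by (intro exI[of _ Q']) blast
qed

lemma souslin_conj:
  assumes "souslin M P" "souslin M P'"
  shows "souslin M (\<lambda>t y. P t y \<and> P' t y)"
proof -
  have "souslin M (\<lambda>t y. \<forall>i. (if i = (0::nat) then P else P') t y)"
    by (rule souslin_all) (use assms in simp)
  then show ?thesis
  proof (rule souslin_cong)
    fix t y
    show "(\<forall>i. (if i = (0::nat) then P else P') t y) \<longleftrightarrow> P t y \<and> P' t y"
      by (auto split: if_splits dest: spec[of _ 0] spec[of _ 1])
  qed
qed

lemma souslin_disj:
  assumes "souslin M P" "souslin M P'"
  shows "souslin M (\<lambda>t y. P t y \<or> P' t y)"
proof -
  have "souslin M (\<lambda>t y. \<exists>i. (if i = (0::nat) then P else P') t y)"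
    by (rule souslin_ex) (use assms in simp)
  then show ?thesis
  proof (rule souslin_cong)
    fix t y
    show "(\<exists>i. (if i = (0::nat) then P else P') t y) \<longleftrightarrow> P t y \<or> P' t y"
      by (auto split: if_splits intro: exI[of _ 0] exI[of _ 1])
  qed
qed

text \<open>The parameter \<open>t\<close> is absorbed into the witness, even positions for
  \<open>s\<close> and odd ones for \<open>t\<close>; the projection is then of the form treated by
  capacitability.\<close>

lemma souslin_projection_null:
  assumes fm: "finite_measure \<mu>" and P: "souslin \<mu> P"
    and null: "\<And>L. L \<in> sets \<mu> \<Longrightarrow> L \<subseteq> {y \<in> space \<mu>. \<exists>t. P t y} \<Longrightarrow> emeasure \<mu> L = 0"
  shows "outer_measure_of \<mu> {y \<in> space \<mu>. \<exists>t. P t y} = 0"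
proof -
  obtain Q where sch: "souslin_scheme \<mu> Q P"
    using P unfolding souslin_def by blast
  then have Q: "Q j s t \<in> sets \<mu>" for j s t unfolding souslin_scheme_def by blast
  have PQ: "P t y \<longleftrightarrow> (\<exists>s. \<forall>j. y \<in> Q j s t)" if "y \<in> space \<mu>" for t y
    using sch that unfolding souslin_scheme_def by blast
  have "\<forall>j. \<exists>N. \<forall>s s' t t'. (\<forall>k<N. s k = s' k \<and> t k = t' k) \<longrightarrow> Q j s t = Q j s' t'"
    using sch unfolding souslin_scheme_def by blast
  then obtain N where N: "\<And>j s s' t t'. (\<forall>k<N j. s k = s' k \<and> t k = t' k) \<Longrightarrow> Q j s t = Q j s' t'"
    by metis
  define Q' where "Q' j u = Q j (\<lambda>k. u (2 * k)) (\<lambda>k. u (Suc (2 * k)))" for j and u :: "nat \<Rightarrow> nat"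
  have S: "{y \<in> space \<mu>. \<exists>t. P t y} = {y \<in> space \<mu>. \<exists>u. \<forall>j. y \<in> Q' j u}"
  proof (rule Collect_cong, intro conj_cong refl)
    fix y assume y: "y \<in> space \<mu>"
    show "(\<exists>t. P t y) \<longleftrightarrow> (\<exists>u. \<forall>j. y \<in> Q' j u)"
    proof
      assume "\<exists>t. P t y"
      then obtain s t where "\<forall>j. y \<in> Q j s t" using PQ[OF y] by blast
      then have "\<forall>j. y \<in> Q' j (\<lambda>k. if even k then s (k div 2) else t (k div 2))" by (simp add: Q'_def)
      then show "\<exists>u. \<forall>j. y \<in> Q' j u" by blast
    next
      assume "\<exists>u. \<forall>j. y \<in> Q' j u"
      then show "\<exists>t. P t y" unfolding Q'_def using PQ[OF y] by blast
    qed
  qed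
  show ?thesis
  proof (rule inner_null_imp_outer_null[OF fm _ _ S])
    show "Q' j u \<in> sets \<mu>" for j u by (simp add: Q'_def Q)
    show "\<exists>n. \<forall>s s'. (\<forall>k<n. s k = s' k) \<longrightarrow> Q' j s = Q' j s'" for j
      by (intro exI[of _ "2 * N j"]) (auto simp: Q'_def intro!: N)
  qed (use null in auto)
qed

section \<open>The symbolic topology\<close>

definition agree :: "nat \<Rightarrow> (int \<Rightarrow> 'a) \<Rightarrow> (int \<Rightarrow> 'a) \<Rightarrow> bool" where
  "agree n x y \<longleftrightarrow> (\<forall>i. \<bar>i\<bar> \<le> int n \<longrightarrow> x i = y i)"

text \<open>\<open>k\<close> is the least absolute value of an index of disagreement, so exactly the
  windows of radius strictly below \<open>k\<close> agree.\<close>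

lemma symb_dist_eq:
  assumes "x \<noteq> y"
  obtains k where "symb_dist x y = exp (- real k)" "\<And>n. agree n x y \<longleftrightarrow> n < k"
proof
  let ?D = "{nat \<bar>n\<bar> | n. x n \<noteq> y n}"
  show "symb_dist x y = exp (- real (Inf ?D))" using assms by (simp add: symb_dist_def)
  have "?D \<noteq> {}" using assms by (auto simp: fun_eq_iff)
  then have *: "Inf ?D \<in> ?D" by (rule Inf_nat_def1)
  show "agree n x y \<longleftrightarrow> n < Inf ?D" for n
  proof
    assume "agree n x y"
    with * show "n < Inf ?D" by (force simp: agree_def)
  next
    assume n: "n < Inf ?D"
    show "agree n x y" unfolding agree_def
    proof (intro allI impI, rule ccontr)
      fix i assume "\<bar>i\<bar> \<le> int n" "x i \<noteq> y i"
      then have "Inf ?D \<le> nat \<bar>i\<bar>" by (intro cInf_lower) auto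
      with n \<open>\<bar>i\<bar> \<le> int n\<close> show False by linarith
    qed
  qed
qed

lemma symb_dist_less_iff_agree: "symb_dist x y < exp (- real n) \<longleftrightarrow> agree n x y"
proof (cases "x = y")
  case True then show ?thesis by (simp add: symb_dist_def agree_def)
next
  case False then show ?thesis by (metis symb_dist_eq exp_less_cancel_iff neg_less_iff_less of_nat_less_iff)
qed

lemma symb_dist_le_if_agree:
  assumes "\<And>n. agree n x y \<Longrightarrow> agree n x' y'"
  shows "symb_dist x' y' \<le> symb_dist x y"
proof (cases "x' = y'")
  case True then show ?thesis by (simp add: symb_dist_def)
next
  case False
  then have ne: "x \<noteq> y" using assms by (auto simp: agree_def fun_eq_iff) (metis abs_ge_zero nat_0_le order_refl)
  obtain k where k: "symb_dist x y = exp (- real k)" "\<And>n. agree n x y \<longleftrightarrow> n < k"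
    using symb_dist_eq[OF ne] by metis
  obtain k' where k': "symb_dist x' y' = exp (- real k')" "\<And>n. agree n x' y' \<longleftrightarrow> n < k'"
    using symb_dist_eq[OF False] by metis
  have "k \<le> k'" using assms k k' by (metis not_less not_less_iff_gr_or_eq)
  then show ?thesis using k k' by simp
qed

lemma topspace_symb_top [simp]: "topspace (symb_top Z) = Z"
  by (simp add: symb_top_def Metric_space.topspace_mtopology Metric_space_symb_dist)

lemma openin_symb_top:
  "openin (symb_top Z) U \<longleftrightarrow> U \<subseteq> Z \<and> (\<forall>x\<in>U. \<exists>n. \<forall>y\<in>Z. agree n x y \<longrightarrow> y \<in> U)"
proof -
  interpret Metric_space Z symb_dist by (rule Metric_space_symb_dist)
  have "(\<exists>r>0. mball x r \<subseteq> U) \<longleftrightarrow> (\<exists>n. \<forall>y\<in>Z. agree n x y \<longrightarrow> y \<in> U)" if "U \<subseteq> Z" "x \<in> U" for x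
  proof
    assume "\<exists>r>0. mball x r \<subseteq> U"
    then obtain r where r: "r > 0" "mball x r \<subseteq> U" by blast
    obtain n :: nat where "- ln r < real n" using reals_Archimedean2 by blast
    then have "exp (- real n) < r" using r(1) by (metis exp_less_mono exp_ln minus_less_iff)
    then have "y \<in> U" if "y \<in> Z" "agree n x y" for y
      using r(2) that \<open>U \<subseteq> Z\<close> \<open>x \<in> U\<close> symb_dist_less_iff_agree[of x y n] by fastforce
    then show "\<exists>n. \<forall>y\<in>Z. agree n x y \<longrightarrow> y \<in> U" by blast
  next
    assume "\<exists>n. \<forall>y\<in>Z. agree n x y \<longrightarrow> y \<in> U"
    then obtain n where n: "\<forall>y\<in>Z. agree n x y \<longrightarrow> y \<in> U" by blast
    have "mball x (exp (- real n)) \<subseteq> U" using n by (auto simp: symb_dist_less_iff_agree)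
    then show "\<exists>r>0. mball x r \<subseteq> U" by (meson exp_gt_zero)
  qed
  then show ?thesis unfolding symb_top_def openin_mtopology by blast
qed

lemma symb_top_subtopology: "S \<subseteq> Z \<Longrightarrow> symb_top S = subtopology (symb_top Z) S"
  unfolding symb_top_def
  by (metis Metric_space_symb_dist Submetric.mtopology_submetric Submetric.intro Submetric_axioms.intro)

lemma compactin_symb_top: "compactin (symb_top Z) K \<longleftrightarrow> K \<subseteq> Z \<and> compactin (symb_top UNIV) K"
  using symb_top_subtopology[of Z UNIV] by (auto simp: compactin_subtopology)

text \<open>Central windows are cofinal among the finite sets of coordinates. This brings in
  compactness of boxes and continuity of the coordinate projections.\<close>

lemma symb_top_UNIV: "symb_top UNIV = product_topology (\<lambda>_::int. discrete_topology UNIV) UNIV"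
proof (rule topology_eq[THEN iffD2], intro allI)
  fix U :: "(int \<Rightarrow> 'a) set"
  let ?P = "product_topology (\<lambda>_::int. discrete_topology (UNIV::'a set)) UNIV"
  show "openin (symb_top UNIV) U \<longleftrightarrow> openin ?P U"
  proof
    assume U: "openin (symb_top UNIV) U"
    show "openin ?P U" unfolding openin_product_topology_alt
    proof
      fix x assume "x \<in> U"
      then obtain n where n: "\<forall>y. agree n x y \<longrightarrow> y \<in> U" using U by (auto simp: openin_symb_top)
      define V where "V i = (if \<bar>i\<bar> \<le> int n then {x i} else UNIV)" for i
      have "finite {i. V i \<noteq> UNIV}"
        by (rule finite_subset[of _ "{- int n..int n}"]) (auto simp: V_def split: if_splits)
      moreover have "x \<in> Pi\<^sub>E UNIV V" by (auto simp: V_def)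
      moreover have "Pi\<^sub>E UNIV V \<subseteq> U"
        using n by (fastforce simp: V_def agree_def PiE_def Pi_def split: if_splits)
      ultimately show "\<exists>V. finite {i \<in> UNIV. V i \<noteq> topspace (discrete_topology (UNIV::'a set))} \<and>
           (\<forall>i\<in>UNIV. openin (discrete_topology UNIV) (V i)) \<and> x \<in> Pi\<^sub>E UNIV V \<and> Pi\<^sub>E UNIV V \<subseteq> U"
        by (intro exI[of _ V]) auto
    qed
  next
    assume U: "openin ?P U"
    show "openin (symb_top UNIV) U" unfolding openin_symb_top
    proof (intro conjI ballI subset_UNIV)
      fix x assume "x \<in> U"
      then obtain V where V: "finite {i. V i \<noteq> UNIV}" "x \<in> Pi\<^sub>E UNIV V" "Pi\<^sub>E UNIV V \<subseteq> U"
        using U unfolding openin_product_topology_alt by auto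
      define n where "n = (\<Sum>i\<in>{i. V i \<noteq> UNIV}. nat \<bar>i\<bar>)"
      have n: "\<bar>i\<bar> \<le> int n" if "V i \<noteq> UNIV" for i
      proof -
        have "nat \<bar>i\<bar> \<le> n"
          unfolding n_def using V(1) that by (intro member_le_sum) auto
        then show ?thesis by linarith
      qed
      have "y \<in> U" if "agree n x y" for y
      proof -
        have "y i \<in> V i" for i
          using n[of i] that V(2) by (cases "V i = UNIV") (auto simp: agree_def PiE_def Pi_def, metis)
        then show ?thesis using V(3) by auto
      qed
      then show "\<exists>n. \<forall>y\<in>UNIV. agree n x y \<longrightarrow> y \<in> U" by blast
    qed
  qed
qed

lemma compactin_symb_top_box:
  assumes "\<And>i. finite (F i)"
  shows "compactin (symb_top UNIV) {x. \<forall>i. x i \<in> F i}"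
proof -
  have "{x. \<forall>i. x i \<in> F i} = Pi\<^sub>E UNIV F" by (auto simp: PiE_def)
  then show ?thesis using assms
    by (simp add: symb_top_UNIV compactin_PiE compactin_discrete_topology)
qed

lemma finite_coordinates_compact:
  assumes "compactin (symb_top Z) K"
  shows "finite ((\<lambda>x. x i) ` K)"
proof -
  have "compactin (symb_top UNIV) K" using assms compactin_symb_top by blast
  moreover have "continuous_map (symb_top UNIV) (discrete_topology UNIV) (\<lambda>x. x i)"
    unfolding symb_top_UNIV by (rule continuous_map_product_projection) simp
  ultimately have "compactin (discrete_topology UNIV) ((\<lambda>x. x i) ` K)"
    by (rule image_compactin)
  then show ?thesis by (simp add: compactin_discrete_topology)
qed

lemma closedin_markov_shift: "closedin (symb_top UNIV) (markov_shift E)"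
  unfolding closedin_def
proof (intro conjI)
  show "openin (symb_top UNIV) (topspace (symb_top UNIV) - markov_shift E)"
    unfolding openin_symb_top
  proof (intro conjI ballI)
    fix x assume "x \<in> topspace (symb_top UNIV) - markov_shift E"
    then obtain i where i: "(x i, x (i + 1)) \<notin> E" by (auto simp: markov_shift_def)
    have "y \<in> topspace (symb_top UNIV) - markov_shift E" if "agree (nat (\<bar>i\<bar> + 1)) x y" for y
    proof -
      have "x i = y i" "x (i + 1) = y (i + 1)" using that by (auto simp: agree_def)
      with i show ?thesis by (auto simp: markov_shift_def)
    qed
    then show "\<exists>n. \<forall>y\<in>UNIV. agree n x y \<longrightarrow> y \<in> topspace (symb_top UNIV) - markov_shift E" by blast
  qed auto
qed auto

lemma continuous_map_symb_top:
  assumes "q \<in> Z \<rightarrow> X" "\<And>n x y. x \<in> Z \<Longrightarrow> y \<in> Z \<Longrightarrow> agree n x y \<Longrightarrow> agree n (q x) (q y)"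
  shows "continuous_map (symb_top Z) (symb_top X) q"
  unfolding continuous_map_def
proof (intro conjI allI impI)
  show "q \<in> topspace (symb_top Z) \<rightarrow> topspace (symb_top X)" using assms(1) by simp
  fix U assume "openin (symb_top X) U"
  then have U: "\<And>x. x \<in> U \<Longrightarrow> \<exists>n. \<forall>y\<in>X. agree n x y \<longrightarrow> y \<in> U" by (auto simp: openin_symb_top)
  show "openin (symb_top Z) {x \<in> topspace (symb_top Z). q x \<in> U}"
    unfolding openin_symb_top
  proof (intro conjI ballI)
    fix x assume "x \<in> {x \<in> topspace (symb_top Z). q x \<in> U}"
    then have x: "x \<in> Z" "q x \<in> U" by auto
    then obtain n where "\<forall>y\<in>X. agree n (q x) y \<longrightarrow> y \<in> U" using U by blast
    then show "\<exists>n. \<forall>y\<in>Z. agree n x y \<longrightarrow> y \<in> {x \<in> topspace (symb_top Z). q x \<in> U}"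
      using assms x by (intro exI[of _ n]) (auto simp: Pi_iff)
  qed auto
qed

lemma continuous_map_measurable_borel_of_top:
  assumes "continuous_map S T f"
  shows "f \<in> borel_of_top S \<rightarrow>\<^sub>M borel_of_top T"
  unfolding borel_of_top_def
proof (rule measurable_measure_of)
  have sp: "space (sigma (topspace S) {U. openin S U}) = topspace S"
    by (rule space_measure_of) (auto dest: openin_subset)
  show "{U. openin T U} \<subseteq> Pow (topspace T)" by (auto dest: openin_subset)
  show "f \<in> space (sigma (topspace S) {U. openin S U}) \<rightarrow> topspace T"
    unfolding sp using assms by (rule continuous_map_funspace)
  fix U assume "U \<in> {U. openin T U}"
  then have "openin S {x \<in> topspace S. f x \<in> U}"
    using assms by (simp add: openin_continuous_map_preimage)
  moreover have "f -` U \<inter> space (sigma (topspace S) {U. openin S U}) = {x \<in> topspace S. f x \<in> U}"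
    unfolding sp by auto
  moreover have "sets (sigma (topspace S) {U. openin S U}) = sigma_sets (topspace S) {U. openin S U}"
    by (rule sets_measure_of) (auto dest: openin_subset)
  ultimately show "f -` U \<inter> space (sigma (topspace S) {U. openin S U})
      \<in> sets (sigma (topspace S) {U. openin S U})" by auto
qed

section \<open>Finite sets of mutually related paths\<close>

definition io_up :: "(int \<Rightarrow> 'a) \<Rightarrow> 'a \<Rightarrow> bool" where
  "io_up x v \<longleftrightarrow> (\<forall>m. \<exists>i\<ge>m. x i = v)"

definition io_down :: "(int \<Rightarrow> 'a) \<Rightarrow> 'a \<Rightarrow> bool" where
  "io_down x u \<longleftrightarrow> (\<forall>m. \<exists>i\<le>m. x i = u)"

lemma infinite_up_iff: "infinite {n::nat. x (int n) = v} \<longleftrightarrow> io_up x v"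
  unfolding infinite_nat_iff_unbounded_le io_up_def
proof safe
  fix m :: int assume "\<forall>m. \<exists>n\<ge>m. n \<in> {n. x (int n) = v}"
  then obtain n where "n \<ge> nat m" "x (int n) = v" by blast
  then show "\<exists>i\<ge>m. x i = v" by (intro exI[of _ "int n"]) auto
next
  fix m :: nat assume "\<forall>m. \<exists>i\<ge>m. x i = v"
  then obtain i where "i \<ge> int m" "x i = v" by blast
  then show "\<exists>n\<ge>m. n \<in> {n. x (int n) = v}" by (intro exI[of _ "nat i"]) auto
qed

lemma infinite_down_iff: "infinite {n::nat. x (- int n) = u} \<longleftrightarrow> io_down x u"
proof -
  have "io_down x u \<longleftrightarrow> io_up (\<lambda>i. x (- i)) u"
    unfolding io_down_def io_up_def by (metis minus_le_iff minus_minus neg_le_iff_le)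
  then show ?thesis using infinite_up_iff[of "\<lambda>i. x (- i)"] by simp
qed

lemma infinite_pos_up: "infinite {n::nat. 0 < n \<and> x (int n) = v} \<longleftrightarrow> io_up x v"
proof -
  have "{n::nat. x (int n) = v} \<subseteq> insert 0 {n. 0 < n \<and> x (int n) = v}" by auto
  then have "infinite {n::nat. x (int n) = v} \<Longrightarrow> infinite {n::nat. 0 < n \<and> x (int n) = v}"
    by (meson finite_insert finite_subset)
  moreover have "infinite {n::nat. 0 < n \<and> x (int n) = v} \<Longrightarrow> infinite {n::nat. x (int n) = v}"
    by (rule infinite_super[rotated]) auto
  ultimately show ?thesis unfolding infinite_up_iff[symmetric] by blast
qed

lemma infinite_pos_down: "infinite {n::nat. 0 < n \<and> x (- int n) = v} \<longleftrightarrow> io_down x v"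
proof -
  have "{n::nat. x (- int n) = v} \<subseteq> insert 0 {n. 0 < n \<and> x (- int n) = v}" by auto
  then have "infinite {n::nat. x (- int n) = v} \<Longrightarrow> infinite {n::nat. 0 < n \<and> x (- int n) = v}"
    by (meson finite_insert finite_subset)
  moreover have "infinite {n::nat. 0 < n \<and> x (- int n) = v} \<Longrightarrow> infinite {n::nat. x (- int n) = v}"
    by (rule infinite_super[rotated]) auto
  ultimately show ?thesis unfolding infinite_down_iff[symmetric] by blast
qed

lemma regular_part_iff:
  "x \<in> regular_part Z \<longleftrightarrow> x \<in> Z \<and> (\<exists>u. io_down x u) \<and> (\<exists>v. io_up x v)"
  by (auto simp: regular_part_def infinite_up_iff infinite_down_iff)

lemma io_up_finite:
  assumes "finite F" "\<And>m. \<exists>i\<ge>m. x i \<in> F"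
  obtains v where "v \<in> F" "io_up x v"
proof (rule ccontr)
  assume "\<not> thesis"
  then have "\<forall>v\<in>F. \<exists>m. \<forall>i\<ge>m. x i \<noteq> v" using that unfolding io_up_def by blast
  then obtain m where m: "\<And>v i. v \<in> F \<Longrightarrow> i \<ge> m v \<Longrightarrow> x i \<noteq> v" by metis
  obtain i where i: "i \<ge> Max (m ` F)" "x i \<in> F" using assms(2) by blast
  then have "m (x i) \<le> i" using assms(1) by (meson Max_ge dual_order.trans finite_imageI imageI)
  with m i show False by blast
qed

lemma io_down_finite:
  assumes "finite F" "\<And>m. \<exists>i\<le>m. x i \<in> F"
  obtains v where "v \<in> F" "io_down x v"
proof -
  have "\<exists>i\<ge>m. x (- i) \<in> F" for m using assms(2)[of "- m"] by (metis minus_le_iff minus_minus)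
  then obtain v where "v \<in> F" "io_up (\<lambda>i. x (- i)) v"
    using io_up_finite[OF assms(1), of "\<lambda>i. x (- i)"] by blast
  moreover from this(2) have "io_down x v"
    unfolding io_down_def io_up_def by (metis minus_le_iff minus_minus neg_le_iff_le)
  ultimately show thesis using that by blast
qed

lemma io_up_shift: "io_up x v \<Longrightarrow> io_up (\<lambda>i. x (i + k)) v"
  unfolding io_up_def
proof (intro allI)
  fix m assume "\<forall>m. \<exists>i\<ge>m. x i = v"
  then obtain i where "i \<ge> m + k" "x i = v" by blast
  then show "\<exists>i\<ge>m. x (i + k) = v" by (intro exI[of _ "i - k"]) auto
qed

lemma io_down_shift: "io_down x v \<Longrightarrow> io_down (\<lambda>i. x (i + k)) v"
  unfolding io_down_def
proof (intro allI)
  fix m assume "\<forall>m. \<exists>i\<le>m. x i = v"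
  then obtain i where "i \<le> m + k" "x i = v" by blast
  then show "\<exists>i\<le>m. x (i + k) = v" by (intro exI[of _ "i - k"]) auto
qed

lemma markov_shift_shift: "x \<in> markov_shift E \<Longrightarrow> (\<lambda>i. x (i + k)) \<in> markov_shift E"
  unfolding markov_shift_def
proof safe
  fix n assume "\<forall>n. (x n, x (n + 1)) \<in> E"
  then have "(x (n + k), x (n + k + 1)) \<in> E" by blast
  then show "(x (n + k), x (n + 1 + k)) \<in> E" by (simp add: algebra_simps)
qed

lemma regular_part_markov_shift:
  "x \<in> regular_part (markov_shift E) \<Longrightarrow> (\<lambda>i. x (i + k)) \<in> regular_part (markov_shift E)"
  unfolding regular_part_iff
  by (intro conjI; elim conjE exE) (auto intro: markov_shift_shift dest: io_up_shift[where k = k] io_down_shift[where k = k])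

lemma markov_shiftD: "x \<in> markov_shift E \<Longrightarrow> (x i, x (i + 1)) \<in> E"
  by (simp add: markov_shift_def)

lemma regular_partD: "x \<in> regular_part Z \<Longrightarrow> x \<in> Z"
  by (simp add: regular_part_def)

section \<open>Fibres of an excellent semiconjugacy as sets of related paths\<close>

locale bowen_map =
  fixes A :: "'a set" and E :: "('a \<times> 'a) set" and T :: "'y \<Rightarrow> 'y" and M :: "'y measure"
    and p :: "(int \<Rightarrow> 'a) \<Rightarrow> 'y" and R :: "('a \<times> 'a) set"
  assumes graph: "shift_graph A E"
    and dyn: "dynamical_system T M"
    and semi: "semiconjugacy (regular_part (markov_shift E)) T M p"
    and meas: "p \<in> borel_of_top (symb_top (regular_part (markov_shift E))) \<rightarrow>\<^sub>M M"
    and fibre: "\<forall>y\<in>space M. finite {x \<in> regular_part (markov_shift E). p x = y}"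
    and R_sub: "R \<subseteq> A \<times> A" and R_refl: "refl_on A R" and R_sym: "sym R"
    and R_fin: "locally_finite_on A R"
    and R_iff: "\<forall>x\<in>regular_part (markov_shift E). \<forall>y\<in>regular_part (markov_shift E).
       p x = p y \<longleftrightarrow> (\<forall>n. (x n, y n) \<in> R)"
begin

abbreviation X where "X \<equiv> markov_shift E"
abbreviation Xr where "Xr \<equiv> regular_part (markov_shift E)"

definition rel where "rel x y \<longleftrightarrow> (\<forall>n::int. (x n, y n) \<in> R)"

text \<open>Defined without \<open>p\<close> and inside all of \<open>X\<close>, so that membership
  of a path glued by hand is checked symbol by symbol. For regular \<open>x\<close> it is the fibre
  of \<open>p\<close> through \<open>x\<close>.\<close>

definition Fib where "Fib x = {z \<in> X. rel x z}"

lemma X_in_A: "x \<in> X \<Longrightarrow> x i \<in> A"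
  using graph markov_shiftD[of x E i] by (auto simp: shift_graph_def)

lemma R_nbrs: "finite {b. (a, b) \<in> R}"
proof (cases "a \<in> A")
  case True
  have "{b. (a, b) \<in> R} = {b \<in> A. (b, a) \<in> R}" using R_sub R_sym by (auto dest: symD)
  then show ?thesis using R_fin True by (simp add: locally_finite_on_def)
next
  case False
  then have "{b. (a, b) \<in> R} = {}" using R_sub by auto
  then show ?thesis by (metis finite.emptyI)
qed

lemma R_refl': "a \<in> A \<Longrightarrow> (a, a) \<in> R" using R_refl by (rule refl_onD)

lemma rel_refl: "x \<in> X \<Longrightarrow> rel x x" using X_in_A R_refl' by (auto simp: rel_def)

lemma rel_shift: "rel x y \<Longrightarrow> rel (\<lambda>i. x (i + k)) (\<lambda>i. y (i + k))" by (simp add: rel_def)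

text \<open>The symbols related to one that recurs in \<open>x\<close> form a finite set, so by
  pigeonhole one of them recurs in \<open>y\<close>.\<close>

lemma rel_regular:
  assumes "x \<in> Xr" "y \<in> X" "rel x y"
  shows "y \<in> Xr"
proof -
  obtain u v where u: "io_down x u" and v: "io_up x v" using assms(1) by (auto simp: regular_part_iff)
  have "\<exists>i\<ge>m. y i \<in> {b. (v, b) \<in> R}" for m
    using v assms(3) unfolding io_up_def rel_def by (metis mem_Collect_eq)
  then obtain v' where "io_up y v'" using io_up_finite[OF R_nbrs] by blast
  moreover have "\<exists>i\<le>m. y i \<in> {b. (u, b) \<in> R}" for m
    using u assms(3) unfolding io_down_def rel_def by (metis mem_Collect_eq)
  then obtain u' where "io_down y u'" using io_down_finite[OF R_nbrs] by blast
  ultimately show ?thesis using assms(2) by (auto simp: regular_part_iff)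
qed

lemma p_eq_iff: "x \<in> Xr \<Longrightarrow> y \<in> Xr \<Longrightarrow> p x = p y \<longleftrightarrow> rel x y"
  using R_iff by (simp add: rel_def)

lemma p_space: "x \<in> Xr \<Longrightarrow> p x \<in> space M"
  using semi by (auto simp: semiconjugacy_def)

lemma p_left_shift: "x \<in> Xr \<Longrightarrow> p (left_shift x) = T (p x)"
  using semi by (auto simp: semiconjugacy_def)

lemma Fib_eq_fibre: "x \<in> Xr \<Longrightarrow> Fib x = {z \<in> Xr. p z = p x}"
proof (intro equalityI subsetI)
  fix z assume x: "x \<in> Xr"
  show "z \<in> {z \<in> Xr. p z = p x}" if "z \<in> Fib x"
    using that rel_regular[OF x] p_eq_iff[OF x, of z] by (auto simp: Fib_def)
  show "z \<in> Fib x" if "z \<in> {z \<in> Xr. p z = p x}"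
    using that p_eq_iff[OF x, of z] by (auto simp: Fib_def dest: regular_partD)
qed

lemma finite_Fib: "x \<in> Xr \<Longrightarrow> finite (Fib x)"
  using fibre p_space by (simp add: Fib_eq_fibre)

lemma Fib_self: "x \<in> X \<Longrightarrow> x \<in> Fib x" by (simp add: Fib_def rel_refl)

lemma Fib_cong: "x \<in> Xr \<Longrightarrow> z \<in> Fib x \<Longrightarrow> Fib z = Fib x"
  by (auto simp: Fib_eq_fibre)

text \<open>\<open>R\<close> is not assumed transitive; transitivity of \<open>rel\<close> on
  regular points comes from equality of the images under \<open>p\<close>.\<close>

lemma Fib_rel: "x \<in> Xr \<Longrightarrow> z \<in> Fib x \<Longrightarrow> z' \<in> Fib x \<Longrightarrow> rel z z'"
  by (simp add: Fib_eq_fibre p_eq_iff[symmetric])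

end

section \<open>Covers of a Markov shift by bundles of disjoint paths\<close>

locale set_cover = bowen_map A E T M p R
  for A :: "'a set" and E and T :: "'y \<Rightarrow> 'y" and M p R +
  fixes A' :: "nat set" and E' :: "(nat \<times> nat) set" and D :: "nat \<Rightarrow> 'a set"
  assumes E'_sub: "E' \<subseteq> A' \<times> A'"
    and D_inj: "inj_on D A'"
    and D_ne: "\<alpha> \<in> A' \<Longrightarrow> D \<alpha> \<noteq> {}"
    and D_R: "\<alpha> \<in> A' \<Longrightarrow> D \<alpha> \<times> D \<alpha> \<subseteq> R"
    and succ: "(\<alpha>, \<beta>) \<in> E' \<Longrightarrow> a \<in> D \<alpha> \<Longrightarrow> \<exists>b\<in>D \<beta>. (a, b) \<in> E"
    and pred: "(\<alpha>, \<beta>) \<in> E' \<Longrightarrow> b \<in> D \<beta> \<Longrightarrow> \<exists>a\<in>D \<alpha>. (a, b) \<in> E"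
    and succ_unique: "(\<alpha>, \<beta>) \<in> E' \<Longrightarrow> a \<in> D \<alpha> \<Longrightarrow> b \<in> D \<beta> \<Longrightarrow> b' \<in> D \<beta> \<Longrightarrow>
      (a, b) \<in> E \<Longrightarrow> (a, b') \<in> E \<Longrightarrow> b = b'"
    and pred_unique: "(\<alpha>, \<beta>) \<in> E' \<Longrightarrow> b \<in> D \<beta> \<Longrightarrow> a \<in> D \<alpha> \<Longrightarrow> a' \<in> D \<alpha> \<Longrightarrow>
      (a, b) \<in> E \<Longrightarrow> (a', b) \<in> E \<Longrightarrow> a = a'"
begin

abbreviation X' where "X' \<equiv> markov_shift E'"
abbreviation Xr' where "Xr' \<equiv> regular_part (markov_shift E')"

text \<open>By the axioms \<open>E\<close> restricts to a bijection between the endpoint sets of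
  each arrow, so exactly one thread of a path in \<open>X'\<close> passes through each element of
  each of its sets.\<close>

definition thread where "thread s x \<longleftrightarrow> x \<in> X \<and> (\<forall>n. x n \<in> D (s n))"

text \<open>The start depends on \<open>s 0\<close> alone, so paths that agree on a window around 0
  get threads that agree there; this is what makes \<open>q\<close> 1-Lipschitz.\<close>

definition q where "q s = (SOME x. thread s x \<and> x 0 = (SOME a. a \<in> D (s 0)))"

lemma X'_in_A': "s \<in> X' \<Longrightarrow> s i \<in> A'"
  using E'_sub markov_shiftD[of s E' i] by auto

lemma D_fin: "\<alpha> \<in> A' \<Longrightarrow> finite (D \<alpha>)"
proof -
  assume "\<alpha> \<in> A'"
  then obtain a where "a \<in> D \<alpha>" using D_ne by blast
  then have "D \<alpha> \<subseteq> {b. (a, b) \<in> R}" using D_R[OF \<open>\<alpha> \<in> A'\<close>] by auto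
  then show ?thesis using R_nbrs finite_subset by blast
qed

text \<open>All sets containing \<open>a\<close> are subsets of the finite set of symbols related to
  \<open>a\<close>, and \<open>D\<close> is injective. This is the finiteness behind the properness
  of \<open>q\<close>, the regularity of covering paths and the local finiteness of the new
  relation.\<close>

lemma finite_containing: "finite {\<alpha> \<in> A'. a \<in> D \<alpha>}"
proof (rule finite_imageD)
  have "D ` {\<alpha> \<in> A'. a \<in> D \<alpha>} \<subseteq> Pow {b. (a, b) \<in> R}" using D_R by auto
  then show "finite (D ` {\<alpha> \<in> A'. a \<in> D \<alpha>})" using R_nbrs by (meson finite_Pow_iff finite_subset)
  show "inj_on D {\<alpha> \<in> A'. a \<in> D \<alpha>}" using D_inj by (rule inj_on_subset) auto
qed

lemma thread_exists:
  assumes s: "s \<in> X'" and a: "a \<in> D (s k)"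
  obtains x where "thread s x" "x k = a"
proof -
  have "\<exists>f. \<forall>n. (f n \<in> D (s (k + int n)) \<and> (n = 0 \<longrightarrow> f n = a)) \<and> (f n, f (Suc n)) \<in> E"
  proof (rule dependent_nat_choice)
    show "\<exists>x. x \<in> D (s (k + int 0)) \<and> (0 = (0::nat) \<longrightarrow> x = a)" using a by simp
    fix x n assume "x \<in> D (s (k + int n)) \<and> (n = 0 \<longrightarrow> x = a)"
    then have "\<exists>b\<in>D (s (k + int n + 1)). (x, b) \<in> E"
      using succ[OF markov_shiftD[OF s, of "k + int n"]] by simp
    then show "\<exists>y. (y \<in> D (s (k + int (Suc n))) \<and> (Suc n = 0 \<longrightarrow> y = a)) \<and> (x, y) \<in> E"
      by (auto simp: algebra_simps)
  qed
  then obtain f where f: "\<And>n. f n \<in> D (s (k + int n))" "f 0 = a" "\<And>n. (f n, f (Suc n)) \<in> E" by blast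
  have "\<exists>f. \<forall>n. (f n \<in> D (s (k - int n)) \<and> (n = 0 \<longrightarrow> f n = a)) \<and> (f (Suc n), f n) \<in> E"
  proof (rule dependent_nat_choice)
    show "\<exists>x. x \<in> D (s (k - int 0)) \<and> (0 = (0::nat) \<longrightarrow> x = a)" using a by simp
    fix x n assume "x \<in> D (s (k - int n)) \<and> (n = 0 \<longrightarrow> x = a)"
    then have "\<exists>b\<in>D (s (k - int n - 1)). (b, x) \<in> E"
      using pred[OF markov_shiftD[OF s, of "k - int n - 1"]] by simp
    then show "\<exists>y. (y \<in> D (s (k - int (Suc n))) \<and> (Suc n = 0 \<longrightarrow> y = a)) \<and> (y, x) \<in> E"
      by (auto simp: algebra_simps)
  qed
  then obtain g where g: "\<And>n. g n \<in> D (s (k - int n))" "g 0 = a" "\<And>n. (g (Suc n), g n) \<in> E" by blast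
  define x where "x i = (if i \<ge> k then f (nat (i - k)) else g (nat (k - i)))" for i
  have "(x i, x (i + 1)) \<in> E" for i
  proof (cases "i \<ge> k")
    case True
    then have "nat (i + 1 - k) = Suc (nat (i - k))" by linarith
    then show ?thesis using True f(3) by (simp add: x_def)
  next
    case False
    then have "nat (k - i) = Suc (nat (k - (i + 1)))" by linarith
    moreover have "x (i + 1) = g (nat (k - (i + 1)))"
      using False f(2) g(2) by (auto simp: x_def)
    ultimately show ?thesis using False g(3) by (simp add: x_def)
  qed
  moreover have "x i \<in> D (s i)" for i
    using f(1)[of "nat (i - k)"] g(1)[of "nat (k - i)"] by (auto simp: x_def)
  ultimately have "thread s x" by (auto simp: thread_def markov_shift_def)
  moreover have "x k = a" using f(2) by (simp add: x_def)
  ultimately show thesis using that by blast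
qed

lemma threads_through:
  assumes "s \<in> X'" shows "D (s n) = {x n | x. thread s x}"
  using thread_exists[OF assms] by (auto simp: thread_def) metis

text \<open>One common value propagates in both directions as long as the two paths carry the same
  sets, by uniqueness of successors and predecessors.\<close>

lemma thread_agree:
  assumes s: "s \<in> X'" "thread s x" "thread s' x'" "x k = x' k"
    and eq: "\<And>i. m \<le> i \<Longrightarrow> i \<le> n \<Longrightarrow> s i = s' i" and k: "m \<le> k" "k \<le> n"
    and i: "m \<le> i" "i \<le> n"
  shows "x i = x' i"
proof (cases "k \<le> i")
  case True
  then show ?thesis using i(2)
  proof (induction i rule: int_ge_induct)
    case (step i)
    then have eqs: "s (i + 1) = s' (i + 1)" "x i = x' i" using eq k by auto
    show ?case
    proof (rule succ_unique[OF markov_shiftD[OF s(1)]])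
      show "x i \<in> D (s i)" "x (i + 1) \<in> D (s (i + 1))" using s(2) by (auto simp: thread_def)
      show "x' (i + 1) \<in> D (s (i + 1))" using s(3) eqs by (auto simp: thread_def)
      show "(x i, x (i + 1)) \<in> E" using s(2) by (auto simp: thread_def markov_shift_def)
      have "(x' i, x' (i + 1)) \<in> E" using s(3) by (auto simp: thread_def markov_shift_def)
      then show "(x i, x' (i + 1)) \<in> E" using eqs(2) by simp
    qed
  qed (use s in simp)
next
  case False
  then have "i \<le> k" by simp
  then show ?thesis using i(1)
  proof (induction i rule: int_le_induct)
    case (step i)
    then have eqs: "s (i - 1) = s' (i - 1)" "x i = x' i" using eq k by auto
    show ?case
    proof (rule pred_unique[OF markov_shiftD[OF s(1), of "i - 1"]])
      show "x (i - 1) \<in> D (s (i - 1))" "x i \<in> D (s (i - 1 + 1))" using s(2) by (auto simp: thread_def)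
      show "x' (i - 1) \<in> D (s (i - 1))" using s(3) eqs by (auto simp: thread_def)
      show "(x (i - 1), x i) \<in> E" using s(2) markov_shiftD[of x E "i - 1"] by (simp add: thread_def)
      have "(x' (i - 1), x' i) \<in> E" using s(3) markov_shiftD[of x' E "i - 1"] by (simp add: thread_def)
      then show "(x' (i - 1), x i) \<in> E" using eqs(2) by simp
    qed
  qed (use s in simp)
qed

lemma q_thread: "s \<in> X' \<Longrightarrow> thread s (q s) \<and> q s 0 = (SOME a. a \<in> D (s 0))"
proof -
  assume s: "s \<in> X'"
  have "(SOME a. a \<in> D (s 0)) \<in> D (s 0)" using D_ne[OF X'_in_A'[OF s]] by (simp add: some_in_eq)
  then have "\<exists>x. thread s x \<and> x 0 = (SOME a. a \<in> D (s 0))" using thread_exists[OF s] by metis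
  then show ?thesis unfolding q_def by (rule someI_ex)
qed

lemma q_X: "s \<in> X' \<Longrightarrow> q s \<in> X" using q_thread by (auto simp: thread_def)

lemma q_agree:
  assumes "s \<in> X'" "s' \<in> X'" "agree n s s'"
  shows "agree n (q s) (q s')"
  unfolding agree_def
proof (intro allI impI)
  fix i assume i: "\<bar>i\<bar> \<le> int n"
  have eq: "s j = s' j" if "- int n \<le> j" "j \<le> int n" for j
    using assms(3) that unfolding agree_def by (metis abs_le_iff minus_le_iff)
  then have "s 0 = s' 0" by simp
  then have "q s 0 = q s' 0" using q_thread[OF assms(1)] q_thread[OF assms(2)] by metis
  then show "q s i = q s' i"
  proof (rule thread_agree[OF assms(1) conjunct1[OF q_thread[OF assms(1)]] conjunct1[OF q_thread[OF assms(2)]]])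
    show "- int n \<le> 0" "0 \<le> int n" "- int n \<le> i" "i \<le> int n" using i by auto
  qed (rule eq)
qed

lemma one_lipschitz_q: "one_lipschitz X' X q"
  unfolding one_lipschitz_def using q_X q_agree by (auto intro: symb_dist_le_if_agree)

lemma threads_rel: "s \<in> X' \<Longrightarrow> thread s x \<Longrightarrow> thread s y \<Longrightarrow> rel x y"
  using D_R[OF X'_in_A'] by (fastforce simp: thread_def rel_def)

text \<open>Two pigeonholes: a recurring symbol lies in finitely many vertices, and a recurring
  vertex contains finitely many symbols.\<close>

lemma thread_regular_iff:
  assumes s: "s \<in> X'" and x: "thread s x"
  shows "x \<in> Xr \<longleftrightarrow> s \<in> Xr'"
proof
  assume "x \<in> Xr"
  then obtain u v where u: "io_down x u" and v: "io_up x v" by (auto simp: regular_part_iff)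
  have "\<exists>i\<ge>m. s i \<in> {\<alpha> \<in> A'. v \<in> D \<alpha>}" for m
    using v x X'_in_A'[OF s] unfolding io_up_def thread_def by (metis (mono_tags, lifting) mem_Collect_eq)
  then obtain v' where "io_up s v'" using io_up_finite[OF finite_containing] by blast
  moreover have "\<exists>i\<le>m. s i \<in> {\<alpha> \<in> A'. u \<in> D \<alpha>}" for m
    using u x X'_in_A'[OF s] unfolding io_down_def thread_def by (metis (mono_tags, lifting) mem_Collect_eq)
  then obtain u' where "io_down s u'" using io_down_finite[OF finite_containing] by blast
  ultimately show "s \<in> Xr'" using s by (auto simp: regular_part_iff)
next
  assume "s \<in> Xr'"
  then obtain \<alpha> \<beta> where \<alpha>: "io_down s \<alpha>" and \<beta>: "io_up s \<beta>" by (auto simp: regular_part_iff)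
  then have A': "\<alpha> \<in> A'" "\<beta> \<in> A'" using X'_in_A'[OF s] unfolding io_down_def io_up_def by metis+
  have "\<exists>i\<ge>m. x i \<in> D \<beta>" for m using \<beta> x unfolding io_up_def thread_def by metis
  then obtain v where "io_up x v" using io_up_finite[OF D_fin[OF A'(2)]] by blast
  moreover have "\<exists>i\<le>m. x i \<in> D \<alpha>" for m using \<alpha> x unfolding io_down_def thread_def by metis
  then obtain u where "io_down x u" using io_down_finite[OF D_fin[OF A'(1)]] by blast
  ultimately show "x \<in> Xr" using x by (auto simp: regular_part_iff thread_def)
qed

lemma q_regular_iff: "s \<in> X' \<Longrightarrow> q s \<in> Xr \<longleftrightarrow> s \<in> Xr'"
  using thread_regular_iff q_thread by blast

lemma thread_p:
  assumes "s \<in> Xr'" "thread s x"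
  shows "x \<in> Xr" "p x = p (q s)"
proof -
  have s: "s \<in> X'" using assms by (simp add: regular_part_def)
  show x: "x \<in> Xr" using thread_regular_iff[OF s assms(2)] assms(1) by simp
  have "rel x (q s)" using threads_rel[OF s assms(2)] q_thread[OF s] by simp
  then show "p x = p (q s)" using p_eq_iff x q_regular_iff[OF s] assms(1) by blast
qed

text \<open>At time \<open>i\<close> the set \<open>K\<close> shows finitely many symbols, each in
  finitely many vertices, so the preimage is a closed subset of a compact box.\<close>

lemma compact_vimage_q:
  assumes K: "compactin (symb_top X) K"
  shows "compactin (symb_top X') (q -` K \<inter> X')"
proof -
  define F where "F i = {\<alpha> \<in> A'. \<exists>x\<in>K. x i \<in> D \<alpha>}" for i
  have "F i = (\<Union>a\<in>(\<lambda>x. x i) ` K. {\<alpha> \<in> A'. a \<in> D \<alpha>})" for i by (auto simp: F_def)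
  then have "finite (F i)" for i
    using finite_UN_I[OF finite_coordinates_compact[OF K, of i], of "\<lambda>a. {\<alpha> \<in> A'. a \<in> D \<alpha>}"]
      finite_containing by simp
  then have "compactin (symb_top UNIV) {s. \<forall>i. s i \<in> F i}" by (rule compactin_symb_top_box)
  then have "compactin (symb_top UNIV) ({s. \<forall>i. s i \<in> F i} \<inter> X')"
    by (rule compact_Int_closedin[OF _ closedin_markov_shift])
  then have "compactin (symb_top X') ({s. \<forall>i. s i \<in> F i} \<inter> X')"
    by (subst compactin_symb_top) auto
  moreover have "q -` K \<inter> X' \<subseteq> {s. \<forall>i. s i \<in> F i} \<inter> X'"
    using q_thread X'_in_A' by (auto simp: F_def thread_def)
  moreover have "closedin (symb_top X') (q -` K \<inter> X')"
  proof -
    have "Hausdorff_space (symb_top X)"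
      unfolding symb_top_def by (rule Metric_space.Hausdorff_space_mtopology[OF Metric_space_symb_dist])
    then have "closedin (symb_top X) K" using K by (rule compactin_imp_closedin)
    moreover have "continuous_map (symb_top X') (symb_top X) q"
      using q_X q_agree by (intro continuous_map_symb_top) auto
    ultimately have "closedin (symb_top X') {s \<in> topspace (symb_top X'). q s \<in> K}"
      by (rule closedin_continuous_map_preimage[rotated])
    moreover have "{s \<in> topspace (symb_top X'). q s \<in> K} = q -` K \<inter> X'" by auto
    ultimately show ?thesis by simp
  qed
  ultimately show ?thesis by (rule closed_compactin)
qed

lemma compact_vimage_q_regular:
  assumes K: "compactin (symb_top Xr) K"
  shows "compactin (symb_top Xr') (q -` K \<inter> Xr')"
proof -
  have KX: "K \<subseteq> Xr" "compactin (symb_top X) K"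
    using K regular_partD[of _ X] unfolding compactin_symb_top[of Xr] compactin_symb_top[of X] by blast+
  have "q -` K \<inter> X' = q -` K \<inter> Xr'"
    using KX(1) q_regular_iff regular_partD[of _ X'] by blast
  then have "compactin (symb_top UNIV) (q -` K \<inter> Xr')"
    using compact_vimage_q[OF KX(2)] unfolding compactin_symb_top[of X'] by simp
  then show ?thesis unfolding compactin_symb_top[of Xr'] by blast
qed

lemma locally_compact_cover:
  assumes "locally_compact_space (symb_top X)"
  shows "locally_compact_space (symb_top X')"
  unfolding locally_compact_space_def
proof
  fix s assume s: "s \<in> topspace (symb_top X')"
  then obtain U K where UK: "openin (symb_top X) U" "compactin (symb_top X) K" "q s \<in> U" "U \<subseteq> K"
    using assms q_X unfolding locally_compact_space_def by (metis topspace_symb_top)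
  have "continuous_map (symb_top X') (symb_top X) q"
    using q_X q_agree by (intro continuous_map_symb_top) auto
  then have "openin (symb_top X') {s \<in> topspace (symb_top X'). q s \<in> U}"
    using UK(1) by (rule openin_continuous_map_preimage)
  then show "\<exists>U K. openin (symb_top X') U \<and> compactin (symb_top X') K \<and> s \<in> U \<and> U \<subseteq> K"
    using compact_vimage_q[OF UK(2)] UK s
    by (intro exI[of _ "{s \<in> topspace (symb_top X'). q s \<in> U}"] exI[of _ "q -` K \<inter> X'"] conjI) auto
qed

text \<open>All pairs are required to be related. Threads pass through every element of the sets,
  and all threads of a regular path have the same image, so equality of images forces the whole
  product into \<open>R\<close>.\<close>

definition R' where "R' = {(\<alpha>, \<beta>). \<alpha> \<in> A' \<and> \<beta> \<in> A' \<and> D \<alpha> \<times> D \<beta> \<subseteq> R}"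

lemma p'_eq_iff:
  assumes "s \<in> Xr'" "s' \<in> Xr'"
  shows "p (q s) = p (q s') \<longleftrightarrow> (\<forall>n. (s n, s' n) \<in> R')"
proof
  have X: "s \<in> X'" "s' \<in> X'" using assms by (auto simp: regular_part_def)
  show "\<forall>n. (s n, s' n) \<in> R'" if eq: "p (q s) = p (q s')"
  proof
    fix n
    have "(a, b) \<in> R" if ab: "a \<in> D (s n)" "b \<in> D (s' n)" for a b
    proof -
      obtain x where "thread s x" "x n = a" by (rule thread_exists[OF X(1) ab(1)])
      moreover obtain y where "thread s' y" "y n = b" by (rule thread_exists[OF X(2) ab(2)])
      ultimately show ?thesis using thread_p[OF assms(1)] thread_p[OF assms(2)] eq p_eq_iff[of x y]
        by (auto simp: rel_def)
    qed
    then show "(s n, s' n) \<in> R'" using X X'_in_A' by (auto simp: R'_def)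
  qed
  show "p (q s) = p (q s')" if "\<forall>n. (s n, s' n) \<in> R'"
  proof -
    have "rel (q s) (q s')"
      using that q_thread[OF X(1)] q_thread[OF X(2)] by (fastforce simp: R'_def rel_def thread_def)
    then show ?thesis using p_eq_iff q_regular_iff X assms by blast
  qed
qed

text \<open>The threads of a path fill its sets at every time, so their collection gives back the
  sets and, by injectivity of \<open>D\<close>, the vertices. The threads of a regular path lie in
  one fibre of \<open>p\<close>, so a fibre of the cover embeds into the power set of that fibre;
  this is the origin of the bound by a power of 2.\<close>

lemma fibre_inj: "inj_on (\<lambda>s. Collect (thread s)) X'"
proof (rule inj_onI)
  fix s s' assume s: "s \<in> X'" "s' \<in> X'" "Collect (thread s) = Collect (thread s')"
  then have "thread s x \<longleftrightarrow> thread s' x" for x by (simp add: set_eq_iff)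
  then have D: "D (s n) = D (s' n)" for n using threads_through s by simp
  show "s = s'"
  proof
    fix n show "s n = s' n" using inj_onD[OF D_inj D] X'_in_A' s by simp
  qed
qed

lemma fibre_card:
  assumes "y \<in> space M"
  shows "finite {s \<in> Xr'. p (q s) = y}"
    and "card {s \<in> Xr'. p (q s) = y} \<le> 2 ^ card {x \<in> Xr. p x = y}"
proof -
  let ?S = "{s \<in> Xr'. p (q s) = y}" and ?F = "{x \<in> Xr. p x = y}"
  have inj: "inj_on (\<lambda>s. Collect (thread s)) ?S"
    using fibre_inj by (rule inj_on_subset) (auto simp: regular_part_def)
  have sub: "(\<lambda>s. Collect (thread s)) ` ?S \<subseteq> Pow ?F" using thread_p by auto
  have fin: "finite (Pow ?F)" using fibre assms by simp
  show "finite ?S" using inj sub fin by (meson finite_imageD finite_subset)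
  show "card ?S \<le> 2 ^ card ?F"
    using card_inj_on_le[OF inj sub fin] fibre assms by (simp add: card_Pow)
qed

lemma left_shift_Xr': "s \<in> Xr' \<Longrightarrow> left_shift s \<in> Xr'"
  unfolding left_shift_def by (rule regular_part_markov_shift)

text \<open>Shifting the chosen thread gives a thread of the shifted path, in general not the chosen
  one; both have the same image.\<close>

lemma p'_left_shift:
  assumes "s \<in> Xr'"
  shows "p (q (left_shift s)) = T (p (q s))"
proof -
  have s: "s \<in> X'" using assms by (simp add: regular_part_def)
  have "thread (left_shift s) (left_shift (q s))"
    using q_thread[OF s] markov_shift_shift[of "q s" E 1] by (auto simp: thread_def left_shift_def)
  then have "p (left_shift (q s)) = p (q (left_shift s))" by (rule thread_p[OF left_shift_Xr'[OF assms]])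
  then show ?thesis using p_left_shift q_regular_iff[OF s] assms by simp
qed

lemma excellent_cover: "excellent A' Xr' T M (\<lambda>s. p (q s))"
  unfolding excellent_def
proof (intro conjI)
  have qr: "s \<in> Xr' \<Longrightarrow> q s \<in> Xr" for s using q_regular_iff by (auto simp: regular_part_def)
  show "semiconjugacy Xr' T M (\<lambda>s. p (q s))"
    using qr p_space p'_left_shift by (auto simp: semiconjugacy_def)
  have "continuous_map (symb_top Xr') (symb_top Xr) q"
    using qr q_agree by (intro continuous_map_symb_top) (auto simp: regular_part_def)
  then have "q \<in> borel_of_top (symb_top Xr') \<rightarrow>\<^sub>M borel_of_top (symb_top Xr)"
    by (rule continuous_map_measurable_borel_of_top)
  then show "(\<lambda>s. p (q s)) \<in> borel_of_top (symb_top Xr') \<rightarrow>\<^sub>M M" using meas by (rule measurable_compose)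
  show "\<forall>y\<in>space M. finite {x \<in> Xr'. p (q x) = y}" using fibre_card by blast
  have "finite {\<beta> \<in> A'. (\<beta>, \<alpha>) \<in> R'}" if "\<alpha> \<in> A'" for \<alpha>
  proof -
    obtain a where "a \<in> D \<alpha>" using D_ne \<open>\<alpha> \<in> A'\<close> by blast
    have "{\<beta> \<in> A'. (\<beta>, \<alpha>) \<in> R'} \<subseteq> (\<Union>b\<in>{b. (a, b) \<in> R}. {\<beta> \<in> A'. b \<in> D \<beta>})"
    proof
      fix \<beta> assume "\<beta> \<in> {\<beta> \<in> A'. (\<beta>, \<alpha>) \<in> R'}"
      then have \<beta>: "\<beta> \<in> A'" "D \<beta> \<times> D \<alpha> \<subseteq> R" by (auto simp: R'_def)
      then obtain b where "b \<in> D \<beta>" using D_ne by blast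
      moreover from this have "(a, b) \<in> R" using \<beta> \<open>a \<in> D \<alpha>\<close> R_sym by (auto dest: symD)
      ultimately show "\<beta> \<in> (\<Union>b\<in>{b. (a, b) \<in> R}. {\<beta> \<in> A'. b \<in> D \<beta>})" using \<beta> by blast
    qed
    then show ?thesis using R_nbrs finite_containing by (meson finite_UN_I finite_subset)
  qed
  moreover have "refl_on A' R'" using D_R by (auto simp: refl_on_def R'_def)
  moreover have "R' \<subseteq> A' \<times> A'" by (auto simp: R'_def)
  moreover have "sym R'" unfolding sym_def R'_def using R_sym by (auto dest: symD)
  ultimately show "\<exists>R. R \<subseteq> A' \<times> A' \<and> refl_on A' R \<and> sym R \<and> locally_finite_on A' R \<and>
      (\<forall>x\<in>Xr'. \<forall>y\<in>Xr'. p (q x) = p (q y) \<longleftrightarrow> (\<forall>n. (x n, y n) \<in> R))"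
    using p'_eq_iff by (intro exI[of _ R']) (auto simp: locally_finite_on_def)
qed

text \<open>Which pair of symbols recurs in \<open>q s\<close> is not known, only that it lies in
  the product of the two sets, so the exponent sums \<open>C\<close> over that product.\<close>

lemma multiplicity_bound_cover:
  assumes C: "multiplicity_bound A Xr p C"
  shows "multiplicity_bound A' Xr' (\<lambda>s. p (q s)) (\<lambda>\<alpha> \<beta>. 2 ^ (\<Sum>a\<in>D \<alpha>. \<Sum>b\<in>D \<beta>. C a b))"
  unfolding multiplicity_bound_def infinite_pos_up infinite_pos_down
proof (intro ballI impI)
  fix s \<alpha> \<beta> assume s: "s \<in> Xr'" and \<alpha>: "\<alpha> \<in> A'" and \<beta>: "\<beta> \<in> A'" and io: "io_down s \<alpha> \<and> io_up s \<beta>"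
  have sX: "s \<in> X'" using s by (simp add: regular_part_def)
  have qs: "q s \<in> Xr" using q_regular_iff[OF sX] s by simp
  have qD: "q s i \<in> D (s i)" for i using q_thread[OF sX] by (simp add: thread_def)
  have "\<exists>i\<ge>m. q s i \<in> D \<beta>" for m using io qD unfolding io_up_def by metis
  then obtain b where b: "b \<in> D \<beta>" "io_up (q s) b" using io_up_finite[OF D_fin[OF \<beta>]] by blast
  have "\<exists>i\<le>m. q s i \<in> D \<alpha>" for m using io qD unfolding io_down_def by metis
  then obtain a where a: "a \<in> D \<alpha>" "io_down (q s) a" using io_down_finite[OF D_fin[OF \<alpha>]] by blast
  have "a \<in> A" "b \<in> A" using a b X_in_A[OF q_X[OF sX]] unfolding io_down_def io_up_def by metis+
  then have "card {z \<in> Xr. p z = p (q s)} \<le> C a b"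
    using C a b qs unfolding multiplicity_bound_def infinite_pos_up infinite_pos_down by blast
  also have "\<dots> \<le> (\<Sum>b\<in>D \<beta>. C a b)" using b D_fin[OF \<beta>] by (intro member_le_sum) auto
  also have "\<dots> \<le> (\<Sum>a\<in>D \<alpha>. \<Sum>b\<in>D \<beta>. C a b)"
    using a D_fin[OF \<alpha>] by (intro member_le_sum[of a "D \<alpha>" "\<lambda>a. \<Sum>b\<in>D \<beta>. C a b"]) auto
  finally have "(2::nat) ^ card {z \<in> Xr. p z = p (q s)} \<le> 2 ^ (\<Sum>a\<in>D \<alpha>. \<Sum>b\<in>D \<beta>. C a b)"
    by (intro power_increasing) auto
  then show "finite {z \<in> Xr'. p (q z) = p (q s)} \<and>
      card {z \<in> Xr'. p (q z) = p (q s)} \<le> 2 ^ (\<Sum>a\<in>D \<alpha>. \<Sum>b\<in>D \<beta>. C a b)"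
    using fibre_card[OF p_space[OF qs]] by linarith
qed

end

section \<open>Periodic points with minimal fibre\<close>

definition has_period :: "(int \<Rightarrow> 'a) \<Rightarrow> int \<Rightarrow> bool" where
  "has_period x P \<longleftrightarrow> P > 0 \<and> (\<forall>n. x (n + P) = x n)"

definition periodic :: "(int \<Rightarrow> 'a) \<Rightarrow> bool" where
  "periodic x \<longleftrightarrow> (\<exists>P. has_period x P)"

lemma has_period_nat_mult: "has_period x P \<Longrightarrow> x (n + int k * P) = x n"
proof (induction k)
  case (Suc k)
  have "x (n + int (Suc k) * P) = x ((n + int k * P) + P)" by (simp add: algebra_simps)
  also have "\<dots> = x (n + int k * P)" using Suc.prems by (simp add: has_period_def)
  finally show ?case using Suc by simp
qed simp

lemma has_period_mult:
  assumes "has_period x P" shows "x (n + k * P) = x n"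
proof (cases "k \<ge> 0")
  case True
  then show ?thesis using has_period_nat_mult[OF assms, of n "nat k"] by simp
next
  case False
  then show ?thesis using has_period_nat_mult[OF assms, of "n + k * P" "nat (- k)"] by simp
qed

lemma has_period_multiple: "has_period x P \<Longrightarrow> k > 0 \<Longrightarrow> has_period x (k * P)"
  using has_period_mult[of x P] by (simp add: has_period_def)

lemma periodic_io:
  assumes "has_period x P" shows "io_up x (x n)" "io_down x (x n)"
proof -
  have P: "P \<ge> 1" using assms by (simp add: has_period_def)
  have bound: "\<bar>n\<bar> + \<bar>m\<bar> \<le> (\<bar>n\<bar> + \<bar>m\<bar>) * P" for m
    using mult_left_mono[OF P, of "\<bar>n\<bar> + \<bar>m\<bar>"] by simp
  show "io_up x (x n)" unfolding io_up_def
  proof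
    fix m
    show "\<exists>i\<ge>m. x i = x n"
      using bound[of m] has_period_mult[OF assms, of n "\<bar>n\<bar> + \<bar>m\<bar>"]
      by (intro exI[of _ "n + (\<bar>n\<bar> + \<bar>m\<bar>) * P"]) auto
  qed
  show "io_down x (x n)" unfolding io_down_def
  proof
    fix m
    show "\<exists>i\<le>m. x i = x n"
    proof (intro exI conjI)
      show "x (n + - (\<bar>n\<bar> + \<bar>m\<bar>) * P) = x n" by (rule has_period_mult[OF assms])
      show "n + - (\<bar>n\<bar> + \<bar>m\<bar>) * P \<le> m" unfolding mult_minus_left using bound[of m] by linarith
    qed
  qed
qed

lemma periodic_shift: "periodic x \<Longrightarrow> periodic (\<lambda>i. x (i + k))"
  unfolding periodic_def has_period_def by (metis add.assoc add.commute)

definition walk :: "('a \<times> 'a) set \<Rightarrow> (int \<Rightarrow> 'a) \<Rightarrow> int \<Rightarrow> int \<Rightarrow> bool" where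
  "walk E w m n \<longleftrightarrow> (\<forall>i. m \<le> i \<and> i < n \<longrightarrow> (w i, w (i + 1)) \<in> E)"

lemma walk_markov_shift: "x \<in> markov_shift E \<Longrightarrow> walk E x m n"
  by (simp add: walk_def markov_shift_def)

lemma trancl_walk:
  assumes "(a, b) \<in> E\<^sup>+"
  obtains k f where "k > 0" "f 0 = a" "f k = b" "walk E f 0 k"
proof -
  obtain n g where n: "n > 0" "g 0 = a" "g n = b" "\<forall>i<n. (g i, g (Suc i)) \<in> E"
    using assms unfolding trancl_power relpow_fun_conv by blast
  have "(g (nat i), g (nat (i + 1))) \<in> E" if "0 \<le> i" "i < int n" for i
  proof -
    have "nat (i + 1) = Suc (nat i)" using that by linarith
    then show ?thesis using n(4) that by (metis nat_less_iff)
  qed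
  with n show thesis by (intro that[of "int n" "\<lambda>i. g (nat i)"]) (auto simp: walk_def)
qed

text \<open>The walk of \<open>n - m\<close> steps followed by a return path of \<open>k\<close>
  steps is a cycle, and \<open>y\<close> runs around it. The return path is nonempty, so the period
  is positive even if \<open>m = n\<close>.\<close>

lemma walk_close:
  assumes w: "walk E w m n" "m \<le> n" and path: "(w n, w m) \<in> E\<^sup>+"
  obtains y where "y \<in> markov_shift E" "periodic y" "\<And>i. m \<le> i \<Longrightarrow> i \<le> n \<Longrightarrow> y i = w i"
proof -
  obtain k f where f: "k > 0" "f 0 = w n" "f k = w m" "walk E f 0 k" using trancl_walk[OF path] .
  define P where "P = n - m + k"
  have P: "P > 0" using f w by (simp add: P_def)
  define v where "v j = (if j \<le> n - m then w (m + j) else f (j - (n - m)))" for j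
  have edge: "(v j, v (j + 1)) \<in> E" if "0 \<le> j" "j < P" for j
  proof -
    consider "j < n - m" | "j = n - m" | "j > n - m" by linarith
    then show ?thesis
    proof cases
      case 1
      have "(w (m + j), w (m + j + 1)) \<in> E" using w(1) that 1 by (simp add: walk_def)
      then show ?thesis using 1 by (simp add: v_def add.assoc)
    next
      case 2
      have "(f 0, f (0 + 1)) \<in> E" using f(1,4) unfolding walk_def by blast
      then show ?thesis using 2 f(2) by (simp add: v_def)
    next
      case 3
      have "(f (j - (n - m)), f (j - (n - m) + 1)) \<in> E"
        using f(4) that 3 unfolding walk_def by (auto simp: P_def)
      then show ?thesis using 3 by (simp add: v_def algebra_simps)
    qed
  qed
  have vP: "v P = v 0" using f w by (auto simp: v_def P_def)
  define y where "y i = v ((i - m) mod P)" for i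
  have "(y i, y (i + 1)) \<in> E" for i
  proof -
    define j where "j = (i - m) mod P"
    have j: "0 \<le> j" "j < P" using P by (auto simp: j_def)
    have "(i + 1 - m) mod P = (j + 1) mod P"
      unfolding j_def mod_add_left_eq by (simp add: algebra_simps)
    also have "\<dots> = (if j + 1 = P then 0 else j + 1)" using j by auto
    finally have "y (i + 1) = v (j + 1)" using vP by (auto simp: y_def)
    moreover have "y i = v j" by (simp add: y_def j_def)
    ultimately show ?thesis using edge[OF j] by simp
  qed
  moreover have "has_period y P"
    using P by (simp add: has_period_def y_def) (metis add_diff_eq diff_add_eq mod_add_self2)
  moreover have "y i = w i" if "m \<le> i" "i \<le> n" for i
    using that f(1) by (simp add: y_def v_def P_def)
  ultimately show thesis using that by (auto simp: markov_shift_def periodic_def)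
qed

text \<open>The second walk is translated by \<open>L\<close> so that it begins where the connecting
  path of \<open>k\<close> steps ends, at time \<open>n + k\<close>.\<close>

lemma walk_append:
  assumes w: "walk E w m n" "m \<le> n" and w': "walk E w' m' n'" "m' \<le> n'"
    and path: "(w n, w' m') \<in> E\<^sup>+"
  obtains L u where "walk E u m (n' + L)" "\<And>i. m \<le> i \<Longrightarrow> i \<le> n \<Longrightarrow> u i = w i"
    "\<And>i. m' \<le> i \<Longrightarrow> i \<le> n' \<Longrightarrow> u (i + L) = w' i" "n < m' + L"
proof -
  obtain k f where f: "k > 0" "f 0 = w n" "f k = w' m'" "walk E f 0 k" using trancl_walk[OF path] .
  define L where "L = n + k - m'"
  define u where "u i = (if i \<le> n then w i else if i \<le> n + k then f (i - n) else w' (i - L))" for i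
  have "(u i, u (i + 1)) \<in> E" if i: "m \<le> i" "i < n' + L" for i
  proof -
    consider "i < n" | "n \<le> i" "i < n + k" | "i \<ge> n + k" by linarith
    then show ?thesis
    proof cases
      case 1 then show ?thesis using w(1) i by (simp add: u_def walk_def)
    next
      case 2
      have "(f (i - n), f (i - n + 1)) \<in> E" using f(4) 2 by (simp add: walk_def)
      moreover have "u i = f (i - n)" using 2 f(2) by (auto simp: u_def)
      moreover have "u (i + 1) = f (i - n + 1)" using 2 by (simp add: u_def algebra_simps)
      ultimately show ?thesis by simp
    next
      case 3
      have "(w' (i - L), w' (i - L + 1)) \<in> E" using w'(1) i 3 unfolding walk_def by (auto simp: L_def)
      moreover have "u i = w' (i - L)" using 3 f by (auto simp: u_def L_def)
      moreover have "u (i + 1) = w' (i - L + 1)" using 3 f(1) by (simp add: u_def algebra_simps)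
      ultimately show ?thesis by simp
    qed
  qed
  moreover have "u (i + L) = w' i" if "m' \<le> i" "i \<le> n'" for i
    using that f by (auto simp: u_def L_def)
  ultimately show thesis using f(1) by (intro that[of u L]) (auto simp: walk_def u_def L_def)
qed

section \<open>Periodic fibres, good points and their localisation\<close>

context bowen_map
begin

definition Sec where "Sec x n = (\<lambda>z. z n) ` Fib x"

lemma periodic_regular: "x \<in> X \<Longrightarrow> periodic x \<Longrightarrow> x \<in> Xr"
  using periodic_io by (fastforce simp: regular_part_iff periodic_def)

text \<open>The translates of \<open>z\<close> by multiples of a period of \<open>x\<close> stay in
  the finite fibre, so two of them coincide.\<close>

lemma Fib_has_period:
  assumes x: "x \<in> X" "periodic x" and z: "z \<in> Fib x"
  obtains Q where "has_period z Q"
proof -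
  obtain P where P: "has_period x P" using x(2) by (auto simp: periodic_def)
  define f where "f k = (\<lambda>i. z (i + int k * P))" for k
  have "f k \<in> Fib x" for k
  proof -
    have "rel (\<lambda>i. x (i + int k * P)) (f k)" using z rel_shift by (auto simp: Fib_def f_def)
    moreover have "(\<lambda>i. x (i + int k * P)) = x" using has_period_nat_mult[OF P] by simp
    ultimately show ?thesis using z markov_shift_shift by (auto simp: Fib_def f_def)
  qed
  then have "finite (range f)" using finite_Fib[OF periodic_regular[OF x]] by (meson finite_subset image_subset_iff)
  then have "\<not> inj f" using finite_imageD by blast
  then obtain k l where kl: "k < l" "f k = f l" unfolding inj_def by (metis nat_neq_iff)
  have "has_period z ((int l - int k) * P)" unfolding has_period_def
  proof (intro conjI allI)
    show "0 < (int l - int k) * P" using kl P by (simp add: has_period_def)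
    fix n
    have "f k (n - int k * P) = f l (n - int k * P)" using kl by simp
    then show "z (n + (int l - int k) * P) = z n" by (simp add: f_def algebra_simps)
  qed
  then show thesis using that by blast
qed

text \<open>Two distinct periodic points of a fibre that share a symbol could be switched at any
  of infinitely many times, which would make the fibre infinite.\<close>

lemma periodic_fibre_disjoint:
  assumes x: "x \<in> X" "periodic x" and z: "z \<in> Fib x" "z' \<in> Fib x" and eq: "z n = z' n"
  shows "z = z'"
proof (rule ccontr)
  assume "z \<noteq> z'"
  then obtain m where m: "z m \<noteq> z' m" by (auto simp: fun_eq_iff)
  obtain Q1 Q2 where Q12: "has_period z Q1" "has_period z' Q2"
    using Fib_has_period[OF x] z by metis
  define Q where "Q = Q1 * Q2"
  have "has_period z Q" "has_period z' Q"
    using has_period_multiple[OF Q12(1), of Q2] has_period_multiple[OF Q12(2), of Q1] Q12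
    by (auto simp: Q_def has_period_def mult.commute)
  then have Q: "Q > 0" "\<And>i k. z (i + k * Q) = z i" "\<And>i k. z' (i + k * Q) = z' i"
    using has_period_mult[of z Q] has_period_mult[of z' Q] by (simp_all add: has_period_def)
  \<comment> \<open>A time of disagreement, moved by a multiple of \<open>Q\<close> into the first
    period after the meeting time \<open>n\<close>.\<close>
  define r where "r = n + (m - n) mod Q"
  have "r = m + (- ((m - n) div Q)) * Q" by (simp add: r_def minus_div_mult_eq_mod[symmetric] algebra_simps)
  then have r: "z r \<noteq> z' r" using m by (simp only: Q(2,3) not_False_eq_True)
  have r': "n \<le> r" "r < n + Q" using Q(1) by (auto simp: r_def)
  define g where "g k = (\<lambda>i. if i < n + int k * Q then z i else z' i)" for k :: nat
  have zX: "z \<in> X" "z' \<in> X" "rel x z" "rel x z'" using z by (auto simp: Fib_def)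
  have "g k \<in> Fib x" for k
  proof -
    have "(g k i, g k (i + 1)) \<in> E" for i
    proof (cases "i + 1 = n + int k * Q")
      case True
      then have "z (i + 1) = z' (i + 1)" using Q eq by simp
      then show ?thesis using True zX(1) markov_shiftD[of z E i] by (simp add: g_def)
    next
      case False
      then show ?thesis using zX markov_shiftD[of z E i] markov_shiftD[of z' E i] by (auto simp: g_def)
    qed
    then show ?thesis using zX by (auto simp: Fib_def markov_shift_def rel_def g_def)
  qed
  then have "finite (range g)" using finite_Fib[OF periodic_regular[OF x]] by (meson finite_subset image_subset_iff)
  then have "\<not> inj g" using finite_imageD by blast
  then obtain k l where kl: "k < l" "g k = g l" unfolding inj_def by (metis nat_neq_iff)
  \<comment> \<open>At time \<open>r + int k * Q\<close> the path \<open>g k\<close> has already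
    switched to \<open>z'\<close> and \<open>g l\<close> has not.\<close>
  have "int (Suc k) * Q \<le> int l * Q" using kl(1) Q(1) by (intro mult_right_mono) auto
  then have "r + int k * Q < n + int l * Q" using r' by (simp add: algebra_simps)
  then have "g l (r + int k * Q) = z r" "g k (r + int k * Q) = z' r" using r' Q by (auto simp: g_def)
  then show False using kl(2) r by simp
qed

lemma card_Sec: "x \<in> X \<Longrightarrow> periodic x \<Longrightarrow> card (Sec x n) = card (Fib x)"
  unfolding Sec_def using periodic_fibre_disjoint by (intro card_image inj_onI) auto

lemma finite_Sec: "x \<in> Xr \<Longrightarrow> finite (Sec x n)"
  using finite_Fib by (simp add: Sec_def)

definition min_fibre_card where "min_fibre_card = (LEAST d. \<exists>x\<in>X. periodic x \<and> card (Fib x) = d)"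

definition good where "good x \<longleftrightarrow> x \<in> X \<and> periodic x \<and> card (Fib x) = min_fibre_card"

lemma min_fibre_card_le: "x \<in> X \<Longrightarrow> periodic x \<Longrightarrow> min_fibre_card \<le> card (Fib x)"
  unfolding min_fibre_card_def by (rule Least_le) blast

lemma goodD: "good x \<Longrightarrow> x \<in> X" "good x \<Longrightarrow> periodic x" "good x \<Longrightarrow> x \<in> Xr"
  using periodic_regular by (auto simp: good_def)

lemma good_exists:
  assumes "Xr \<noteq> {}"
  obtains x where "good x"
proof -
  obtain x u where x: "x \<in> X" "io_up x u" using assms by (auto simp: regular_part_iff)
  obtain i where i: "x i = u" using x(2) by (auto simp: io_up_def)
  obtain j where j: "j \<ge> i + 1" "x j = u" using x(2) unfolding io_up_def by blast
  have "(x i, x (i + 1)) \<in> E" using x(1) by (rule markov_shiftD)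
  then obtain y where "y \<in> X" "periodic y"
  proof -
    \<comment> \<open>The walk stops at \<open>j - 1\<close>: the arrow into \<open>x j\<close>, the
      same symbol as \<open>x i\<close>, serves as the return path.\<close>
    have "walk E x i (j - 1)" by (rule walk_markov_shift[OF x(1)])
    moreover have "(x (j - 1), x i) \<in> E\<^sup>+" using markov_shiftD[OF x(1), of "j - 1"] i j by auto
    ultimately show thesis using walk_close[of E x i "j - 1"] j that by auto
  qed
  then have "\<exists>d. \<exists>x\<in>X. periodic x \<and> card (Fib x) = d" by blast
  then have "\<exists>x\<in>X. periodic x \<and> card (Fib x) = min_fibre_card" unfolding min_fibre_card_def by (rule LeastI_ex)
  then show thesis using that by (auto simp: good_def)
qed

lemma good_Fib:
  assumes "good x" "z \<in> Fib x"
  shows "good z" "Sec z n = Sec x n"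
proof -
  have "Fib z = Fib x" using Fib_cong goodD assms by blast
  moreover have "periodic z"
    using Fib_has_period[OF goodD(1)[OF assms(1)] goodD(2)[OF assms(1)] assms(2)] by (auto simp: periodic_def)
  moreover have "z \<in> X" using assms by (auto simp: Fib_def)
  ultimately show "good z" "Sec z n = Sec x n" using assms by (auto simp: good_def Sec_def)
qed

lemma Fib_shift: "Fib (\<lambda>i. x (i + k)) = (\<lambda>z i. z (i + k)) ` Fib x"
proof (intro equalityI subsetI)
  fix z assume z: "z \<in> Fib (\<lambda>i. x (i + k))"
  then have "rel x (\<lambda>i. z (i + - k))" using rel_shift[of "\<lambda>i. x (i + k)" z "- k"] by (simp add: Fib_def)
  then have "(\<lambda>i. z (i + - k)) \<in> Fib x" using z markov_shift_shift[of z E "- k"] by (simp add: Fib_def)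
  then show "z \<in> (\<lambda>z i. z (i + k)) ` Fib x" by (rule rev_image_eqI) simp
next
  fix z assume "z \<in> (\<lambda>z i. z (i + k)) ` Fib x"
  then show "z \<in> Fib (\<lambda>i. x (i + k))" using rel_shift markov_shift_shift by (auto simp: Fib_def)
qed

lemma Sec_shift: "Sec (\<lambda>i. x (i + k)) n = Sec x (n + k)"
  by (simp add: Sec_def Fib_shift image_image)

lemma good_shift: "good x \<Longrightarrow> good (\<lambda>i. x (i + k))"
proof -
  assume x: "good x"
  have X: "(\<lambda>i. x (i + k)) \<in> X" "periodic (\<lambda>i. x (i + k))"
    using x markov_shift_shift periodic_shift by (auto simp: good_def)
  have "card (Fib (\<lambda>i. x (i + k))) = card (Sec (\<lambda>i. x (i + k)) 0)" using card_Sec[OF X] by simp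
  also have "\<dots> = card (Fib x)" unfolding Sec_shift using card_Sec x by (simp add: good_def)
  finally show ?thesis using x X by (simp add: good_def)
qed

lemma card_Sec_good: "good x \<Longrightarrow> card (Sec x n) = min_fibre_card"
  using card_Sec by (simp add: good_def)

text \<open>A finite test for the section. Only the central symbol is controlled, since a related
  walk need not follow a point of the fibre near the ends of the window.\<close>

definition localizes where
  "localizes x N \<longleftrightarrow> (\<forall>v. walk E v (- int N) (int N) \<and> (\<forall>i. \<bar>i\<bar> \<le> int N \<longrightarrow> (x i, v i) \<in> R)
     \<longrightarrow> v 0 \<in> Sec x 0)"

lemma localizes_mono: "localizes x N \<Longrightarrow> N \<le> N' \<Longrightarrow> localizes x N'"
  unfolding localizes_def walk_def by (auto intro!: order_trans[of _ "int N" "int N'"]) 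

text \<open>If every radius failed, a limit of the bad walks would be a path related to
  \<open>x\<close>, thus a point of the fibre, whose central symbol lies outside the
  section.\<close>

lemma localizes_exists:
  assumes x: "x \<in> Xr"
  obtains N where "localizes x N"
proof (rule ccontr)
  assume "\<not> thesis"
  then have bad: "\<exists>v. walk E v (- int N) (int N) \<and> (\<forall>i. \<bar>i\<bar> \<le> int N \<longrightarrow> (x i, v i) \<in> R) \<and> v 0 \<notin> Sec x 0" for N
    using that unfolding localizes_def by blast
  have "\<exists>v. (\<forall>i. v i \<in> {b. (x i, b) \<in> R}) \<and> (\<forall>N. walk E v (- int N) (int N) \<and> v 0 \<notin> Sec x 0)"
  proof (rule finite_choice_compactness)
    show "finite {b. (x i, b) \<in> R}" for i by (rule R_nbrs)
    show "\<exists>J. finite J \<and> (\<forall>v v'. (\<forall>i\<in>J. v i = v' i) \<longrightarrow> walk E v (- int N) (int N) \<and> v 0 \<notin> Sec x 0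
        \<longrightarrow> walk E v' (- int N) (int N) \<and> v' 0 \<notin> Sec x 0)" for N
      by (intro exI[of _ "{- int N..int N}"]) (auto simp: walk_def)
    show "\<exists>v. (\<forall>i. v i \<in> {b. (x i, b) \<in> R}) \<and> (\<forall>m\<le>N. walk E v (- int m) (int m) \<and> v 0 \<notin> Sec x 0)" for N
    proof -
      obtain v where v: "walk E v (- int N) (int N)" "\<forall>i. \<bar>i\<bar> \<le> int N \<longrightarrow> (x i, v i) \<in> R" "v 0 \<notin> Sec x 0"
        using bad by blast
      \<comment> \<open>Outside the window \<open>x\<close> itself is the filler; it is related to
        itself, and no arrow is tested there.\<close>
      define v' where "v' i = (if \<bar>i\<bar> \<le> int N then v i else x i)" for i
      have "(x i, v' i) \<in> R" for i
        using v(2) X_in_A[OF regular_partD[OF x]] R_refl' by (auto simp: v'_def)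
      moreover have "walk E v' (- int m) (int m)" if "m \<le> N" for m
        using v(1) that by (auto simp: walk_def v'_def)
      ultimately show ?thesis using v(3) by (intro exI[of _ v']) (auto simp: v'_def)
    qed
  qed
  then obtain v where v: "\<And>i. (x i, v i) \<in> R" "\<And>N. walk E v (- int N) (int N)" "v 0 \<notin> Sec x 0" by blast
  have "(v i, v (i + 1)) \<in> E" for i
    using v(2)[of "nat (\<bar>i\<bar> + 1)"] unfolding walk_def by (auto dest: spec[of _ i])
  then have "v \<in> Fib x" using v(1) by (auto simp: Fib_def markov_shift_def rel_def)
  then show False using v(3) by (auto simp: Sec_def)
qed

lemma localizes_Sec:
  assumes loc: "localizes g N" and v: "walk E v (L - int N) (L + int N)"
    and R: "\<And>i. \<bar>i\<bar> \<le> int N \<Longrightarrow> (g i, v (L + i)) \<in> R"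
  shows "v L \<in> Sec g 0"
proof -
  have "walk E (\<lambda>i. v (L + i)) (- int N) (int N)"
    unfolding walk_def
  proof (intro allI impI)
    fix i assume "- int N \<le> i \<and> i < int N"
    then have "(v (L + i), v (L + i + 1)) \<in> E" using v by (auto simp: walk_def)
    then show "(v (L + i), v (L + (i + 1))) \<in> E" by (simp add: add.assoc)
  qed
  then show ?thesis using loc R by (auto simp: localizes_def)
qed

text \<open>Localisation puts the section of \<open>y\<close> inside that of \<open>g\<close>. A
  periodic fibre has as many points as its section has symbols, so minimality forces equality and
  makes \<open>y\<close> good.\<close>

lemma good_window:
  assumes g: "good g" "localizes g N" and y: "y \<in> X" "periodic y"
    and w: "\<And>i. \<bar>i\<bar> \<le> int N \<Longrightarrow> y (L + i) = g i"
  shows "good y" "Sec y L = Sec g 0"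
proof -
  have sub: "Sec y L \<subseteq> Sec g 0"
  proof
    fix b assume "b \<in> Sec y L"
    then obtain u where u: "u \<in> Fib y" "b = u L" by (auto simp: Sec_def)
    have "(g i, u (L + i)) \<in> R" if "\<bar>i\<bar> \<le> int N" for i
      using w[OF that] u(1) by (metis (no_types, lifting) Fib_def mem_Collect_eq rel_def)
    then show "b \<in> Sec g 0"
      using localizes_Sec[OF g(2), of u L] u walk_markov_shift[of u E] by (simp add: Fib_def)
  qed
  have fin: "finite (Sec g 0)" using finite_Sec goodD g by blast
  have c: "card (Sec y L) \<le> min_fibre_card" using card_mono[OF fin sub] card_Sec_good[OF g(1)] by simp
  then have "card (Fib y) = min_fibre_card" using min_fibre_card_le[OF y] card_Sec[OF y] by simp
  then show "good y" using y by (simp add: good_def)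
  then show "Sec y L = Sec g 0" using card_subset_eq[OF fin sub] card_Sec_good g(1) by metis
qed

text \<open>The ends of the walk lie on points \<open>a\<close> and \<open>b\<close> of the fibre;
  the past of \<open>a\<close> and the future of \<open>b\<close> complete it to a path related to
  \<open>g\<close>.\<close>

lemma walk_in_fibre:
  assumes v: "walk E v m n" "m \<le> n" "\<And>i. m \<le> i \<Longrightarrow> i \<le> n \<Longrightarrow> (g i, v i) \<in> R"
    and ends: "v m \<in> Sec g m" "v n \<in> Sec g n"
  obtains z where "z \<in> Fib g" "\<And>i. m \<le> i \<Longrightarrow> i \<le> n \<Longrightarrow> z i = v i"
proof -
  obtain a b where a: "a \<in> Fib g" "a m = v m" and b: "b \<in> Fib g" "b n = v n"
    using ends by (auto simp: Sec_def)
  define z where "z i = (if i < m then a i else if i \<le> n then v i else b i)" for i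
  have "(z i, z (i + 1)) \<in> E" for i
  proof -
    have *: "(a i, a (i + 1)) \<in> E" "(b i, b (i + 1)) \<in> E"
      using a(1) b(1) markov_shiftD by (auto simp: Fib_def)
    consider "i + 1 < m" | "i + 1 = m" | "m \<le> i" "i < n" | "i = n" | "i > n" by linarith
    then show ?thesis
    proof cases
      case 2 then show ?thesis using * a(2) v(2) by (auto simp: z_def)
    next
      case 3 then show ?thesis using v(1) by (auto simp: z_def walk_def)
    next
      case 4 then show ?thesis using * b(2) v(2) by (auto simp: z_def)
    qed (use * v(2) in \<open>auto simp: z_def\<close>)
  qed
  moreover have "rel g z" using a b v(3) by (auto simp: rel_def Fib_def z_def)
  ultimately have "z \<in> Fib g" by (auto simp: Fib_def markov_shift_def)
  then show thesis using that[of z] by (auto simp: z_def)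
qed

end

section \<open>The cover by minimal fibres\<close>

lemma markov_shift_path:
  assumes "x \<in> markov_shift E" "m < n" shows "(x m, x n) \<in> E\<^sup>+"
  using assms(2)
proof (induction n rule: int_gr_induct)
  case base show ?case using markov_shiftD[OF assms(1)] by blast
next
  case (step i) then show ?case using markov_shiftD[OF assms(1), of i] by (meson trancl.trancl_into_trancl)
qed

lemma periodic_path:
  assumes "x \<in> markov_shift E" "periodic x" shows "(x m, x n) \<in> E\<^sup>+"
proof -
  obtain P where P: "has_period x P" using assms by (auto simp: periodic_def)
  obtain i where "i \<ge> m + 1" "x i = x n" using periodic_io(1)[OF P] unfolding io_up_def by blast
  then show ?thesis using markov_shift_path[OF assms(1), of m i] by simp
qed

lemma occurs_at_period: "has_period x P \<Longrightarrow> occurs_at w x n \<Longrightarrow> occurs_at w x (n + k * P)"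
  using has_period_mult[of x P] by (simp add: occurs_at_def add.commute add.left_commute add.assoc)
    (metis add.assoc add.commute)

lemma infinite_multiples:
  assumes "P > 0" shows "infinite {n::int. (\<exists>k. n = a + k * P) \<and> n \<le> b}"
    and "infinite {n::int. (\<exists>k. n = a + k * P) \<and> c \<le> n}"
proof -
  have inj: "inj_on (\<lambda>k. a + k * P) S" for S using assms by (auto simp: inj_on_def)
  have ge: "(\<bar>a\<bar> + \<bar>b\<bar>) \<le> (\<bar>a\<bar> + \<bar>b\<bar>) * P" for a b :: int
    using assms mult_left_mono[of 1 P "\<bar>a\<bar> + \<bar>b\<bar>"] by simp
  have "a + k * P \<le> b" if "k \<le> - (\<bar>a\<bar> + \<bar>b\<bar>)" for k
  proof -
    have "k * P \<le> - (\<bar>a\<bar> + \<bar>b\<bar>) * P" using that assms by (intro mult_right_mono) auto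
    then show ?thesis unfolding mult_minus_left using ge[of a b] by linarith
  qed
  then have "(\<lambda>k. a + k * P) ` {..- (\<bar>a\<bar> + \<bar>b\<bar>)} \<subseteq> {n. (\<exists>k. n = a + k * P) \<and> n \<le> b}" by auto
  moreover have "infinite ((\<lambda>k. a + k * P) ` {..- (\<bar>a\<bar> + \<bar>b\<bar>)})"
    using finite_imageD[OF _ inj] infinite_Iic by blast
  ultimately show "infinite {n. (\<exists>k. n = a + k * P) \<and> n \<le> b}" using infinite_super by blast
  have "c \<le> a + k * P" if "k \<ge> \<bar>a\<bar> + \<bar>c\<bar>" for k
  proof -
    have "(\<bar>a\<bar> + \<bar>c\<bar>) * P \<le> k * P" using that assms by (intro mult_right_mono) auto
    then show ?thesis using ge[of a c] by linarith
  qed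
  then have "(\<lambda>k. a + k * P) ` {\<bar>a\<bar> + \<bar>c\<bar>..} \<subseteq> {n. (\<exists>k. n = a + k * P) \<and> c \<le> n}" by auto
  moreover have "infinite ((\<lambda>k. a + k * P) ` {\<bar>a\<bar> + \<bar>c\<bar>..})"
    using finite_imageD[OF _ inj] infinite_Ici by blast
  ultimately show "infinite {n. (\<exists>k. n = a + k * P) \<and> c \<le> n}" using infinite_super by blast
qed

lemma periodic_rec_part:
  assumes "x \<in> Z" "periodic x"
  shows "x \<in> rec_part Z"
proof -
  obtain P where P: "has_period x P" "P > 0" using assms(2) by (auto simp: periodic_def has_period_def)
  have "sees_io x w" if w: "occurs_at w x n" for w n
    unfolding sees_io_def
  proof
    show "infinite {n. occurs_at w x n \<and> n + int (length w) - 1 \<le> 0}"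
      by (rule infinite_super[OF _ infinite_multiples(1)[OF P(2), of n "1 - int (length w)"]])
        (use occurs_at_period[OF P(1) w] in auto)
    show "infinite {n. occurs_at w x n \<and> 0 \<le> n}"
      by (rule infinite_super[OF _ infinite_multiples(2)[OF P(2), of n 0]])
        (use occurs_at_period[OF P(1) w] in auto)
  qed
  then show ?thesis using assms(1) by (auto simp: rec_part_def)
qed

lemma sees_io_unbounded:
  assumes "sees_io x w"
  shows "\<exists>n\<ge>m. occurs_at w x n" "\<exists>n\<le>m. occurs_at w x n"
proof -
  show "\<exists>n\<ge>m. occurs_at w x n"
  proof (rule ccontr)
    assume "\<not> ?thesis"
    then have "{n. occurs_at w x n \<and> 0 \<le> n} \<subseteq> {0..m}" by auto (meson linear)
    then show False using assms finite_subset[OF _ finite_atLeastAtMost_int] by (auto simp: sees_io_def)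
  qed
  show "\<exists>n\<le>m. occurs_at w x n"
  proof (rule ccontr)
    assume "\<not> ?thesis"
    then have "{n. occurs_at w x n \<and> n + int (length w) - 1 \<le> 0} \<subseteq> {m..1}" by auto (meson linear)
    then show False using assms finite_subset[OF _ finite_atLeastAtMost_int] by (auto simp: sees_io_def)
  qed
qed

section \<open>Vertices and arrows of the cover\<close>

locale bowen_map_nonempty = bowen_map +
  assumes nonempty: "Xr \<noteq> {}"
begin

definition G where "G = {Sec g 0 | g. good g}"

definition V where "V = G \<union> (\<lambda>a. {a}) ` (A - \<Union>G)"

text \<open>\<open>V\<close> consists of finite subsets of the countable alphabet, so its members
  can be named by naturals, the type of the new alphabet.\<close>

definition code where "code = to_nat_on V"

definition label where "label = inv_into V code"

text \<open>The two families do not mix: a path of sets consists either of sections of good points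
  only or of singletons that avoid all of them. The times 0 and 1 suffice because shifts of good
  points are good.\<close>

definition set_edges where
  "set_edges = {(Sec g 0, Sec g 1) | g. good g} \<union>
     {({a}, {b}) | a b. (a, b) \<in> E \<and> a \<notin> \<Union>G \<and> b \<notin> \<Union>G}"

definition verts where "verts = code ` V"

definition edges where "edges = map_prod code code ` set_edges"

lemma good_in_Sec: "good g \<Longrightarrow> g n \<in> Sec g n"
  using Fib_self goodD by (auto simp: Sec_def)

lemma Sec_in_A: "Sec g n \<subseteq> A"
  using X_in_A by (auto simp: Sec_def Fib_def)

lemma Sec_in_G: "good g \<Longrightarrow> Sec g n \<in> G"
  using good_shift[of g n] Sec_shift[of g n 0] by (auto simp: G_def)

lemma Sec_edge: "good g \<Longrightarrow> (Sec g n, Sec g (n + 1)) \<in> set_edges"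
proof -
  assume "good g"
  then have "good (\<lambda>i. g (i + n))" by (rule good_shift)
  moreover have "Sec (\<lambda>i. g (i + n)) 0 = Sec g n" "Sec (\<lambda>i. g (i + n)) 1 = Sec g (n + 1)"
    by (simp_all add: Sec_shift add.commute)
  ultimately show ?thesis unfolding set_edges_def by (metis (mono_tags, lifting) UnI1 mem_Collect_eq)
qed

lemma code_inj: "inj_on code V"
proof -
  have "V \<subseteq> {F. finite F \<and> F \<subseteq> A}"
    using finite_Sec goodD(3) Sec_in_A by (fastforce simp: V_def G_def)
  moreover have "countable {F. finite F \<and> F \<subseteq> A}"
    using graph by (intro countable_Collect_finite_subset) (simp add: shift_graph_def)
  ultimately have "countable V" by (rule countable_subset)
  then show ?thesis unfolding code_def by (rule inj_on_to_nat_on)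
qed

lemma label_code [simp]: "S \<in> V \<Longrightarrow> label (code S) = S"
  unfolding label_def using code_inj by (rule inv_into_f_f)

lemma label_V: "\<alpha> \<in> verts \<Longrightarrow> label \<alpha> \<in> V"
  by (auto simp: verts_def)

lemma V_cases:
  assumes "S \<in> V"
  obtains g where "good g" "S = Sec g 0" | a where "S = {a}" "a \<in> A" "a \<notin> \<Union>G"
  using assms by (auto simp: V_def G_def)

lemma set_edges_sub: "set_edges \<subseteq> V \<times> V"
proof
  fix e assume "e \<in> set_edges"
  then consider g where "good g" "e = (Sec g 0, Sec g 1)"
    | a b where "e = ({a}, {b})" "(a, b) \<in> E" "a \<notin> \<Union>G" "b \<notin> \<Union>G" by (auto simp: set_edges_def)
  then show "e \<in> V \<times> V"
  proof cases
    case 1 then show ?thesis using Sec_in_G by (simp add: V_def)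
  next
    case 2
    then have "a \<in> A" "b \<in> A" using graph by (auto simp: shift_graph_def)
    then show ?thesis using 2 by (auto simp: V_def)
  qed
qed

lemma edges_label: "(\<alpha>, \<beta>) \<in> edges \<Longrightarrow> (label \<alpha>, label \<beta>) \<in> set_edges"
  using set_edges_sub by (auto simp: edges_def)

lemma edges_cases:
  assumes "(\<alpha>, \<beta>) \<in> edges"
  obtains g where "good g" "label \<alpha> = Sec g 0" "label \<beta> = Sec g 1"
  | a b where "label \<alpha> = {a}" "label \<beta> = {b}" "(a, b) \<in> E" "a \<notin> \<Union>G" "b \<notin> \<Union>G"
  using edges_label[OF assms] by (auto simp: set_edges_def)

text \<open>Completing the single step by the past and the future of fibre points puts the arrow on
  one point of the fibre. Uniqueness of successors and predecessors thereby reduces to disjointness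
  of the fibre.\<close>

lemma edge_in_fibre:
  assumes g: "good g" and ab: "a \<in> Sec g 0" "b \<in> Sec g 1" "(a, b) \<in> E"
  obtains z where "z \<in> Fib g" "z 0 = a" "z 1 = b"
proof -
  define v where "v i = (if i \<le> (0::int) then a else b)" for i
  have *: "(g i, c) \<in> R" if "c \<in> Sec g i" for c i using that by (auto simp: Sec_def Fib_def rel_def)
  have "walk E v 0 1"
  proof -
    have "i = 0" if "0 \<le> i \<and> i < 1" for i :: int using that by simp
    then show ?thesis using ab by (auto simp: walk_def v_def)
  qed
  moreover have "(g i, v i) \<in> R" if "0 \<le> i" "i \<le> 1" for i
  proof -
    have "i = 0 \<or> i = 1" using that by auto
    then show ?thesis using * ab by (auto simp: v_def)
  qed
  ultimately obtain z where "z \<in> Fib g" "\<And>i. 0 \<le> i \<Longrightarrow> i \<le> 1 \<Longrightarrow> z i = v i"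
    using walk_in_fibre[of v 0 1 g] ab by (auto simp: v_def)
  then show thesis using that by (auto simp: v_def)
qed

lemma set_cover: "set_cover A E T M p R verts edges label"
proof
  show "edges \<subseteq> verts \<times> verts" using set_edges_sub by (auto simp: edges_def verts_def)
  show "inj_on label verts" unfolding label_def verts_def by (rule inj_on_inv_into) simp
  show "label \<alpha> \<noteq> {}" if "\<alpha> \<in> verts" for \<alpha>
    using label_V[OF that] by (cases rule: V_cases) (use good_in_Sec in auto)
  show "label \<alpha> \<times> label \<alpha> \<subseteq> R" if "\<alpha> \<in> verts" for \<alpha>
    using label_V[OF that]
  proof (cases rule: V_cases)
    case (1 g)
    then show ?thesis using Fib_rel[OF goodD(3)] by (auto simp: Sec_def rel_def)
  qed (use R_refl' in auto)
  fix \<alpha> \<beta> assume e: "(\<alpha>, \<beta>) \<in> edges"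
  show "\<exists>b\<in>label \<beta>. (a, b) \<in> E" if "a \<in> label \<alpha>" for a
    using e
  proof (cases rule: edges_cases)
    case (1 g)
    then obtain z where "z \<in> Fib g" "a = z 0" using \<open>a \<in> label \<alpha>\<close> by (auto simp: Sec_def)
    then show ?thesis using 1 markov_shiftD[of z E 0] by (auto simp: Sec_def Fib_def)
  qed (use that in auto)
  show "\<exists>a\<in>label \<alpha>. (a, b) \<in> E" if "b \<in> label \<beta>" for b
    using e
  proof (cases rule: edges_cases)
    case (1 g)
    then obtain z where "z \<in> Fib g" "b = z 1" using \<open>b \<in> label \<beta>\<close> by (auto simp: Sec_def)
    then show ?thesis using 1 markov_shiftD[of z E 0] by (auto simp: Sec_def Fib_def)
  qed (use that in auto)
  show "b = b'" if a: "a \<in> label \<alpha>" and b: "b \<in> label \<beta>" "b' \<in> label \<beta>" "(a, b) \<in> E" "(a, b') \<in> E" for a b b'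
    using e
  proof (cases rule: edges_cases)
    case (1 g)
    obtain z where z: "z \<in> Fib g" "z 0 = a" "z 1 = b" using edge_in_fibre[of g a b] 1 a b by auto
    obtain z' where z': "z' \<in> Fib g" "z' 0 = a" "z' 1 = b'" using edge_in_fibre[of g a b'] 1 a b by auto
    show ?thesis using periodic_fibre_disjoint[OF goodD(1,2)[OF 1(1)] z(1) z'(1), of 0] z z' by simp
  qed (use b in auto)
  show "a = a'" if b: "b \<in> label \<beta>" and a: "a \<in> label \<alpha>" "a' \<in> label \<alpha>" "(a, b) \<in> E" "(a', b) \<in> E" for a a' b
    using e
  proof (cases rule: edges_cases)
    case (1 g)
    obtain z where z: "z \<in> Fib g" "z 0 = a" "z 1 = b" using edge_in_fibre[of g a b] 1 a b by auto
    obtain z' where z': "z' \<in> Fib g" "z' 0 = a'" "z' 1 = b" using edge_in_fibre[of g a' b] 1 a b by auto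
    show ?thesis using periodic_fibre_disjoint[OF goodD(1,2)[OF 1(1)] z(1) z'(1), of 1] z z' by simp
  qed (use a in auto)
qed

sublocale set_cover A E T M p R verts edges label
  by (rule set_cover)

lemma good_code_path: "good g \<Longrightarrow> (\<lambda>i. code (Sec g i)) \<in> X'"
  using Sec_edge by (force simp: markov_shift_def edges_def)

lemma label_good: "good g \<Longrightarrow> label (code (Sec g i)) = Sec g i"
  using Sec_in_G by (simp add: V_def)

section \<open>Points covered by the bundles, and irreducibility\<close>

lemma through_good:
  assumes "a \<in> \<Union>G"
  obtains g where "good g" "g 0 = a"
  using assms good_Fib(1) by (auto simp: G_def Sec_def)

lemma vertex_containing:
  assumes "a \<in> A"
  obtains \<alpha> where "\<alpha> \<in> verts" "a \<in> label \<alpha>"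
proof (cases "a \<in> \<Union>G")
  case True
  then obtain S where "S \<in> G" "a \<in> S" by blast
  then show thesis using that[of "code S"] by (simp add: verts_def V_def)
next
  case False
  then have "{a} \<in> V" using assms by (simp add: V_def)
  then show thesis using that[of "code {a}"] by (simp add: verts_def)
qed

text \<open>The window of \<open>x\<close> is continued by a localising window of a good point
  through \<open>x k\<close> and closed up. The periodic orbit contains the latter window, hence is
  good.\<close>

lemma good_approximation:
  assumes x: "x \<in> X" and conn: "\<And>m n. (x m, x n) \<in> E\<^sup>*" and C: "x k \<in> \<Union>G"
  obtains y where "good y" "\<And>i. \<bar>i\<bar> \<le> int n \<Longrightarrow> y i = x i"
proof -
  obtain g where g: "good g" "g 0 = x k" using through_good[OF C] .
  obtain N where N: "localizes g N" using localizes_exists goodD(3)[OF g(1)] .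
  have gp: "(g i, g j) \<in> E\<^sup>+" for i j using periodic_path goodD[OF g(1)] by blast
  have p1: "(x (int n), g (- int N)) \<in> E\<^sup>+"
    using conn[of "int n" k] gp[of 0 "- int N"] g(2) by (metis rtrancl_trancl_trancl)
  have p2: "(g (int N), x (- int n)) \<in> E\<^sup>+"
    using conn[of k "- int n"] gp[of "int N" 0] g(2) by (metis trancl_rtrancl_trancl)
  obtain L u where u: "walk E u (- int n) (int N + L)"
    "\<And>i. - int n \<le> i \<Longrightarrow> i \<le> int n \<Longrightarrow> u i = x i"
    "\<And>i. - int N \<le> i \<Longrightarrow> i \<le> int N \<Longrightarrow> u (i + L) = g i" "int n < - int N + L"
    by (rule walk_append[OF walk_markov_shift[OF x] _ walk_markov_shift[OF goodD(1)[OF g(1)]] _ p1]) auto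
  have "(u (int N + L), u (- int n)) \<in> E\<^sup>+" using p2 u(2)[of "- int n"] u(3)[of "int N"] by simp
  then obtain y where y: "y \<in> X" "periodic y" "\<And>i. - int n \<le> i \<Longrightarrow> i \<le> int N + L \<Longrightarrow> y i = u i"
    using walk_close[OF u(1)] u(4) by auto
  have "good y"
  proof (rule good_window(1)[OF g(1) N y(1,2)])
    fix i assume "\<bar>i\<bar> \<le> int N"
    then show "y (L + i) = g i" using y(3)[of "L + i"] u(3)[of i] u(4) by (simp add: add.commute abs_le_iff)
  qed
  moreover have "y i = x i" if "\<bar>i\<bar> \<le> int n" for i
    using that y(3)[of i] u(2)[of i] u(4) by (simp add: abs_le_iff)
  ultimately show thesis using that by blast
qed

text \<open>At each time only the finitely many vertices containing the symbol of \<open>x\<close>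
  are candidates, so the bundles of good approximations on growing windows have a limit, and
  \<open>x\<close> is a thread of it.\<close>

lemma connected_point_covered:
  assumes x: "x \<in> X" and conn: "\<And>m n. (x m, x n) \<in> E\<^sup>*" and C: "x k \<in> \<Union>G"
  shows "\<exists>s\<in>X'. thread s x"
proof -
  have "\<exists>s. (\<forall>i. s i \<in> {\<alpha> \<in> verts. x i \<in> label \<alpha>}) \<and> (\<forall>n. walk edges s (- int n) (int n))"
  proof (rule finite_choice_compactness)
    show "finite {\<alpha> \<in> verts. x i \<in> label \<alpha>}" for i by (rule finite_containing)
    show "\<exists>J. finite J \<and> (\<forall>s s'. (\<forall>i\<in>J. s i = s' i) \<longrightarrow> walk edges s (- int n) (int n)
       \<longrightarrow> walk edges s' (- int n) (int n))" for n
      by (intro exI[of _ "{- int n..int n}"]) (auto simp: walk_def)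
    show "\<exists>s. (\<forall>i. s i \<in> {\<alpha> \<in> verts. x i \<in> label \<alpha>}) \<and> (\<forall>m\<le>n. walk edges s (- int m) (int m))" for n
    proof -
      obtain y where y: "good y" "\<And>i. \<bar>i\<bar> \<le> int n \<Longrightarrow> y i = x i"
        using good_approximation[OF x conn C, where n = n] by blast
      have "\<exists>\<alpha>. \<alpha> \<in> verts \<and> x i \<in> label \<alpha>" for i
        by (rule vertex_containing[OF X_in_A[OF x]]) blast
      then obtain c where c: "\<And>i. c i \<in> verts \<and> x i \<in> label (c i)" by metis
      \<comment> \<open>Inside the window this is the bundle of the approximating good point;
        outside, any vertex containing \<open>x i\<close> will do, as no arrow is tested
        there.\<close>
      define s where "s i = (if \<bar>i\<bar> \<le> int n then code (Sec y i) else c i)" for i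
      have "s i \<in> {\<alpha> \<in> verts. x i \<in> label \<alpha>}" for i
      proof (cases "\<bar>i\<bar> \<le> int n")
        case True
        then have "x i \<in> Sec y i" using y good_in_Sec by metis
        then show ?thesis
          using True label_good[OF y(1)] X'_in_A'[OF good_code_path[OF y(1)]] by (simp add: s_def)
      qed (use c in \<open>simp add: s_def\<close>)
      moreover have "walk edges s (- int m) (int m)" if "m \<le> n" for m
        using walk_markov_shift[OF good_code_path[OF y(1)], of "- int m" "int m"] that
        by (auto simp: walk_def s_def)
      ultimately show ?thesis by blast
    qed
  qed
  then obtain s where s: "\<And>i. x i \<in> label (s i)" "\<And>n. walk edges s (- int n) (int n)" by blast
  have "(s i, s (i + 1)) \<in> edges" for i
    using s(2)[of "nat (\<bar>i\<bar> + 1)"] unfolding walk_def by (auto dest: spec[of _ i])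
  then show ?thesis using s(1) x by (auto simp: thread_def markov_shift_def)
qed

lemma outside_point_covered:
  assumes x: "x \<in> X" and C: "\<And>n. x n \<notin> \<Union>G"
  shows "\<exists>s\<in>X'. thread s x"
proof
  have V: "{x i} \<in> V" for i using X_in_A[OF x] C by (auto simp: V_def)
  show "(\<lambda>i. code {x i}) \<in> X'"
    using C markov_shiftD[OF x] by (force simp: markov_shift_def edges_def set_edges_def)
  show "thread (\<lambda>i. code {x i}) x" using x V by (simp add: thread_def)
qed

text \<open>If every arrow of \<open>x\<close> had a return path, all symbols of \<open>x\<close>
  would be mutually reachable, and \<open>x\<close> would be a thread of good sections or of
  singletons.\<close>

lemma uncovered_wanders:
  assumes x: "x \<in> Xr" and nc: "p x \<notin> (\<lambda>s. p (q s)) ` Xr'"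
  obtains n where "(x (n + 1), x n) \<notin> E\<^sup>*"
proof (rule ccontr)
  assume "\<not> thesis"
  then have backw: "(x (n + 1), x n) \<in> E\<^sup>*" for n using that by blast
  have X: "x \<in> X" using x by (rule regular_partD)
  have down: "(x n, x m) \<in> E\<^sup>*" if "m \<le> n" for m n
    using that by (induction n rule: int_ge_induct) (auto intro: rtrancl_trans backw)
  have "(x m, x n) \<in> E\<^sup>*" for m n
    using down[of n m] markov_shift_path[OF X, of m n] by (cases "n \<le> m") (auto dest: trancl_into_rtrancl)
  then have "\<exists>s\<in>X'. thread s x"
    using connected_point_covered[OF X] outside_point_covered[OF X] by blast
  then obtain s where s: "s \<in> X'" "thread s x" by blast
  then have "s \<in> Xr'" using thread_regular_iff x by blast
  then show False using thread_p(2)[OF _ s(2)] nc by blast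
qed

lemma irreducible_cover:
  assumes irr: "irreducible_graph A E"
  shows "irreducible_graph verts edges"
proof -
  have conn: "(a, b) \<in> E\<^sup>+" if "a \<in> A" "b \<in> A" for a b using irr that by (simp add: irreducible_graph_def)
  \<comment> \<open>A localising window of \<open>g\<close> and the window of radius
    \<open>N'\<close> of \<open>h\<close> lie on one closed orbit, and the former makes it good.
    Radius 0 serves to show that every symbol lies in a good section, a localising radius to reach
    the section of \<open>h\<close>.\<close>
  have joined: "\<exists>y L. good y \<and> L > 0 \<and> Sec y 0 = Sec g 0 \<and> y L = b \<and>
      (\<forall>i. \<bar>i\<bar> \<le> int N' \<longrightarrow> y (L + i) = h i)"
    if g: "good g" and h: "h \<in> X" "h 0 = b" for g h b N'
  proof -
    obtain N where N: "localizes g N" using localizes_exists goodD(3)[OF g] .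
    have gX: "g \<in> X" using g by (rule goodD)
    obtain L u where u: "walk E u (- int N) (int N' + L)"
      "\<And>i. - int N \<le> i \<Longrightarrow> i \<le> int N \<Longrightarrow> u i = g i"
      "\<And>i. - int N' \<le> i \<Longrightarrow> i \<le> int N' \<Longrightarrow> u (i + L) = h i" "int N < - int N' + L"
      by (rule walk_append[OF walk_markov_shift[OF gX] _ walk_markov_shift[OF h(1)] _
            conn[OF X_in_A[OF gX, of "int N"] X_in_A[OF h(1), of "- int N'"]]]) auto
    have "u (int N' + L) = h (int N')" "u (- int N) = g (- int N)" using u(2)[of "- int N"] u(3)[of "int N'"] by auto
    then have "(u (int N' + L), u (- int N)) \<in> E\<^sup>+" using conn X_in_A gX h(1) by simp
    then obtain y where y: "y \<in> X" "periodic y" "\<And>i. - int N \<le> i \<Longrightarrow> i \<le> int N' + L \<Longrightarrow> y i = u i"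
      using walk_close[OF u(1)] u(4) by auto
    have w: "y (0 + i) = g i" if "\<bar>i\<bar> \<le> int N" for i
      using that y(3)[of i] u(2)[of i] u(4) by (simp add: abs_le_iff)
    have w': "y (L + i) = h i" if "\<bar>i\<bar> \<le> int N'" for i
      using that y(3)[of "L + i"] u(3)[of i] u(4) by (simp add: add.commute abs_le_iff)
    show ?thesis
      using good_window[OF g N y(1,2) w] w' w'[of 0] h(2) u(4) by (intro exI[of _ y] exI[of _ L]) auto
  qed
  obtain g0 where g0: "good g0" using good_exists nonempty .
  have cov: "a \<in> \<Union>G" if "a \<in> A" for a
  proof -
    have "(a, a) \<in> E\<^sup>+" using conn that by blast
    \<comment> \<open>A walk without steps, to be closed by a cycle through
      \<open>a\<close>.\<close>
    moreover have "walk E (\<lambda>_. a) 0 0" by (auto simp: walk_def)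
    ultimately obtain h where h: "h \<in> X" "h 0 = a"
      using walk_close[of E "\<lambda>_. a" 0 0] by (metis order_refl)
    obtain y L where "good y" "y L = a" using joined[OF g0 h, of 0] by blast
    then show ?thesis using good_in_Sec Sec_in_G by blast
  qed
  have VG: "S \<in> G" if "S \<in> V" for S using that cov by (auto simp: V_def)
  show ?thesis unfolding irreducible_graph_def
  proof (intro ballI)
    fix \<alpha> \<beta> assume "\<alpha> \<in> verts" "\<beta> \<in> verts"
    then obtain g h where g: "good g" "\<alpha> = code (Sec g 0)" and h: "good h" "\<beta> = code (Sec h 0)"
    proof -
      have "\<exists>g. good g \<and> \<gamma> = code (Sec g 0)" if "\<gamma> \<in> verts" for \<gamma>
        using that VG unfolding verts_def G_def by blast
      then show thesis using that \<open>\<alpha> \<in> verts\<close> \<open>\<beta> \<in> verts\<close> by metis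
    qed
    obtain N' where N': "localizes h N'" using localizes_exists goodD(3)[OF h(1)] .
    obtain y L where y: "good y" "L > 0" "Sec y 0 = Sec g 0" "\<And>i. \<bar>i\<bar> \<le> int N' \<Longrightarrow> y (L + i) = h i"
      using joined[OF g(1) goodD(1)[OF h(1)] refl, of N'] by blast
    have "Sec y L = Sec h 0" using good_window(2)[OF h(1) N' goodD(1,2)[OF y(1)]] y(4) by simp
    then show "(\<alpha>, \<beta>) \<in> edges\<^sup>+"
      using markov_shift_path[OF good_code_path[OF y(1)] y(2)] g(2) h(2) y(3) by simp
  qed
qed

section \<open>The word that forces a unique preimage\<close>

lemma meets_good_forever:
  assumes s: "s \<in> X'" and n: "label (s n) \<inter> \<Union>G \<noteq> {}"
  obtains g where "good g" "label (s i) = Sec g 0" "label (s (i + 1)) = Sec g 1"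
proof -
  have GC: "Sec g j \<inter> \<Union>G \<noteq> {}" if "good g" for g j
    using good_in_Sec[OF that] Sec_in_G[OF that] by blast
  \<comment> \<open>Arrows do not join the two kinds of vertices, so meeting a good section passes
    to both neighbours in time.\<close>
  have eq: "label (s i) \<inter> \<Union>G \<noteq> {} \<longleftrightarrow> label (s (i + 1)) \<inter> \<Union>G \<noteq> {}" for i
    using markov_shiftD[OF s, of i] by (cases rule: edges_cases) (use GC in auto)
  have all: "label (s i) \<inter> \<Union>G \<noteq> {}" for i
  proof (cases "n \<le> i")
    case True then show ?thesis
      by (induction i rule: int_ge_induct) (use n eq in auto)
  next
    case False
    then have "i \<le> n" by simp
    then show ?thesis
    proof (induction i rule: int_le_induct)
      case (step i) then show ?case using eq[of "i - 1"] by simp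
    qed (rule n)
  qed
  show thesis
    using markov_shiftD[OF s, of i]
  proof (cases rule: edges_cases)
    case (1 g) then show thesis using that by blast
  next
    case (2 a b) then show thesis using all[of i] by auto
  qed
qed

text \<open>Each arrow of a thread of a good bundle is an arrow of a periodic point of the fibre,
  which comes back.\<close>

lemma thread_back_path:
  assumes s: "s \<in> X'" "label (s k) \<inter> \<Union>G \<noteq> {}" and x: "thread s x" and mn: "m < n"
  shows "(x n, x m) \<in> E\<^sup>+"
proof -
  have backw: "(x (i + 1), x i) \<in> E\<^sup>+" for i
  proof -
    obtain g where g: "good g" "label (s i) = Sec g 0" "label (s (i + 1)) = Sec g 1"
      using meets_good_forever[OF s] by blast
    obtain z where z: "z \<in> Fib g" "z 0 = x i" "z 1 = x (i + 1)"
    proof (rule edge_in_fibre[OF g(1)])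
      show "x i \<in> Sec g 0" "x (i + 1) \<in> Sec g 1" using x g by (auto simp: thread_def)
      show "(x i, x (i + 1)) \<in> E" using x markov_shiftD by (auto simp: thread_def)
    qed
    have "good z" using good_Fib[OF g(1) z(1)] by simp
    then show ?thesis using periodic_path[of z E 1 0] goodD z by auto
  qed
  show ?thesis using mn
  proof (induction n rule: int_gr_induct)
    case base show ?case by (rule backw)
  next
    case (step i) then show ?case using backw[of i] by simp
  qed
qed

text \<open>Bundles with the same image have the same section at every occurrence of \<open>W\<close>. Closing a path
  between two occurrences to a good periodic point shows that they also agree in between.\<close>

lemma magic_word:
  obtains W where "W \<in> language (rec_part X')"
    "\<And>s. s \<in> X' \<Longrightarrow> sees_io s W \<Longrightarrow> {z \<in> Xr'. p (q z) = p (q s)} = {s}"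
proof -
  obtain g where g: "good g" using good_exists nonempty .
  have "\<forall>f\<in>Fib g. \<exists>N. localizes f N" using localizes_exists good_Fib(1)[OF g] goodD(3) by metis
  then obtain M0 where M0: "\<And>f. f \<in> Fib g \<Longrightarrow> localizes f (M0 f)" by metis
  \<comment> \<open>One radius that serves all points of the fibre of \<open>g\<close>.\<close>
  define N where "N = Max (M0 ` Fib g)"
  have N: "localizes f N" if "f \<in> Fib g" for f
    using M0[OF that] finite_Fib[OF goodD(3)[OF g]] that by (auto simp: N_def intro: localizes_mono)
  define t where "t i = code (Sec g i)" for i
  have "t = (\<lambda>i. code (Sec g i))" by (simp add: fun_eq_iff t_def)
  then have t: "t \<in> X'" "label (t i) = Sec g i" for i
    using good_code_path[OF g] label_good[OF g] by auto
  have "periodic t"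
  proof -
    obtain P where P: "has_period g P" using goodD(2)[OF g] by (auto simp: periodic_def)
    have "(\<lambda>i. g (i + P)) = g" using P by (simp add: has_period_def)
    then have "t (i + P) = t i" for i using Sec_shift[of g P i] by (simp add: t_def)
    then show ?thesis using P by (auto simp: periodic_def has_period_def)
  qed
  \<comment> \<open>The window of radius \<open>N\<close> of \<open>t\<close>, so an occurrence at
    \<open>n\<close> is centred at \<open>n + int N\<close>.\<close>
  define W where "W = map (\<lambda>j. t (int j - int N)) [0..<2 * N + 1]"
  have occ: "occurs_at W s n \<longleftrightarrow> (\<forall>i. \<bar>i\<bar> \<le> int N \<longrightarrow> s (n + int N + i) = t i)" for s n
  proof
    assume a: "occurs_at W s n"
    show "\<forall>i. \<bar>i\<bar> \<le> int N \<longrightarrow> s (n + int N + i) = t i"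
    proof (intro allI impI)
      fix i assume i: "\<bar>i\<bar> \<le> int N"
      then have "nat (i + int N) < 2 * N + 1" by linarith
      then have "s (n + int (nat (i + int N))) = t (int (nat (i + int N)) - int N)"
        using a by (auto simp: occurs_at_def W_def simp del: upt_Suc)
      moreover have "int (nat (i + int N)) = i + int N" using i by linarith
      ultimately show "s (n + int N + i) = t i" by (simp add: algebra_simps)
    qed
  next
    assume a: "\<forall>i. \<bar>i\<bar> \<le> int N \<longrightarrow> s (n + int N + i) = t i"
    have "s (n + int j) = t (int j - int N)" if "j < 2 * N + 1" for j
      using a[rule_format, of "int j - int N"] that by simp
    then show "occurs_at W s n" by (auto simp: occurs_at_def W_def simp del: upt_Suc)
  qed
  have "W \<in> language (rec_part X')"
  proof -
    have "occurs_at W t (- int N)" by (simp add: occ)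
    moreover have "W \<noteq> []" by (simp add: W_def)
    ultimately show ?thesis using periodic_rec_part[OF t(1) \<open>periodic t\<close>] by (auto simp: language_def)
  qed
  moreover have "{z \<in> Xr'. p (q z) = p (q s)} = {s}" if s: "s \<in> X'" and io: "sees_io s W" for s
  proof -
    define centre where "centre n \<longleftrightarrow> (\<forall>i. \<bar>i\<bar> \<le> int N \<longrightarrow> s (n + i) = t i)" for n
    have up: "\<exists>n\<ge>k. centre n" for k
      using sees_io_unbounded(1)[OF io, of k] unfolding occ centre_def by (metis add_increasing2 of_nat_0_le_iff)
    have down: "\<exists>n\<le>k. centre n" for k
    proof -
      obtain n where "n \<le> k - int N" "occurs_at W s n" using sees_io_unbounded(2)[OF io] by blast
      then show ?thesis unfolding occ centre_def by (intro exI[of _ "n + int N"]) auto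
    qed
    have c0: "s n = t 0" if "centre n" for n
      using that[unfolded centre_def, rule_format, of 0] by simp
    have "io_up s (t 0)" "io_down s (t 0)"
      using up down c0 unfolding io_up_def io_down_def by metis+
    then have sr: "s \<in> Xr'" using s by (auto simp: regular_part_iff)
    obtain n0 where n0: "centre n0" using up by blast
    have sG: "label (s n0) \<inter> \<Union>G \<noteq> {}"
      using c0[OF n0] t(2) good_in_Sec[OF g, of 0] Sec_in_G[OF g, of 0] by auto
    \<comment> \<open>Around a centre the paths \<open>s\<close> and \<open>t\<close> coincide up to
      translation, so a thread follows the point of the fibre of \<open>g\<close> that it meets at
      the centre.\<close>
    have window: "\<exists>f\<in>Fib g. \<forall>i. \<bar>i\<bar> \<le> int N \<longrightarrow> x (n + i) = f i" if x: "thread s x" and n: "centre n" for x n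
    proof -
      have "x n \<in> label (s n)" using x by (simp add: thread_def)
      then obtain f where f: "f \<in> Fib g" "f 0 = x n" using c0[OF n] t(2) by (auto simp: Sec_def)
      have tf: "thread t f" using f(1) by (auto simp: thread_def t(2) Sec_def Fib_def)
      have sh: "(\<lambda>i. s (i + n)) \<in> X'" "thread (\<lambda>i. s (i + n)) (\<lambda>i. x (i + n))"
        using s x markov_shift_shift by (auto simp: thread_def)
      have "x (i + n) = f i" if i: "\<bar>i\<bar> \<le> int N" for i
      proof (rule thread_agree[OF sh tf, of 0 "- int N" "int N"])
        show "x (0 + n) = f 0" using f by simp
        show "s (j + n) = t j" if "- int N \<le> j" "j \<le> int N" for j
          using n[unfolded centre_def, rule_format, of j] that by (simp add: add.commute abs_le_iff)
      qed (use i in auto)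
      then show ?thesis using f(1) by (auto simp: add.commute)
    qed
    have eq: "z = s" if z: "z \<in> Xr'" and pz: "p (q z) = p (q s)" for z
    proof
      fix k
      have zX: "z \<in> X'" using z by (rule regular_partD)
      obtain n where n: "n \<le> k" "centre n" using down by blast
      obtain m where m: "k \<le> m" "centre m" using up by blast
      have x: "thread s (q s)" using q_thread[OF s] by simp
      define x where "x = q s"
      have xX: "x \<in> X" "x \<in> Xr" using q_X[OF s] thread_p(1)[OF sr x] by (auto simp: x_def)
      obtain f where f: "f \<in> Fib g" "\<And>i. \<bar>i\<bar> \<le> int N \<Longrightarrow> x (n + i) = f i" using window[OF x n(2)] x_def by blast
      obtain f' where f': "f' \<in> Fib g" "\<And>i. \<bar>i\<bar> \<le> int N \<Longrightarrow> x (m + i) = f' i" using window[OF x m(2)] x_def by blast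
      have "(x (m + int N), x (n - int N)) \<in> E\<^sup>+"
      proof (cases "n - int N < m + int N")
        case True then show ?thesis using thread_back_path[OF s sG x] by (simp add: x_def)
      next
        \<comment> \<open>The window consists of a single time here, and the return path comes from
          the periodicity of \<open>f\<close>.\<close>
        case False
        then have nm: "n = m" "N = 0" using n m by auto
        have "good f" using good_Fib(1)[OF g f(1)] .
        then have "(f 0, f 0) \<in> E\<^sup>+" using periodic_path goodD by blast
        then show ?thesis using nm f(2)[of 0] by simp
      qed
      then obtain y where y: "y \<in> X" "periodic y" "\<And>i. n - int N \<le> i \<Longrightarrow> i \<le> m + int N \<Longrightarrow> y i = x i"
        using walk_close[OF walk_markov_shift[OF xX(1)], of "n - int N" "m + int N"] n m by auto
      have gf: "good f" "good f'" using good_Fib(1)[OF g] f f' by auto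
      have Sf: "Sec f 0 = Sec g 0" "Sec f' 0 = Sec g 0" using good_Fib(2)[OF g] f f' by auto
      have w: "y (n + i) = f i" if "\<bar>i\<bar> \<le> int N" for i
        using y(3)[of "n + i"] f(2)[OF that] n m that by (simp add: abs_le_iff)
      have w': "y (m + i) = f' i" if "\<bar>i\<bar> \<le> int N" for i
        using y(3)[of "m + i"] f'(2)[OF that] n m that by (simp add: abs_le_iff)
      note gy = good_window[OF gf(1) N[OF f(1)] y(1,2) w]
      have gm: "Sec y m = Sec f' 0" using good_window(2)[OF gf(2) N[OF f'(1)] y(1,2) w'] .
      \<comment> \<open>Every path related to \<open>x\<close>, whether or not it belongs to the
        bundle of \<open>s\<close>, passes through the section of \<open>g\<close> at both
        centres.\<close>
      have centre_Sec: "v n \<in> Sec g 0 \<and> v m \<in> Sec g 0" if v: "v \<in> X" "rel x v" for v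
      proof
        have "v n \<in> Sec f 0"
        proof (rule localizes_Sec[OF N[OF f(1)] walk_markov_shift[OF v(1)]])
          fix i assume "\<bar>i\<bar> \<le> int N"
          then show "(f i, v (n + i)) \<in> R" using f(2) v(2) by (metis rel_def)
        qed
        then show "v n \<in> Sec g 0" using Sf by simp
        have "v m \<in> Sec f' 0"
        proof (rule localizes_Sec[OF N[OF f'(1)] walk_markov_shift[OF v(1)]])
          fix i assume "\<bar>i\<bar> \<le> int N"
          then show "(f' i, v (m + i)) \<in> R" using f'(2) v(2) by (metis rel_def)
        qed
        then show "v m \<in> Sec g 0" using Sf by simp
      qed
      \<comment> \<open>Between the centres such a path is completed on both sides by points of the
        fibre of \<open>y\<close>, so at time \<open>k\<close> it lies in the section of
        \<open>y\<close>.\<close>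
      have in_Sec: "v k \<in> Sec y k" if v: "v \<in> X" "rel x v" for v
      proof -
        have "(y i, v i) \<in> R" if "n \<le> i" "i \<le> m" for i
          using y(3)[of i] that v(2) by (auto simp: rel_def)
        then obtain u where u: "u \<in> Fib y" "\<And>i. n \<le> i \<Longrightarrow> i \<le> m \<Longrightarrow> u i = v i"
          using walk_in_fibre[OF walk_markov_shift[OF v(1)], of n m y]
            centre_Sec[OF v] gy(2) gm Sf n m by auto
        then have "v k = u k" using n m by simp
        then show ?thesis using u(1) by (simp add: Sec_def)
      qed
      have finS: "finite (Sec y k)" using finite_Sec goodD(3)[OF gy(1)] by blast
      \<comment> \<open>A good bundle whose threads are related to \<open>x\<close> has its set at
        time \<open>k\<close> inside \<open>Sec y k\<close>, and both have the minimal cardinality.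
        Applied to \<open>z\<close> and to \<open>s\<close>, this identifies their vertices at time
        \<open>k\<close>.\<close>
      have full: "label (r k) = Sec y k"
        if r: "r \<in> X'" "label (r i) \<inter> \<Union>G \<noteq> {}" and rr: "\<And>v. thread r v \<Longrightarrow> rel x v" for r i
      proof (rule card_subset_eq[OF finS])
        show "label (r k) \<subseteq> Sec y k"
          unfolding threads_through[OF r(1)] using in_Sec rr by (auto simp: thread_def)
        obtain h where "good h" "label (r k) = Sec h 0" using meets_good_forever[OF r] by blast
        then show "card (label (r k)) = card (Sec y k)" using card_Sec_good gy(1) by simp
      qed
      have zrel: "rel x v" if "thread z v" for v
        using thread_p[OF z that] pz p_eq_iff[OF xX(2), of v] by (simp add: x_def)
      obtain v where v: "thread z v" using q_thread[OF zX] by blast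
      have "v n \<in> Sec g 0" using centre_Sec zrel[OF v] v by (auto simp: thread_def)
      then have "label (z n) \<inter> \<Union>G \<noteq> {}" using v Sec_in_G[OF g, of 0] by (auto simp: thread_def)
      then have "label (z k) = Sec y k" using full[OF zX] zrel by blast
      moreover have "label (s k) = Sec y k"
        using full[OF s sG] threads_rel[OF s x] by (simp add: x_def)
      ultimately show "z k = s k" using D_inj X'_in_A'[OF zX] X'_in_A'[OF s] by (simp add: inj_on_def)
    qed
    show ?thesis using eq sr by blast
  qed
  ultimately show thesis using that by blast
qed

end

section \<open>Wandering points have null image\<close>

text \<open>A countable base of a Hausdorff topology separates points. It serves to express
  \<open>y = p x\<close> by countably many membership conditions.\<close>

lemma standard_borel_separating:
  assumes "standard_borel M"
  obtains B :: "nat \<Rightarrow> 'y set" where "\<And>n. B n \<in> sets M"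
    "\<And>y z. y \<in> space M \<Longrightarrow> z \<in> space M \<Longrightarrow> (\<And>n. y \<in> B n \<longleftrightarrow> z \<in> B n) \<Longrightarrow> y = z"
proof -
  obtain S where S: "completely_metrizable_space S" "second_countable S" "sets M = sets (borel_of_top S)"
    using assms by (auto simp: standard_borel_def)
  have sub: "{U. openin S U} \<subseteq> Pow (topspace S)" by (auto dest: openin_subset)
  have sp: "space M = topspace S"
    using sets_eq_imp_space_eq[OF S(3)] space_measure_of[OF sub] by (simp add: borel_of_top_def)
  have openM: "U \<in> sets M" if "openin S U" for U
    unfolding S(3) borel_of_top_def sets_measure_of[OF sub] using that by auto
  obtain \<B> where B: "countable \<B>" "\<forall>V\<in>\<B>. openin S V"
    "\<forall>U x. openin S U \<and> x \<in> U \<longrightarrow> (\<exists>V\<in>\<B>. x \<in> V \<and> V \<subseteq> U)"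
    using S(2) by (auto simp: second_countable_def)
  \<comment> \<open>The empty set is added so that the enumerated family is nonempty.\<close>
  define b where "b = from_nat_into (insert {} \<B>)"
  have range: "range b = insert {} \<B>" unfolding b_def using B(1) by (intro range_from_nat_into) auto
  show thesis
  proof
    show "b n \<in> sets M" for n
      using range openM B(2) by (metis insertE openin_empty rangeI)
    fix y z assume yz: "y \<in> space M" "z \<in> space M" and eq: "\<And>n. y \<in> b n \<longleftrightarrow> z \<in> b n"
    show "y = z"
    proof (rule ccontr)
      assume "y \<noteq> z"
      moreover have "Hausdorff_space S"
        using S(1) completely_metrizable_imp_metrizable_space metrizable_imp_Hausdorff_space by blast
      ultimately have "\<exists>U U'. openin S U \<and> openin S U' \<and> y \<in> U \<and> z \<in> U' \<and> disjnt U U'"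
        using yz sp by (simp add: Hausdorff_space_def)
      then obtain U U' where U: "openin S U" "openin S U'" "y \<in> U" "z \<in> U'" "disjnt U U'" by blast
      then obtain V where V: "V \<in> \<B>" "y \<in> V" "V \<subseteq> U" using B(3) by blast
      obtain n where "b n = V" using V(1) range by (metis insertI2 rangeE)
      then show False using eq[of n] V U(4,5) by (auto simp: disjnt_def)
    qed
  qed
qed

text \<open>\<open>L'\<close> collects the points of \<open>L\<close> that never return to it. Its
  preimages under the iterates are disjoint and of equal measure, hence null, and every point of
  \<open>L\<close> lies in one of them, given by its last visit.\<close>

lemma invariant_finite_returns_null:
  assumes inv: "invariant_prob T M \<mu>" and T: "T \<in> M \<rightarrow>\<^sub>M M" and L: "L \<in> sets M"
    and fin: "\<And>y. y \<in> L \<Longrightarrow> finite {k::nat. (T ^^ k) y \<in> L}"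
  shows "emeasure \<mu> L = 0"
proof -
  have sets: "sets \<mu> = sets M" and prob: "prob_space \<mu>" and distr: "distr \<mu> M T = \<mu>"
    using inv by (auto simp: invariant_prob_def)
  interpret prob_space \<mu> by (rule prob)
  have sp: "space \<mu> = space M" using sets by (rule sets_eq_imp_space_eq)
  have T\<mu>: "T \<in> \<mu> \<rightarrow>\<^sub>M M" using T measurable_cong_sets[OF sets refl] by blast
  have Tk: "(T ^^ k) \<in> M \<rightarrow>\<^sub>M M" for k
  proof (induction k)
    case (Suc k) then show ?case using measurable_comp[OF Suc T] by (simp add: comp_def)
  qed simp
  have pre: "(T ^^ k) -` B \<inter> space M \<in> sets M" if "B \<in> sets M" for k B
    using measurable_sets[OF Tk that] .
  have inv1: "emeasure \<mu> (T -` B \<inter> space M) = emeasure \<mu> B" if "B \<in> sets M" for B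
    using emeasure_distr[OF T\<mu> that] distr sp by simp
  have invk: "emeasure \<mu> ((T ^^ k) -` B \<inter> space M) = emeasure \<mu> B" if "B \<in> sets M" for k B
  proof (induction k)
    case 0 then show ?case using sets.sets_into_space[OF that] by (simp add: Int_absorb2)
  next
    case (Suc k)
    have "(T ^^ Suc k) -` B \<inter> space M = T -` ((T ^^ k) -` B \<inter> space M) \<inter> space M"
      using measurable_space[OF T] by (auto simp: funpow_Suc_right simp del: funpow.simps)
    then show ?case using inv1[OF pre[OF that, of k]] Suc by (simp only:)
  qed
  define L' where "L' = L - (\<Union>k. (T ^^ Suc k) -` L \<inter> space M)"
  have L'M: "L' \<in> sets M" unfolding L'_def by (intro sets.Diff L sets.countable_UN image_subsetI pre)
  define D where "D k = (T ^^ k) -` L' \<inter> space M" for k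
  have DM: "D k \<in> sets \<mu>" for k using pre[OF L'M] sets by (simp add: D_def)
  have "disjoint_family D"
  proof -
    have "D k \<inter> D l = {}" if "k < l" for k l
    proof -
      obtain j where j: "l = Suc j + k" using \<open>k < l\<close> by (metis add.commute add_Suc less_natE)
      have False if y: "y \<in> D k" "y \<in> D l" for y
      proof -
        have "(T ^^ l) y = (T ^^ Suc j) ((T ^^ k) y)" unfolding j funpow_add by simp
        moreover have "(T ^^ l) y \<in> L" using y by (simp add: D_def L'_def)
        moreover have "(T ^^ k) y \<in> space M" using y measurable_space[OF Tk] by (auto simp: D_def)
        ultimately have "(T ^^ k) y \<in> (T ^^ Suc j) -` L \<inter> space M" by simp
        then show False using y(1) unfolding D_def L'_def by blast
      qed
      then show ?thesis by blast
    qed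
    then show ?thesis unfolding disjoint_family_on_def by (metis Int_commute nat_neq_iff)
  qed
  then have "(\<lambda>k. measure \<mu> (D k)) sums measure \<mu> (\<Union>k. D k)"
    using DM by (intro finite_measure_UNION) auto
  moreover have mD: "measure \<mu> (D k) = measure \<mu> L'" for k
    using invk[OF L'M, of k] by (simp add: measure_def D_def)
  ultimately have "summable (\<lambda>k::nat. measure \<mu> L')" by (auto simp: sums_iff)
  then have "measure \<mu> L' = 0" by (simp add: summable_const_iff)
  then have "D k \<in> null_sets \<mu>" for k
    using DM mD by (intro null_setsI) (auto simp: emeasure_eq_measure)
  then have "(\<Union>k. D k) \<in> null_sets \<mu>" by blast
  moreover have "L \<subseteq> (\<Union>k. D k)"
  proof
    fix y assume y: "y \<in> L"
    let ?K = "{k::nat. (T ^^ k) y \<in> L}"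
    define k where "k = Max ?K"
    have K: "finite ?K" "0 \<in> ?K" using fin[OF y] y by auto
    have "k \<in> ?K" unfolding k_def using Max_in[OF K(1)] K(2) by blast
    moreover have "(T ^^ Suc j) ((T ^^ k) y) \<notin> L" for j
    proof
      assume "(T ^^ Suc j) ((T ^^ k) y) \<in> L"
      then have "(T ^^ (Suc j + k)) y \<in> L" unfolding funpow_add by simp
      then have "Suc j + k \<le> k" unfolding k_def using K by (intro Max_ge) auto
      then show False by simp
    qed
    moreover have "y \<in> space M" using y L sets.sets_into_space by blast
    ultimately show "y \<in> (\<Union>k. D k)" by (auto simp: D_def L'_def)
  qed
  moreover have "L \<in> sets \<mu>" using L sets by simp
  ultimately have "L \<in> null_sets \<mu>" using null_sets_subset by blast
  then show ?thesis by (rule null_setsD1)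
qed

section \<open>Images of the sets of points that cross a given arrow\<close>

context bowen_map
begin

text \<open>Points of \<open>X\<close> are parametrised by sequences of naturals; each coordinate
  reads one entry, so conditions on finitely many coordinates are clopen in the parameter.\<close>

definition decode :: "(nat \<Rightarrow> nat) \<Rightarrow> int \<Rightarrow> 'a" where
  "decode t i = from_nat_into A (t (to_nat i))"

lemma decode_surj:
  assumes "x \<in> X" obtains t where "decode t = x"
proof
  show "decode (\<lambda>k. to_nat_on A (x (from_nat k))) = x"
    using graph X_in_A[OF assms] by (simp add: fun_eq_iff decode_def shift_graph_def)
qed

lemma souslin_coordinates: "souslin \<mu> (\<lambda>t y. \<Psi> (decode t i) (decode t j))"
proof (rule souslin_clopen[where N = "Suc (to_nat i + to_nat j)"])
  fix t t' :: "nat \<Rightarrow> nat" assume "\<forall>k<Suc (to_nat i + to_nat j). t k = t' k"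
  then have "decode t i = decode t' i" "decode t j = decode t' j" by (auto simp: decode_def)
  then show "\<Psi> (decode t i) (decode t j) \<longleftrightarrow> \<Psi> (decode t' i) (decode t' j)" by simp
qed

lemma souslin_agree:
  assumes "\<And>x x'. agree n x x' \<Longrightarrow> \<Psi> x \<longleftrightarrow> \<Psi> x'"
  shows "souslin \<mu> (\<lambda>t y. \<Psi> (decode t))"
proof (rule souslin_clopen[where N = "Suc (\<Sum>i\<in>{- int n..int n}. to_nat i)"])
  fix t t' :: "nat \<Rightarrow> nat" assume a: "\<forall>k<Suc (\<Sum>i\<in>{- int n..int n}. to_nat i). t k = t' k"
  have "decode t i = decode t' i" if "\<bar>i\<bar> \<le> int n" for i
  proof -
    have "to_nat i \<le> (\<Sum>i\<in>{- int n..int n}. to_nat i)"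
      using that by (intro member_le_sum) auto
    then show ?thesis using a by (simp add: decode_def)
  qed
  then show "\<Psi> (decode t) \<longleftrightarrow> \<Psi> (decode t')" by (intro assms) (simp add: agree_def)
qed

text \<open>Recurrence is rewritten with quantifiers over naturals, the form that
  \<open>souslin_all\<close> and \<open>souslin_ex\<close> accept; the recurring symbol ranges over
  an enumeration of \<open>A\<close>.\<close>

lemma io_nat:
  assumes "x \<in> X"
  shows "(\<exists>u. io_down x u) \<longleftrightarrow> (\<exists>k::nat. \<forall>m::nat. \<exists>n::nat. m \<le> n \<and> x (- int n) = from_nat_into A k)"
    and "(\<exists>v. io_up x v) \<longleftrightarrow> (\<exists>k::nat. \<forall>m::nat. \<exists>n::nat. m \<le> n \<and> x (int n) = from_nat_into A k)"
proof -
  have ex: "\<exists>k. from_nat_into A k = x i" for i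
    using X_in_A[OF assms, of i] graph by (metis from_nat_into_surj shift_graph_def)
  have "(\<exists>u. io_down x u) \<longleftrightarrow> (\<exists>k. io_down x (from_nat_into A k))"
    using ex unfolding io_down_def by metis
  then show "(\<exists>u. io_down x u) \<longleftrightarrow> (\<exists>k::nat. \<forall>m::nat. \<exists>n::nat. m \<le> n \<and> x (- int n) = from_nat_into A k)"
    by (simp add: infinite_down_iff[symmetric] infinite_nat_iff_unbounded_le)
  have "(\<exists>v. io_up x v) \<longleftrightarrow> (\<exists>k. io_up x (from_nat_into A k))"
    using ex unfolding io_up_def by metis
  then show "(\<exists>v. io_up x v) \<longleftrightarrow> (\<exists>k::nat. \<forall>m::nat. \<exists>n::nat. m \<le> n \<and> x (int n) = from_nat_into A k)"
    by (simp add: infinite_up_iff[symmetric] infinite_nat_iff_unbounded_le)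
qed

lemma souslin_regular: "souslin \<mu> (\<lambda>t y. decode t \<in> Xr)"
proof -
  have "souslin \<mu> (\<lambda>t y. (\<forall>k::nat. (decode t (from_nat k), decode t (from_nat k + 1)) \<in> E) \<and>
     (\<exists>k::nat. \<forall>m::nat. \<exists>n::nat. m \<le> n \<and> decode t (- int n) = from_nat_into A k) \<and>
     (\<exists>k::nat. \<forall>m::nat. \<exists>n::nat. m \<le> n \<and> decode t (int n) = from_nat_into A k))"
    by (intro souslin_conj souslin_all souslin_ex souslin_coordinates
        souslin_coordinates[where \<Psi> = "\<lambda>a b. (a, b) \<in> E"]
        souslin_coordinates[where \<Psi> = "\<lambda>a b. _ \<and> a = _"])
  then show ?thesis
  proof (rule souslin_cong)
    fix t y
    have "(\<forall>k::nat. (decode t (from_nat k), decode t (from_nat k + 1)) \<in> E) \<longleftrightarrow> decode t \<in> X"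
      unfolding markov_shift_def by (auto, metis from_nat_to_nat)
    then show "((\<forall>k::nat. (decode t (from_nat k), decode t (from_nat k + 1)) \<in> E) \<and>
     (\<exists>k::nat. \<forall>m::nat. \<exists>n::nat. m \<le> n \<and> decode t (- int n) = from_nat_into A k) \<and>
     (\<exists>k::nat. \<forall>m::nat. \<exists>n::nat. m \<le> n \<and> decode t (int n) = from_nat_into A k)) \<longleftrightarrow> decode t \<in> Xr"
      unfolding regular_part_iff using io_nat[of "decode t"] by blast
  qed
qed

text \<open>Complements of Souslin sets need not be Souslin, so the induction carries
  \<open>B\<close> and its complement together.\<close>

lemma souslin_borel:
  assumes "B \<in> sets (borel_of_top (symb_top Xr))"
  shows "souslin \<mu> (\<lambda>t y. decode t \<in> Xr \<and> decode t \<in> B) \<and> souslin \<mu> (\<lambda>t y. decode t \<in> Xr \<and> decode t \<notin> B)"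
proof -
  have "sets (borel_of_top (symb_top Xr)) = sigma_sets Xr {U. openin (symb_top Xr) U}"
    unfolding borel_of_top_def topspace_symb_top
    by (rule sets_measure_of) (auto simp: openin_symb_top)
  then have "B \<in> sigma_sets Xr {U. openin (symb_top Xr) U}" using assms by simp
  then show ?thesis
  proof induction
    case (Basic U)
    then have U: "U \<subseteq> Xr" "x \<in> Xr \<Longrightarrow> x \<in> U \<longleftrightarrow> (\<exists>n. \<forall>z\<in>Xr. agree n x z \<longrightarrow> z \<in> U)" for x
      by (auto simp: openin_symb_top agree_def)
    \<comment> \<open>Depends on a finite window of \<open>x\<close> only, so \<open>U\<close> is a
      countable union, and its complement in \<open>Xr\<close> a countable intersection, of clopen
      conditions.\<close>
    define near where "near n x \<longleftrightarrow> (\<forall>z\<in>Xr. agree n x z \<longrightarrow> z \<in> U)" for n x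
    have near: "agree n x x' \<Longrightarrow> near n x \<longleftrightarrow> near n x'" for n x x' by (simp add: near_def agree_def)
    have "souslin \<mu> (\<lambda>t y. decode t \<in> Xr \<and> (\<exists>n. near n (decode t)))"
      using souslin_agree[OF near] by (intro souslin_conj souslin_regular souslin_ex)
    moreover have "souslin \<mu> (\<lambda>t y. decode t \<in> Xr \<and> (\<forall>n. \<not> near n (decode t)))"
      using souslin_agree[of _ "\<lambda>x. \<not> near _ x"] near by (intro souslin_conj souslin_regular souslin_all) blast
    moreover have "x \<in> Xr \<Longrightarrow> x \<in> U \<longleftrightarrow> (\<exists>n. near n x)" for x using U(2) by (simp add: near_def)
    ultimately show ?case by (simp cong: conj_cong)
  next
    case Empty
    have "souslin \<mu> (\<lambda>t y. False)" by (rule souslin_clopen) simp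
    then show ?case using souslin_regular by simp
  next
    case (Compl B)
    have "decode t \<in> Xr \<and> decode t \<in> Xr - B \<longleftrightarrow> decode t \<in> Xr \<and> decode t \<notin> B"
      "decode t \<in> Xr \<and> decode t \<notin> Xr - B \<longleftrightarrow> decode t \<in> Xr \<and> decode t \<in> B" for t by auto
    then show ?case using Compl.IH by simp
  next
    case (Union B)
    have "souslin \<mu> (\<lambda>t y. \<exists>i. decode t \<in> Xr \<and> decode t \<in> B i)"
      "souslin \<mu> (\<lambda>t y. \<forall>i. decode t \<in> Xr \<and> decode t \<notin> B i)"
      using Union.IH by (intro souslin_ex souslin_all; blast)+
    then show ?case by simp
  qed
qed

text \<open>By a countable separating family, \<open>y = p x\<close> holds iff \<open>y\<close> and
  \<open>p x\<close> lie in the same sets \<open>B m\<close>. Hence the image is the projection of a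
  Souslin relation, and nullity of its measurable subsets gives outer measure 0.\<close>

lemma souslin_image_null:
  assumes fm: "finite_measure \<mu>" and sets: "sets \<mu> = sets M"
    and null: "\<And>L. L \<in> sets M \<Longrightarrow> L \<subseteq> p ` {x \<in> Xr. x n = a \<and> x (n + 1) = b} \<Longrightarrow> emeasure \<mu> L = 0"
  shows "\<exists>N\<in>null_sets \<mu>. p ` {x \<in> Xr. x n = a \<and> x (n + 1) = b} \<subseteq> N"
proof -
  let ?S = "p ` {x \<in> Xr. x n = a \<and> x (n + 1) = b}"
  have sp: "space \<mu> = space M" using sets by (rule sets_eq_imp_space_eq)
  obtain B :: "nat \<Rightarrow> 'y set" where B: "\<And>n. B n \<in> sets M"
    "\<And>y z. y \<in> space M \<Longrightarrow> z \<in> space M \<Longrightarrow> (\<And>n. y \<in> B n \<longleftrightarrow> z \<in> B n) \<Longrightarrow> y = z"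
    using standard_borel_separating dyn by (auto simp: dynamical_system_def)
  have space_Xr: "space (borel_of_top (symb_top Xr)) = Xr"
    unfolding borel_of_top_def topspace_symb_top
    by (rule space_measure_of) (auto simp: openin_symb_top)
  define pre_B where "pre_B m = p -` B m \<inter> Xr" for m
  have pre_B: "pre_B m \<in> sets (borel_of_top (symb_top Xr))" for m
    using measurable_sets[OF meas B(1)[of m]] by (simp add: pre_B_def space_Xr)
  define P where "P t y \<longleftrightarrow> (decode t \<in> Xr \<and> decode t n = a \<and> decode t (n + 1) = b) \<and>
     (\<forall>m. (decode t \<in> Xr \<and> decode t \<in> pre_B m) \<and> y \<in> B m \<or> (decode t \<in> Xr \<and> decode t \<notin> pre_B m) \<and> y \<in> space M - B m)"
    for t y
  have "souslin \<mu> P" unfolding P_def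
  proof (rule souslin_conj)
    show "souslin \<mu> (\<lambda>t y. decode t \<in> Xr \<and> decode t n = a \<and> decode t (n + 1) = b)"
      by (intro souslin_conj souslin_regular
          souslin_coordinates[where \<Psi> = "\<lambda>c d. c = a" and i = n and j = n]
          souslin_coordinates[where \<Psi> = "\<lambda>c d. c = b" and i = "n + 1" and j = n])
    have "souslin \<mu> (\<lambda>t y. y \<in> B m)" "souslin \<mu> (\<lambda>t y. y \<in> space M - B m)" for m
      by (rule souslin_basic[where N = 0]; use B(1)[of m] sets in auto)+
    then show "souslin \<mu> (\<lambda>t y. \<forall>m. (decode t \<in> Xr \<and> decode t \<in> pre_B m) \<and> y \<in> B m \<or>
        (decode t \<in> Xr \<and> decode t \<notin> pre_B m) \<and> y \<in> space M - B m)"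
      using souslin_borel[OF pre_B]
      by (intro souslin_all souslin_disj souslin_conj[of _ _ "\<lambda>t y. y \<in> _"]) auto
  qed
  moreover have S: "{y \<in> space \<mu>. \<exists>t. P t y} = ?S"
  proof (intro equalityI subsetI)
    fix y assume "y \<in> {y \<in> space \<mu>. \<exists>t. P t y}"
    then obtain t where y: "y \<in> space M" and t: "P t y" using sp by auto
    then have x: "decode t \<in> Xr" "decode t n = a" "decode t (n + 1) = b" by (auto simp: P_def)
    have "p (decode t) \<in> B m \<longleftrightarrow> y \<in> B m" for m using t x(1) by (auto simp: P_def pre_B_def)
    then have "p (decode t) = y" using B(2)[OF p_space[OF x(1)] y] by blast
    then show "y \<in> ?S" using x by blast
  next
    fix y assume "y \<in> ?S"
    then obtain x where x: "x \<in> Xr" "x n = a" "x (n + 1) = b" "y = p x" by blast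
    obtain t where "decode t = x" using decode_surj[OF regular_partD[OF x(1)]] .
    then have "P t y" using x p_space[OF x(1)] by (auto simp: P_def pre_B_def)
    then show "y \<in> {y \<in> space \<mu>. \<exists>t. P t y}" using p_space[OF x(1)] x(4) sp by auto
  qed
  ultimately have "outer_measure_of \<mu> ?S = 0"
    using souslin_projection_null[OF fm, of P] null sets by simp
  moreover have "?S \<subseteq> space \<mu>" using S by blast
  ultimately show ?thesis using outer_measure_of_attain[of ?S \<mu>] by auto
qed

text \<open>A second crossing would contain a path from \<open>b\<close> back to \<open>a\<close>,
  so a path crosses the arrow at most once. A return of \<open>y\<close> after \<open>k\<close>
  steps only says that some point of the fibre crosses at time \<open>n + int k\<close>, hence the
  union over the finite fibre.\<close>

lemma wandering_image_finite_returns: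
  assumes ba: "(b, a) \<notin> E\<^sup>*" and y: "y \<in> p ` {x \<in> Xr. x n = a \<and> x (n + 1) = b}"
  shows "finite {k::nat. (T ^^ k) y \<in> p ` {x \<in> Xr. x n = a \<and> x (n + 1) = b}}"
proof -
  obtain x where x: "x \<in> Xr" "y = p x" using y by blast
  have Tk: "(T ^^ k) y = p (\<lambda>i. x (i + int k))" for k
  proof (induction k)
    case (Suc k)
    have "p (left_shift (\<lambda>i. x (i + int k))) = T (p (\<lambda>i. x (i + int k)))"
      by (rule p_left_shift[OF regular_part_markov_shift[OF x(1)]])
    then show ?case using Suc by (simp add: left_shift_def add.commute add.left_commute add.assoc)
  qed (use x in simp)
  define K where "K u = {k::nat. u (n + int k) = a \<and> u (n + int k + 1) = b}" for u
  have "{k::nat. (T ^^ k) y \<in> p ` {x \<in> Xr. x n = a \<and> x (n + 1) = b}} \<subseteq> (\<Union>u\<in>Fib x. K u)"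
  proof
    fix k :: nat assume "k \<in> {k. (T ^^ k) y \<in> p ` {x \<in> Xr. x n = a \<and> x (n + 1) = b}}"
    then obtain z where z: "z \<in> Xr" "z n = a" "z (n + 1) = b" "p z = p (\<lambda>i. x (i + int k))"
      using Tk by auto
    then have "z \<in> Fib (\<lambda>i. x (i + int k))"
      using Fib_eq_fibre[OF regular_part_markov_shift[OF x(1)], of "int k"] by simp
    then obtain u where u: "u \<in> Fib x" "z = (\<lambda>i. u (i + int k))" unfolding Fib_shift by blast
    then have "k \<in> K u" using z by (simp add: K_def algebra_simps)
    then show "k \<in> (\<Union>u\<in>Fib x. K u)" using u by blast
  qed
  moreover have "finite (K u)" if u: "u \<in> Fib x" for u
  proof -
    have X: "u \<in> X" using u by (simp add: Fib_def)
    have no: "\<not> k < l" if "k \<in> K u" "l \<in> K u" for k l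
    proof
      assume "k < l"
      then have "(u (n + int k + 1), u (n + int l)) \<in> E\<^sup>*"
      proof (cases "int k + 1 = int l")
        case True
        then show ?thesis by (simp add: add.assoc)
      next
        case False
        then show ?thesis
          using markov_shift_path[OF X, of "n + int k + 1" "n + int l"] \<open>k < l\<close> by simp
      qed
      then show False using that ba by (simp add: K_def)
    qed
    then have "k = l" if "k \<in> K u" "l \<in> K u" for k l using no that by (meson nat_neq_iff)
    then show ?thesis by (metis finite.simps is_singletonI' is_singleton_def)
  qed
  ultimately show ?thesis using finite_Fib[OF x(1)] by (meson finite_UN_I finite_subset)
qed

lemma wandering_null:
  assumes inv: "invariant_prob T M \<mu>"
  obtains N where "N \<in> null_sets \<mu>"
    "\<And>x n. x \<in> Xr \<Longrightarrow> (x (n + 1), x n) \<notin> E\<^sup>* \<Longrightarrow> p x \<in> N"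
proof -
  have sets: "sets \<mu> = sets M" and prob: "prob_space \<mu>" using inv by (auto simp: invariant_prob_def)
  have fm: "finite_measure \<mu>" using prob by (simp add: prob_space_def)
  have T: "T \<in> M \<rightarrow>\<^sub>M M" using dyn by (simp add: dynamical_system_def borel_automorphism_def)
  define I where "I = {(n::int, a, b) | n a b. (a, b) \<in> E \<and> (b, a) \<notin> E\<^sup>*}"
  have "countable (A \<times> A)" "E \<subseteq> A \<times> A" using graph by (auto simp: shift_graph_def)
  then have "countable E" using countable_subset by blast
  moreover have "I \<subseteq> UNIV \<times> E" by (auto simp: I_def)
  ultimately have "countable I" by (meson countableI_type countable_SIGMA countable_subset)
  have null: "\<exists>N\<in>null_sets \<mu>. p ` {x \<in> Xr. x n = a \<and> x (n + 1) = b} \<subseteq> N" if "(n, a, b) \<in> I" for n a b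
  proof (rule souslin_image_null[OF fm sets])
    fix L assume L: "L \<in> sets M" "L \<subseteq> p ` {x \<in> Xr. x n = a \<and> x (n + 1) = b}"
    have ba: "(b, a) \<notin> E\<^sup>*" using that by (simp add: I_def)
    show "emeasure \<mu> L = 0"
    proof (rule invariant_finite_returns_null[OF inv T L(1)])
      fix y assume "y \<in> L"
      with L(2) have "y \<in> p ` {x \<in> Xr. x n = a \<and> x (n + 1) = b}" by (rule subsetD)
      then have "finite {k::nat. (T ^^ k) y \<in> p ` {x \<in> Xr. x n = a \<and> x (n + 1) = b}}"
        by (rule wandering_image_finite_returns[OF ba])
      then show "finite {k. (T ^^ k) y \<in> L}"
        by (rule rev_finite_subset) (use L(2) in blast)
    qed
  qed
  have "\<forall>i\<in>I. \<exists>N. N \<in> null_sets \<mu> \<and>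
      p ` {x \<in> Xr. x (fst i) = fst (snd i) \<and> x (fst i + 1) = snd (snd i)} \<subseteq> N"
  proof
    fix i assume "i \<in> I"
    then have "(fst i, fst (snd i), snd (snd i)) \<in> I" by simp
    then show "\<exists>N. N \<in> null_sets \<mu> \<and>
      p ` {x \<in> Xr. x (fst i) = fst (snd i) \<and> x (fst i + 1) = snd (snd i)} \<subseteq> N"
      by (rule null[unfolded Bex_def])
  qed
  from bchoice[OF this] obtain N where N: "\<forall>i\<in>I. N i \<in> null_sets \<mu> \<and>
      p ` {x \<in> Xr. x (fst i) = fst (snd i) \<and> x (fst i + 1) = snd (snd i)} \<subseteq> N i" by blast
  show thesis
  proof
    show "(\<Union>i\<in>I. N i) \<in> null_sets \<mu>" using \<open>countable I\<close> N by (intro null_sets_UN') auto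
    fix x n assume x: "x \<in> Xr" "(x (n + 1), x n) \<notin> E\<^sup>*"
    then have "(n, x n, x (n + 1)) \<in> I" using markov_shiftD[OF regular_partD[OF x(1)], of n] by (simp add: I_def)
    moreover from bspec[OF N this] have "p x \<in> N (n, x n, x (n + 1))" using x(1) by auto
    ultimately show "p x \<in> (\<Union>i\<in>I. N i)" by blast
  qed
qed

end

lemma (in bowen_map_nonempty) null_difference:
  "null_subset T M (p ` Xr - (\<lambda>s. p (q s)) ` Xr')" (is "null_subset T M ?N")
  unfolding null_subset_def
proof (intro conjI allI impI)
  show "?N \<subseteq> space M" using p_space by auto
  fix \<mu> assume "ergodic_prob T M \<mu>"
  then have inv: "invariant_prob T M \<mu>" by (simp add: ergodic_prob_def)
  then have sp: "space \<mu> = space M" and prob: "prob_space \<mu>"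
    using sets_eq_imp_space_eq by (auto simp: invariant_prob_def)
  obtain N where N: "N \<in> null_sets \<mu>" "\<And>x n. x \<in> Xr \<Longrightarrow> (x (n + 1), x n) \<notin> E\<^sup>* \<Longrightarrow> p x \<in> N"
    using wandering_null[OF inv] by blast
  have "?N \<subseteq> N" using uncovered_wanders N(2) by blast
  \<comment> \<open>\<open>?N\<close> itself need not be measurable; containment in a null set
    suffices after completion.\<close>
  then have "?N \<in> null_sets (completion \<mu>)" using N(1) null_sets_completion_iff2 by blast
  then have "emeasure (completion \<mu>) (space \<mu> - ?N) = emeasure (completion \<mu>) (space \<mu>)"
    by (rule emeasure_Diff_null_set) (metis sets.top space_completion)
  also have "\<dots> = 1" using prob by (simp add: prob_space.emeasure_space_1)
  finally show "emeasure (completion \<mu>) (space M - ?N) = 1" using sp by simp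
qed

theorem theorem5p3:
  fixes A :: "'a set" and E :: "('a \<times> 'a) set"
    and T :: "'y \<Rightarrow> 'y" and M :: "'y measure"
    and p :: "(int \<Rightarrow> 'a) \<Rightarrow> 'y"
  assumes "shift_graph A E"
    and "regular_part (markov_shift E) \<noteq> {}"
    and "dynamical_system T M"
    and "excellent A (regular_part (markov_shift E)) T M p"
  shows "\<exists>(A' :: nat set) (E' :: (nat \<times> nat) set) (p' :: (int \<Rightarrow> nat) \<Rightarrow> 'y)
           (q :: (int \<Rightarrow> nat) \<Rightarrow> (int \<Rightarrow> 'a)).
      let X = markov_shift E; Xr = regular_part X;
          X' = markov_shift E'; Xr' = regular_part X'
      in shift_graph A' E'
       \<and> excellent A' Xr' T M p'
       \<and> ((\<exists>C. multiplicity_bound A Xr p C) \<longrightarrow> (\<exists>C'. multiplicity_bound A' Xr' p' C'))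
       \<and> (locally_compact_space (symb_top X) \<longrightarrow> locally_compact_space (symb_top X'))
       \<and> one_lipschitz X' X q \<and> q ` Xr' \<subseteq> Xr \<and> (\<forall>x\<in>Xr'. p' x = p (q x))
       \<and> (\<forall>K. compactin (symb_top Xr) K \<longrightarrow> compactin (symb_top Xr') (q -` K \<inter> Xr'))
       \<and> p' ` Xr' \<subseteq> p ` Xr \<and> null_subset T M (p ` Xr - p' ` Xr')
       \<and> (\<exists>W\<in>language (rec_part X'). \<forall>x\<in>X'. sees_io x W \<longrightarrow> {z \<in> Xr'. p' z = p' x} = {x})
       \<and> (irreducible_graph A E \<longrightarrow> irreducible_graph A' E')"
proof -
  obtain R where "bowen_map_nonempty A E T M p R"
    using assms unfolding excellent_def bowen_map_nonempty_def bowen_map_nonempty_axioms_def bowen_map_def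
    by blast
  then interpret bowen_map_nonempty A E T M p R .
  have qr: "q ` Xr' \<subseteq> Xr" using q_regular_iff regular_partD by blast
  then have img: "(\<lambda>s. p (q s)) ` Xr' \<subseteq> p ` Xr" by blast
  have sg: "shift_graph verts edges" using E'_sub by (simp add: shift_graph_def)
  obtain W where "W \<in> language (rec_part X')"
    "\<And>s. s \<in> X' \<Longrightarrow> sees_io s W \<Longrightarrow> {z \<in> Xr'. p (q z) = p (q s)} = {s}"
    using magic_word by blast
  then have W: "\<exists>W\<in>language (rec_part X'). \<forall>x\<in>X'. sees_io x W \<longrightarrow> {z \<in> Xr'. p (q z) = p (q x)} = {x}"
    by blast
  show ?thesis
    unfolding Let_def
  proof (rule exI[of _ verts], rule exI[of _ edges], rule exI[of _ "\<lambda>s. p (q s)"], rule exI[of _ q],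
      intro conjI)
    show "(\<exists>C. multiplicity_bound A Xr p C) \<longrightarrow> (\<exists>C'. multiplicity_bound verts Xr' (\<lambda>s. p (q s)) C')"
      using multiplicity_bound_cover by blast
    show "locally_compact_space (symb_top X) \<longrightarrow> locally_compact_space (symb_top X')"
      using locally_compact_cover by blast
    show "\<forall>K. compactin (symb_top Xr) K \<longrightarrow> compactin (symb_top Xr') (q -` K \<inter> Xr')"
      using compact_vimage_q_regular by blast
    show "irreducible_graph A E \<longrightarrow> irreducible_graph verts edges"
      using irreducible_cover by blast
    show "\<forall>x\<in>Xr'. p (q x) = p (q x)" by simp
  qed (use sg excellent_cover one_lipschitz_q qr img null_difference W in simp_all)
qed

end
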